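(* Fix a polynomial $p$. There is an $\mathcal{RNC}^2$ algorithm PARALLEL-SROCT that, on input a connected graph $G=(V,E)$ with edge-weight function $w:E\to\{0,1,\ldots,p(|V|)\}$ and vertex-requirement function $r:V\to\{0,1,\ldots,p(|V|)\}$, with high probability (probability tending to $1$ as $|V|\to\infty$) outputs a spanning tree $T$ of $G$ with $c^{(s)}_w(T)\le (2+o(1))\, c^{(s)}_w(\mathrm{SROCT}(G))$, where $o(1)$ denotes a quantity tending to $0$ as $|V|\to\infty$; whenever it does not output such a spanning tree, it outputs ``fail''.
   Context: For a spanning tree $T$ of $G=(V,E)$ with nonnegative edge weights $w$ and nonnegative vertex requirements $r$, $d_T(u,v)$ is the weight of the unique simple $u$-$v$ path in $T$, and the sum-requirement communication cost is $c^{(s)}_w(T)=\sum_{u,v\in V}(r(u)+r(v))\,d_T(u,v)$ (sum over ordered pairs). $\mathrm{SROCT}(G)$ denotes a spanning tree of $G$ minimizing $c^{(s)}_w$. An $\mathcal{RNC}^2$ algorithm is a uniform family of polynomial-size circuits of depth $O(\log^2 n)$ that additionally receive polynomially many uniformly random input bits. *)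

theory Defs
  imports
    "HOL-Probability.Probability"
    "HOL-Computational_Algebra.Polynomial"
    "HOL-Library.Landau_Symbols"
    "HOL-Library.Log_Nat"
begin

section \<open>Graphs, spanning trees, communication cost\<close>

definition simple_graph :: "'a set \<Rightarrow> 'a set set \<Rightarrow> bool" where
  "simple_graph V E \<longleftrightarrow> finite V \<and> V \<noteq> {} \<and> (\<forall>e\<in>E. \<exists>u\<in>V. \<exists>v\<in>V. u \<noteq> v \<and> e = {u, v})"

text \<open>Walks are given by their nonempty vertex sequences; edges are two-element sets.\<close>

definition simple_path :: "'a set set \<Rightarrow> 'a \<Rightarrow> 'a list \<Rightarrow> 'a \<Rightarrow> bool" where
  "simple_path E u xs v \<longleftrightarrow>
     xs \<noteq> [] \<and> hd xs = u \<and> last xs = v \<and> distinct xs \<and> successively (\<lambda>x y. {x, y} \<in> E) xs"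

definition connected_graph :: "'a set \<Rightarrow> 'a set set \<Rightarrow> bool" where
  "connected_graph V E \<longleftrightarrow> (\<forall>u\<in>V. \<forall>v\<in>V. \<exists>xs. simple_path E u xs v)"

definition graph_cycle :: "'a set set \<Rightarrow> 'a list \<Rightarrow> bool" where
  "graph_cycle E xs \<longleftrightarrow>
     length xs \<ge> 3 \<and> distinct xs \<and> successively (\<lambda>x y. {x, y} \<in> E) xs \<and> {last xs, hd xs} \<in> E"

definition spanning_tree :: "'a set \<Rightarrow> 'a set set \<Rightarrow> 'a set set \<Rightarrow> bool" where
  "spanning_tree V E T \<longleftrightarrow> T \<subseteq> E \<and> connected_graph V T \<and> (\<nexists>xs. graph_cycle T xs)"

definition path_weight :: "('a set \<Rightarrow> nat) \<Rightarrow> 'a list \<Rightarrow> nat" where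
  "path_weight w xs = sum_list (map2 (\<lambda>x y. w {x, y}) xs (tl xs))"

definition tree_dist :: "('a set \<Rightarrow> nat) \<Rightarrow> 'a set set \<Rightarrow> 'a \<Rightarrow> 'a \<Rightarrow> nat" where
  "tree_dist w T u v = path_weight w (THE xs. simple_path T u xs v)"

definition sum_req_cost ::
    "'a set \<Rightarrow> ('a set \<Rightarrow> nat) \<Rightarrow> ('a \<Rightarrow> nat) \<Rightarrow> 'a set set \<Rightarrow> nat" where
  "sum_req_cost V w r T = (\<Sum>u\<in>V. \<Sum>v\<in>V. (r u + r v) * tree_dist w T u v)"

definition SROCT ::
    "'a set \<Rightarrow> 'a set set \<Rightarrow> ('a set \<Rightarrow> nat) \<Rightarrow> ('a \<Rightarrow> nat) \<Rightarrow> 'a set set" where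
  "SROCT V E w r = arg_min_on (sum_req_cost V w r) {T. spanning_tree V E T}"


section \<open>Boolean circuits\<close>

text \<open>
  A circuit is a straight-line program of gates of fan-in at most two. The operands of a gate
  are positions of earlier gates; \<open>In i\<close> reads the \<open>i\<close>-th input bit.
\<close>

datatype gate = In nat | Const bool | Neg nat | Conj nat nat | Disj nat nat

record circuit =
  num_inputs :: nat
  gates :: "gate list"
  outputs :: "nat list"

fun wf_gate :: "nat \<Rightarrow> nat \<Rightarrow> gate \<Rightarrow> bool" where
  "wf_gate l k (In i) \<longleftrightarrow> i < l"
| "wf_gate l k (Const b) \<longleftrightarrow> True"
| "wf_gate l k (Neg i) \<longleftrightarrow> i < k"
| "wf_gate l k (Conj i j) \<longleftrightarrow> i < k \<and> j < k"
| "wf_gate l k (Disj i j) \<longleftrightarrow> i < k \<and> j < k"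

definition wf_circuit :: "circuit \<Rightarrow> bool" where
  "wf_circuit c \<longleftrightarrow>
     (\<forall>k < length (gates c). wf_gate (num_inputs c) k (gates c ! k)) \<and>
     (\<forall>i \<in> set (outputs c). i < length (gates c))"

fun gate_val :: "bool list \<Rightarrow> bool list \<Rightarrow> gate \<Rightarrow> bool" where
  "gate_val x vs (In i) = x ! i"
| "gate_val x vs (Const b) = b"
| "gate_val x vs (Neg i) = (\<not> vs ! i)"
| "gate_val x vs (Conj i j) = (vs ! i \<and> vs ! j)"
| "gate_val x vs (Disj i j) = (vs ! i \<or> vs ! j)"

definition circuit_eval :: "circuit \<Rightarrow> bool list \<Rightarrow> bool list" where
  "circuit_eval c x =
     (let vs = foldl (\<lambda>vs g. vs @ [gate_val x vs g]) [] (gates c)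
      in map (\<lambda>i. vs ! i) (outputs c))"

fun gate_depth :: "nat list \<Rightarrow> gate \<Rightarrow> nat" where
  "gate_depth ds (In i) = 0"
| "gate_depth ds (Const b) = 0"
| "gate_depth ds (Neg i) = Suc (ds ! i)"
| "gate_depth ds (Conj i j) = Suc (max (ds ! i) (ds ! j))"
| "gate_depth ds (Disj i j) = Suc (max (ds ! i) (ds ! j))"

definition circuit_depth :: "circuit \<Rightarrow> nat" where
  "circuit_depth c = Max (insert 0 (set (foldl (\<lambda>ds g. ds @ [gate_depth ds g]) [] (gates c))))"

definition circuit_size :: "circuit \<Rightarrow> nat" where
  "circuit_size c = length (gates c)"

text \<open>
  Description of a circuit as a bit string: a sequence of numbers, each in self-delimiting unary.
  The tag \<open>0\<close> ends the gate list. All numbers are polynomially bounded for circuits of polynomial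
  size, so for logarithmic-space computability unary is equivalent to binary here.
\<close>

fun gate_code :: "gate \<Rightarrow> nat list" where
  "gate_code (In i) = [1, i]"
| "gate_code (Const b) = [if b then 3 else 2]"
| "gate_code (Neg i) = [4, i]"
| "gate_code (Conj i j) = [5, i, j]"
| "gate_code (Disj i j) = [6, i, j]"

definition encode_circuit :: "circuit \<Rightarrow> bool list" where
  "encode_circuit c =
     concat (map (\<lambda>k. replicate k True @ [False])
       (num_inputs c # concat (map gate_code (gates c)) @ [0] @ outputs c))"


section \<open>Logarithmic-space Turing machines\<close>

text \<open>
  Deterministic machines with a read-only input tape, finitely many work tapes (infinite to the
  right) and a write-only output. Tape symbols are \<open>0\<close> (blank), \<open>1\<close> (marker of the leftmost cell),
  \<open>2\<close> (the letter of the unary input), and further work symbols. The transition function maps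
  the state, the scanned input symbol and the scanned work symbols to \<open>None\<close> (halt) or to the
  new state, the input head move, the written symbol and head move for each work tape, and at
  most one output bit. Restricted to its relevant arguments, the transition function of a
  well-formed machine is a finite table.
\<close>

datatype move = Move_Left | Stay | Move_Right

record tm =
  num_states :: nat
  num_tapes :: nat
  num_syms :: nat
  delta :: "nat \<Rightarrow> nat \<Rightarrow> nat list \<Rightarrow> (nat \<times> move \<times> (nat \<times> move) list \<times> bool option) option"

definition wf_tm :: "tm \<Rightarrow> bool" where
  "wf_tm M \<longleftrightarrow>
     num_states M > 0 \<and> num_syms M \<ge> 2 \<and>
     (\<forall>q < num_states M. \<forall>a < 3. \<forall>ss q' mv acts b.
        length ss = num_tapes M \<longrightarrow> (\<forall>s \<in> set ss. s < num_syms M) \<longrightarrow>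
        delta M q a ss = Some (q', mv, acts, b) \<longrightarrow>
          q' < num_states M \<and> length acts = num_tapes M \<and>
          (\<forall>(s, _) \<in> set acts. s < num_syms M))"

record config =
  cstate :: nat
  ihead :: nat
  work :: "((nat \<Rightarrow> nat) \<times> nat) list"
  outp :: "bool list"

fun move_head :: "move \<Rightarrow> nat \<Rightarrow> nat" where
  "move_head Move_Left h = h - 1"
| "move_head Stay h = h"
| "move_head Move_Right h = Suc h"

text \<open>The input \<open>1\<^sup>n\<close> occupies cells \<open>1..n\<close>; the input head cannot leave the cells \<open>0..n+1\<close>, so
  that its position cannot serve as additional unbounded storage.\<close>

definition unary_input :: "nat \<Rightarrow> nat \<Rightarrow> nat" where
  "unary_input n i = (if i = 0 then 1 else if i \<le> n then 2 else 0)"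

definition init_config :: "tm \<Rightarrow> config" where
  "init_config M =
     \<lparr>cstate = 0, ihead = 0, work = replicate (num_tapes M) ((\<lambda>_. 0)(0 := 1), 0), outp = []\<rparr>"

definition tm_action ::
    "tm \<Rightarrow> nat \<Rightarrow> config \<Rightarrow> (nat \<times> move \<times> (nat \<times> move) list \<times> bool option) option" where
  "tm_action M n c = delta M (cstate c) (unary_input n (ihead c)) (map (\<lambda>(t, h). t h) (work c))"

definition tm_step :: "tm \<Rightarrow> nat \<Rightarrow> config \<Rightarrow> config" where
  "tm_step M n c =
     (case tm_action M n c of
        None \<Rightarrow> c
      | Some (q, mv, acts, b) \<Rightarrow>
          \<lparr>cstate = q,
           ihead = min (Suc n) (move_head mv (ihead c)),
           work = map2 (\<lambda>(t, h) (s, mv'). (t(h := s), move_head mv' h)) (work c) acts,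
           outp = outp c @ (case b of None \<Rightarrow> [] | Some x \<Rightarrow> [x])\<rparr>)"

definition tm_run :: "tm \<Rightarrow> nat \<Rightarrow> nat \<Rightarrow> config" where
  "tm_run M n t = (tm_step M n ^^ t) (init_config M)"

definition tm_computes :: "tm \<Rightarrow> nat \<Rightarrow> bool list \<Rightarrow> bool" where
  "tm_computes M n y \<longleftrightarrow> (\<exists>t. tm_action M n (tm_run M n t) = None \<and> outp (tm_run M n t) = y)"

definition logspace_uniform :: "(nat \<Rightarrow> circuit) \<Rightarrow> bool" where
  "logspace_uniform C \<longleftrightarrow>
     (\<exists>M c. wf_tm M \<and>
        (\<forall>n. tm_computes M n (encode_circuit (C n)) \<and>
             (\<forall>t. \<forall>(_, h) \<in> set (work (tm_run M n t)). h \<le> c * floorlog 2 n + c)))"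


section \<open>\<open>RNC\<^sup>2\<close>\<close>

text \<open>
  The family is indexed by a size parameter \<open>n\<close>; its \<open>n\<close>-th circuit takes \<open>l n\<close> proper input bits
  followed by \<open>m n\<close> random bits. The input length \<open>l n\<close> is meant to be polynomially related to \<open>n\<close>,
  so that the bounds may equivalently be taken in terms of \<open>l n\<close>.
\<close>

definition RNC2 :: "(nat \<Rightarrow> nat) \<Rightarrow> (nat \<Rightarrow> nat) \<Rightarrow> (nat \<Rightarrow> circuit) \<Rightarrow> bool" where
  "RNC2 l m C \<longleftrightarrow>
     logspace_uniform C \<and>
     (\<forall>n. wf_circuit (C n) \<and> num_inputs (C n) = l n + m n) \<and>
     (\<exists>k. (\<lambda>n. real (m n)) \<in> O(\<lambda>n. real n ^ k)) \<and>
     (\<exists>k. (\<lambda>n. real (circuit_size (C n))) \<in> O(\<lambda>n. real n ^ k)) \<and>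
     (\<lambda>n. real (circuit_depth (C n))) \<in> O(\<lambda>n. (log 2 (real n))\<^sup>2)"

definition random_bits :: "nat \<Rightarrow> bool list pmf" where
  "random_bits k = pmf_of_set {\<rho>. length \<rho> = k}"


section \<open>Encoding of instances and answers\<close>

text \<open>
  Numbers up to \<open>p n\<close> are written in binary in fields whose width is a constant multiple of the
  bit length of \<open>n\<close>. (The exact bit length of \<open>p n\<close> need not be computable for real coefficients.)
\<close>

definition width_factor :: "real poly \<Rightarrow> nat" where
  "width_factor p = (LEAST k. \<forall>n\<ge>1. poly p (real n) < 2 ^ (k * floorlog 2 n))"

definition field_width :: "real poly \<Rightarrow> nat \<Rightarrow> nat" where
  "field_width p n = width_factor p * floorlog 2 n"

lemma less_two_power_floorlog: "n < 2 ^ floorlog 2 n"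
proof (cases "n = 0")
  case False
  then show ?thesis using floorlog_bounds[of n 2] by simp
qed simp

lemma field_width_sufficient:
  assumes "n \<ge> 1"
  shows "poly p (real n) < 2 ^ field_width p n"
proof -
  have "\<exists>k. \<forall>n\<ge>1. poly p (real n) < 2 ^ (k * floorlog 2 n)"
  proof -
    define A where "A = (\<Sum>i\<le>degree p. \<bar>coeff p i\<bar>)"
    obtain a where a: "A < 2 ^ a"
      using real_arch_pow[of 2 A] by auto
    have "poly p (real n) < 2 ^ ((a + degree p) * floorlog 2 n)" if n: "n \<ge> 1" for n
    proof -
      have fl: "floorlog 2 n \<ge> 1"
        using n by (simp add: floorlog_def)
      have "poly p (real n) \<le> (\<Sum>i\<le>degree p. \<bar>coeff p i\<bar> * real n ^ degree p)"
        unfolding poly_altdef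
      proof (rule sum_mono)
        fix i assume i: "i \<in> {..degree p}"
        have "coeff p i * real n ^ i \<le> \<bar>coeff p i\<bar> * real n ^ i"
          by (intro mult_right_mono) auto
        also have "\<dots> \<le> \<bar>coeff p i\<bar> * real n ^ degree p"
          using i n by (intro mult_left_mono power_increasing) auto
        finally show "coeff p i * real n ^ i \<le> \<bar>coeff p i\<bar> * real n ^ degree p" .
      qed
      also have "\<dots> = A * real n ^ degree p"
        by (simp add: A_def sum_distrib_right)
      also have "\<dots> < 2 ^ a * real n ^ degree p"
        using a n by (intro mult_strict_right_mono) auto
      also have "\<dots> \<le> 2 ^ (a * floorlog 2 n) * (2 ^ floorlog 2 n) ^ degree p"
      proof (intro mult_mono power_mono)
        show "(2::real) ^ a \<le> 2 ^ (a * floorlog 2 n)"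
          using fl by (intro power_increasing) auto
        show "real n \<le> 2 ^ floorlog 2 n"
          using less_two_power_floorlog[of n]
          by (metis less_imp_le of_nat_le_iff of_nat_numeral of_nat_power)
      qed auto
      also have "\<dots> = 2 ^ ((a + degree p) * floorlog 2 n)"
        by (simp add: power_mult[symmetric] power_add[symmetric] algebra_simps)
      finally show ?thesis .
    qed
    then show ?thesis by blast
  qed
  then have "\<forall>n\<ge>1. poly p (real n) < 2 ^ (width_factor p * floorlog 2 n)"
    unfolding width_factor_def by (rule LeastI_ex)
  with assms show ?thesis by (simp add: field_width_def)
qed

definition bits_of :: "nat \<Rightarrow> nat \<Rightarrow> bool list" where
  "bits_of k x = map (bit x) [0..<k]"

text \<open>Adjacency matrix with the edge weights (weight field \<open>0\<close> at non-edges), row by row, then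
  the vertex requirements. The vertices are \<open>0, \<dots>, n - 1\<close>.\<close>

definition encode_instance ::
    "real poly \<Rightarrow> nat \<Rightarrow> nat set set \<Rightarrow> (nat set \<Rightarrow> nat) \<Rightarrow> (nat \<Rightarrow> nat) \<Rightarrow> bool list" where
  "encode_instance p n E w r =
     concat (map (\<lambda>(i, j). ({i, j} \<in> E) # bits_of (field_width p n) (if {i, j} \<in> E then w {i, j} else 0))
       (List.product [0..<n] [0..<n])) @
     concat (map (\<lambda>i. bits_of (field_width p n) (r i)) [0..<n])"

definition input_length :: "real poly \<Rightarrow> nat \<Rightarrow> nat" where
  "input_length p n = n * n * (1 + field_width p n) + n * field_width p n"

lemma length_encode_instance: "length (encode_instance p n E w r) = input_length p n"
proof -
  have "length (concat (map (\<lambda>(i, j). ({i, j} \<in> E) #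
      bits_of (field_width p n) (if {i, j} \<in> E then w {i, j} else 0)) (List.product [0..<n] [0..<n])))
    = n * n * (1 + field_width p n)"
    by (simp add: length_concat comp_def bits_of_def sum_list_triv split_def)
  moreover have "length (concat (map (\<lambda>i. bits_of (field_width p n) (r i)) [0..<n]))
    = n * field_width p n"
    by (simp add: length_concat comp_def bits_of_def sum_list_triv)
  ultimately show ?thesis
    unfolding encode_instance_def input_length_def by simp
qed

lemma input_length_bounds:
  "n \<le> input_length p n" "input_length p n \<le> (2 * width_factor p + 1) * n ^ 3"
proof -
  have fl: "floorlog 2 n \<le> n"
  proof (cases "n = 0")
    case False
    then have "2 ^ (floorlog 2 n - 1) \<le> n" using floorlog_bounds[of n 2] by simp
    moreover have "floorlog 2 n - 1 < 2 ^ (floorlog 2 n - 1)" by (rule less_exp)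
    ultimately show ?thesis by linarith
  qed (simp add: floorlog_def)
  show "n \<le> input_length p n"
    by (cases n) (auto simp: input_length_def)
  have "field_width p n \<le> width_factor p * n"
    unfolding field_width_def using fl by simp
  then have "input_length p n \<le> n * n * (1 + width_factor p * n) + n * (width_factor p * n)"
    unfolding input_length_def by (intro add_mono mult_mono) auto
  also have "\<dots> = n\<^sup>2 + width_factor p * n ^ 3 + width_factor p * n\<^sup>2"
    by (simp add: algebra_simps power2_eq_square power3_eq_cube)
  also have "\<dots> \<le> n ^ 3 + width_factor p * n ^ 3 + width_factor p * n ^ 3"
  proof -
    have "n\<^sup>2 \<le> n ^ 3" by (cases n) (auto intro: power_increasing)
    then show ?thesis by (intro add_mono mult_mono) auto
  qed
  finally show "input_length p n \<le> (2 * width_factor p + 1) * n ^ 3"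
    by (simp add: algebra_simps)
qed

text \<open>An answer is a success bit followed by an adjacency matrix; \<open>None\<close> stands for ``fail''.\<close>

fun encode_answer :: "nat \<Rightarrow> nat set set option \<Rightarrow> bool list" where
  "encode_answer n None = False # replicate (n * n) False"
| "encode_answer n (Some T) = True # map (\<lambda>(i, j). {i, j} \<in> T) (List.product [0..<n] [0..<n])"

definition sroct_instance ::
    "real poly \<Rightarrow> nat \<Rightarrow> nat set set \<Rightarrow> (nat set \<Rightarrow> nat) \<Rightarrow> (nat \<Rightarrow> nat) \<Rightarrow> bool" where
  "sroct_instance p n E w r \<longleftrightarrow>
     simple_graph {..<n} E \<and> connected_graph {..<n} E \<and>
     (\<forall>e\<in>E. real (w e) \<le> poly p (real n)) \<and>
     (\<forall>v<n. real (r v) \<le> poly p (real n))"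

definition approx_SROCT ::
    "real \<Rightarrow> nat \<Rightarrow> nat set set \<Rightarrow> (nat set \<Rightarrow> nat) \<Rightarrow> (nat \<Rightarrow> nat) \<Rightarrow> nat set set \<Rightarrow> bool" where
  "approx_SROCT a n E w r T \<longleftrightarrow>
     spanning_tree {..<n} E T \<and>
     real (sum_req_cost {..<n} w r T) \<le> a * real (sum_req_cost {..<n} w r (SROCT {..<n} E w r))"

end

theory Submission
  imports Defs
begin

text \<open>
  For a root \<open>x\<close> let \<open>F x = (\<Sum>u. \<Sum>v. r u * (d x u + d x v))\<close>, where \<open>d\<close> is the distance in the graph.
  A shortest-path tree with root \<open>x\<close> costs at most \<open>2 * F x\<close>. Conversely, every spanning tree \<open>T\<close> has a
  vertex \<open>x\<close> with \<open>2 * F x \<le> 2 * c T\<close>: choose \<open>x\<close> at random with probability proportional to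
  \<open>n * r x + (\<Sum>v. r v)\<close>; since a tree metric is a sum of cut metrics, the expected value of \<open>F x\<close> can
  be estimated cut by cut. Hence the shortest-path tree at a root minimizing \<open>F\<close> is a deterministic
  2-approximation. Replacing the weights \<open>w\<close> by \<open>N * w + 1\<close> with a large \<open>N\<close> makes them positive, so that
  parents at smaller distance define a tree, and does not affect the integral factor 2.

  All numbers are polynomially bounded and can be represented by their thresholds. Then distances and
  the sums \<open>F x\<close> are obtained by \<open>O(log n)\<close> rounds of path doubling, each of which is a disjunctive
  normal form of polynomial size, that is, a circuit of depth \<open>O(log n)\<close>.

  For the uniformity, a language of nested loops with polynomially bounded counters is compiled to a
  machine that keeps all its registers in binary, as parallel tracks of one work tape.
\<close>

section \<open>Compiling counter programs to logarithmic-space machines\<close>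

text \<open>The random root lives only in the analysis: all \<open>n\<close> roots are evaluated
  side by side, so the circuits take no random bits. Two obstacles shape the rest. Weights and
  requirements arrive in binary and a root cost is a sum of \<open>2 * n * n\<close> products, so
  one would expect separate circuits for conversion, multiplication and iterated addition, each with
  its own depth and uniformity proof. All of them are instead lengths of paths in a larger digraph,
  where adding means concatenating arcs; a single doubling rule then serves three nested stages:
  edge weights, distances, root costs. Secondly, uniformity speaks of a concrete machine that prints
  a concrete gate list. Kind and operands of gate \<open>k\<close> then become arithmetic
  expressions in \<open>n\<close> and \<open>k\<close>, which the loop language can
  evaluate.\<close>

datatype com = Emit bool | Adv | Inc nat | Zero nat | Seq com com
  | WhileLess nat nat com | WhileIn com

instance com :: countable
  by countable_datatype

fun cvars :: "com \<Rightarrow> nat set" where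
  "cvars (Emit b) = {}"
| "cvars Adv = {}"
| "cvars (Inc x) = {x}"
| "cvars (Zero x) = {x}"
| "cvars (Seq a b) = cvars a \<union> cvars b"
| "cvars (WhileLess x y c) = {x, y} \<union> cvars c"
| "cvars (WhileIn c) = cvars c"

lemma finite_cvars: "finite (cvars c)"
  by (induction c) auto

type_synonym store = "(nat \<Rightarrow> nat) \<times> nat \<times> bool list"

inductive big_step :: "nat \<Rightarrow> nat \<Rightarrow> com \<Rightarrow> store \<Rightarrow> store \<Rightarrow> bool" for n M where
  "big_step n M (Emit b) (\<sigma>, h, out) (\<sigma>, h, out @ [b])"
| "big_step n M Adv (\<sigma>, h, out) (\<sigma>, min (Suc n) (Suc h), out)"
| "\<sigma> x < M \<Longrightarrow> big_step n M (Inc x) (\<sigma>, h, out) (\<sigma>(x := Suc (\<sigma> x)), h, out)"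
| "big_step n M (Zero x) (\<sigma>, h, out) (\<sigma>(x := 0), h, out)"
| "big_step n M a s s' \<Longrightarrow> big_step n M b s' s'' \<Longrightarrow> big_step n M (Seq a b) s s''"
| "\<not> \<sigma> x < \<sigma> y \<Longrightarrow> big_step n M (WhileLess x y c) (\<sigma>, h, out) (\<sigma>, h, out)"
| "\<sigma> x < \<sigma> y \<Longrightarrow> big_step n M c (\<sigma>, h, out) s' \<Longrightarrow> big_step n M (WhileLess x y c) s' s'' \<Longrightarrow>
     big_step n M (WhileLess x y c) (\<sigma>, h, out) s''"
| "unary_input n h = 0 \<Longrightarrow> big_step n M (WhileIn c) (\<sigma>, h, out) (\<sigma>, h, out)"
| "unary_input n h \<noteq> 0 \<Longrightarrow> big_step n M c (\<sigma>, h, out) s' \<Longrightarrow> big_step n M (WhileIn c) s' s'' \<Longrightarrow>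
     big_step n M (WhileIn c) (\<sigma>, h, out) s''"

text \<open>The control of the machine is a stack of commands that are still to be executed. Every
  primitive command is performed by one sweep over the tape and a return to the marker.\<close>

datatype sweep = Fetch | Scan bool | Ret

instance sweep :: countable
  by countable_datatype

text \<open>A symbol \<open>2 + v\<close> is a column holding one bit of every register: bit
  \<open>x\<close> of \<open>v\<close> belongs to register \<open>x\<close>. Low-order columns come
  first, so a carry travels to the right, and the flag of \<open>Scan\<close> is the outcome of the
  comparison on the bits read so far, overruled by each later column in which the two bits
  differ.\<close>

fun transition :: "com list \<Rightarrow> sweep \<Rightarrow> nat \<Rightarrow> nat \<Rightarrow>
    ((com list \<times> sweep) \<times> move \<times> nat \<times> move \<times> bool option) option" where
  "transition (Emit b # ks) Fetch a s = Some ((ks, Fetch), Stay, s, Stay, Some b)"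
| "transition (Adv # ks) Fetch a s = Some ((ks, Fetch), Move_Right, s, Stay, None)"
| "transition (Seq c d # ks) Fetch a s = Some ((c # d # ks, Fetch), Stay, s, Stay, None)"
| "transition (WhileIn c # ks) Fetch a s =
     Some (if a = 0 then (ks, Fetch) else (c # WhileIn c # ks, Fetch), Stay, s, Stay, None)"
| "transition (k # ks) Fetch a s = Some ((k # ks, Scan False), Stay, s, Move_Right, None)"
| "transition (Inc x # ks) (Scan f) a s =
     (if s = 0 then Some ((ks, Ret), Stay, 2 + 2 ^ x, Move_Left, None)
      else if bit (s - 2) x
        then Some ((Inc x # ks, Scan f), Stay, 2 + unset_bit x (s - 2), Move_Right, None)
        else Some ((ks, Ret), Stay, 2 + set_bit x (s - 2), Move_Left, None))"
| "transition (Zero x # ks) (Scan f) a s =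
     (if s = 0 then Some ((ks, Ret), Stay, 0, Move_Left, None)
      else Some ((Zero x # ks, Scan f), Stay, 2 + unset_bit x (s - 2), Move_Right, None))"
| "transition (WhileLess x y c # ks) (Scan f) a s =
     (if s = 0 then Some ((if f then c # WhileLess x y c # ks else ks, Ret), Stay, 0, Move_Left, None)
      else Some ((WhileLess x y c # ks,
             Scan (if bit (s - 2) x = bit (s - 2) y then f else bit (s - 2) y)),
           Stay, s, Move_Right, None))"
| "transition ks Ret a s =
     Some (if s = 1 then ((ks, Fetch), Stay, s, Stay, None) else ((ks, Ret), Stay, s, Move_Left, None))"
| "transition _ _ a s = None"

text \<open>Closure under every push and pop of \<open>transition\<close>, so that such a set can
  serve as the control of a machine; \<open>K\<close> bounds the registers that occur.\<close>

definition cont_closed :: "nat \<Rightarrow> com list set \<Rightarrow> bool" where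
  "cont_closed K C \<longleftrightarrow> (\<forall>k ks. k # ks \<in> C \<longrightarrow> ks \<in> C \<and> cvars k \<subseteq> {..<K} \<and>
     (\<forall>c d. k = Seq c d \<longrightarrow> c # d # ks \<in> C) \<and>
     (\<forall>c. k = WhileIn c \<longrightarrow> c # k # ks \<in> C) \<and>
     (\<forall>x y c. k = WhileLess x y c \<longrightarrow> c # k # ks \<in> C))"

text \<open>Stacks stay bounded: a loop pushes its body on top of itself, and the body is used up
  before the loop is read again. This keeps the set of control states finite.\<close>

fun continuations :: "com \<Rightarrow> com list set" where
  "continuations (Seq a b) = {[Seq a b]} \<union> (\<lambda>k. k @ [b]) ` continuations a \<union> continuations b"
| "continuations (WhileLess x y c) = {[WhileLess x y c], []} \<union> (\<lambda>k. k @ [WhileLess x y c]) ` continuations c"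
| "continuations (WhileIn c) = {[WhileIn c], []} \<union> (\<lambda>k. k @ [WhileIn c]) ` continuations c"
| "continuations c = {[c], []}"

lemma finite_continuations: "finite (continuations c)"
  by (induction c) auto

lemma continuations_self: "[c] \<in> continuations c" and continuations_Nil: "[] \<in> continuations c"
  by (induction c) auto

lemma cont_closed_append:
  assumes A: "cont_closed K A" and B: "cont_closed K B" "[b] \<in> B" "[] \<in> B"
  shows "cont_closed K ((\<lambda>k. k @ [b]) ` A \<union> B)"
  unfolding cont_closed_def
proof (intro allI impI)
  let ?B = "(\<lambda>k. k @ [b]) ` A \<union> B"
  fix k ks assume "k # ks \<in> ?B"
  then consider "k # ks \<in> B" | ks' where "k # ks' \<in> A" "ks = ks' @ [b]"
    using B(2) by (auto simp: Cons_eq_append_conv)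
  then show "ks \<in> ?B \<and> cvars k \<subseteq> {..<K} \<and> (\<forall>c d. k = Seq c d \<longrightarrow> c # d # ks \<in> ?B) \<and>
     (\<forall>c. k = WhileIn c \<longrightarrow> c # k # ks \<in> ?B) \<and>
     (\<forall>x y c. k = WhileLess x y c \<longrightarrow> c # k # ks \<in> ?B)"
  proof cases
    case 1
    from B(1)[unfolded cont_closed_def, rule_format, OF this] show ?thesis by simp
  next
    case 2
    have "l @ [b] \<in> ?B" if "l \<in> A" for l using that by blast
    moreover note A(1)[unfolded cont_closed_def, rule_format, OF 2(1)]
    ultimately show ?thesis unfolding 2(2) by (metis append_Cons)
  qed
qed

lemma cont_closed_loop:
  assumes A: "cont_closed K A" "[c] \<in> A" and b: "b = WhileIn c \<or> b = WhileLess x y c" "cvars b \<subseteq> {..<K}"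
  shows "cont_closed K ({[b], []} \<union> (\<lambda>k. k @ [b]) ` A)" (is "cont_closed K ?B")
  unfolding cont_closed_def
proof (intro allI impI)
  fix k ks assume "k # ks \<in> ?B"
  then have "k = b \<and> ks = [] \<or> (\<exists>ks'. k # ks' \<in> A \<and> ks = ks' @ [b])"
    by (auto simp: Cons_eq_append_conv)
  then show "ks \<in> ?B \<and> cvars k \<subseteq> {..<K} \<and> (\<forall>c d. k = Seq c d \<longrightarrow> c # d # ks \<in> ?B) \<and>
     (\<forall>c. k = WhileIn c \<longrightarrow> c # k # ks \<in> ?B) \<and>
     (\<forall>x y c. k = WhileLess x y c \<longrightarrow> c # k # ks \<in> ?B)"
  proof
    assume k: "k = b \<and> ks = []"
    have "c # [b] \<in> ?B" using A(2) by (auto intro!: image_eqI[of _ _ "[c]"])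
    then show ?thesis using k b by auto
  next
    assume "\<exists>ks'. k # ks' \<in> A \<and> ks = ks' @ [b]"
    then obtain ks' where k: "k # ks' \<in> A" "ks = ks' @ [b]" by blast
    have "l @ [b] \<in> ?B" if "l \<in> A" for l using that by blast
    moreover note A(1)[unfolded cont_closed_def, rule_format, OF k(1)]
    ultimately show ?thesis unfolding k(2) by (metis append_Cons)
  qed
qed

lemma cont_closed_insert:
  assumes "cont_closed K A" "[a, b] \<in> A" "[] \<in> A" "cvars (Seq a b) \<subseteq> {..<K}"
  shows "cont_closed K (insert [Seq a b] A)"
  unfolding cont_closed_def
proof (intro allI impI)
  fix k ks assume "k # ks \<in> insert [Seq a b] A"
  then consider "k = Seq a b" "ks = []" | "k # ks \<in> A" by blast
  then show "ks \<in> insert [Seq a b] A \<and> cvars k \<subseteq> {..<K} \<and>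
     (\<forall>c d. k = Seq c d \<longrightarrow> c # d # ks \<in> insert [Seq a b] A) \<and>
     (\<forall>c. k = WhileIn c \<longrightarrow> c # k # ks \<in> insert [Seq a b] A) \<and>
     (\<forall>x y c. k = WhileLess x y c \<longrightarrow> c # k # ks \<in> insert [Seq a b] A)"
  proof cases
    case 1
    then show ?thesis using assms(2-4) by simp
  next
    case 2
    from assms(1)[unfolded cont_closed_def, rule_format, OF this] show ?thesis by simp
  qed
qed

lemma cont_closed_continuations: "cvars c \<subseteq> {..<K} \<Longrightarrow> cont_closed K (continuations c)"
proof (induction c)
  case (Seq a b)
  then have "cont_closed K ((\<lambda>k. k @ [b]) ` continuations a \<union> continuations b)"
    by (intro cont_closed_append) (auto simp: continuations_self continuations_Nil)
  moreover have "a # b # [] \<in> (\<lambda>k. k @ [b]) ` continuations a" using continuations_self[of a] by force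
  ultimately show ?case
    using Seq.prems cont_closed_insert[of K "(\<lambda>k. k @ [b]) ` continuations a \<union> continuations b" a b] by (simp add: continuations_Nil)
next
  case (WhileLess x y c)
  then show ?case using cont_closed_loop[of K "continuations c" c "WhileLess x y c"] by (simp add: continuations_self)
next
  case (WhileIn c)
  then show ?case using cont_closed_loop[of K "continuations c" c "WhileIn c"] by (simp add: continuations_self)
qed (auto simp: cont_closed_def)

text \<open>\<open>init_config\<close> prescribes start state \<open>0\<close>, so the initial stack
  gets this number and all other codes are shifted by one.\<close>

definition state_enc :: "com \<Rightarrow> com list \<times> sweep \<Rightarrow> nat" where
  "state_enc c s = (if s = ([c], Fetch) then 0 else Suc (to_nat s))"

definition state_dec :: "com \<Rightarrow> nat \<Rightarrow> com list \<times> sweep" where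
  "state_dec c q = (case q of 0 \<Rightarrow> ([c], Fetch) | Suc k \<Rightarrow> from_nat k)"

lemma state_dec_enc [simp]: "state_dec c (state_enc c s) = s"
  by (simp add: state_dec_def state_enc_def)

definition num_regs :: "com \<Rightarrow> nat" where
  "num_regs c = Suc (Max (insert 0 (cvars c)))"

lemma cvars_num_regs: "cvars c \<subseteq> {..<num_regs c}"
  using finite_cvars[of c] by (auto simp: num_regs_def less_Suc_eq_le)

text \<open>The codes leave gaps below \<open>num_states\<close>. A number that decodes to a stack
  outside \<open>continuations c\<close> halts, so well-formedness has to be checked only on the
  closed finite set.\<close>

definition machine :: "com \<Rightarrow> tm" where
  "machine c = \<lparr>num_states = Suc (Max (state_enc c ` (continuations c \<times> {Fetch, Scan False, Scan True, Ret}))),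
     num_tapes = 1, num_syms = 2 + 2 ^ num_regs c,
     delta = (\<lambda>q a ss. let (ks, m) = state_dec c q in
        if ks \<in> continuations c then
          map_option (\<lambda>(s', mv, w, mv', b). (state_enc c s', mv, [(w, mv')], b)) (transition ks m a (hd ss))
        else None)\<rparr>"

lemma sweep_UNIV: "m \<in> {Fetch, Scan False, Scan True, Ret}"
  by (cases m) auto

lemma state_enc_less: "ks \<in> continuations c \<Longrightarrow> state_enc c (ks, m) < num_states (machine c)"
  unfolding machine_def using sweep_UNIV[of m] finite_continuations[of c]
  by (auto simp: less_Suc_eq_le intro!: Max_ge finite_imageI)

lemma less_exp_iff_bits: "(v :: nat) < 2 ^ k \<longleftrightarrow> (\<forall>i\<ge>k. \<not> bit v i)"
proof
  assume "v < 2 ^ k" then show "\<forall>i\<ge>k. \<not> bit v i"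
    by (metis bit_take_bit_iff not_le take_bit_nat_eq_self)
next
  assume "\<forall>i\<ge>k. \<not> bit v i"
  then have "take_bit k v = v" by (intro bit_eqI) (auto simp: bit_take_bit_iff not_le)
  then show "v < 2 ^ k" by (metis take_bit_nat_less_exp)
qed

lemma set_bit_less: "(v :: nat) < 2 ^ k \<Longrightarrow> x < k \<Longrightarrow> set_bit x v < 2 ^ k"
  and unset_bit_less: "(v :: nat) < 2 ^ k \<Longrightarrow> unset_bit x v < 2 ^ k"
  by (auto simp: less_exp_iff_bits bit_simps)

lemma transition_closed:
  assumes "transition ks m a s = Some ((ks', m'), mv, w, mv', b)" "ks \<in> C" "cont_closed K C" "s < 2 + 2 ^ K"
  shows "ks' \<in> C \<and> w < 2 + 2 ^ K"
proof -
  have "(0::nat) < 2 ^ K" by simp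
  then have *: "s - 2 < 2 ^ K" using assms(4) by linarith
  have "(2::nat) ^ x < 2 ^ K" if "x < K" for x using that by simp
  note pow = this
  show ?thesis
  proof (cases ks)
    case Nil
    then show ?thesis using assms by (cases m) (auto split: if_splits)
  next
    case (Cons k l)
    have "l \<in> C \<and> cvars k \<subseteq> {..<K} \<and> (\<forall>c d. k = Seq c d \<longrightarrow> c # d # l \<in> C) \<and>
      (\<forall>c. k = WhileIn c \<longrightarrow> c # k # l \<in> C) \<and> (\<forall>x y c. k = WhileLess x y c \<longrightarrow> c # k # l \<in> C)"
      using assms(2,3) unfolding cont_closed_def Cons by blast
    then show ?thesis using assms(1,2,4) * pow unfolding Cons
      by (cases k; cases m) (simp_all add: set_bit_less unset_bit_less split: if_splits, auto simp: set_bit_less unset_bit_less)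
  qed
qed

lemma wf_machine: "wf_tm (machine c)"
proof -
  have "q' < num_states (machine c) \<and> length acts = 1 \<and> (\<forall>(s, _) \<in> set acts. s < num_syms (machine c))"
    if ss: "length ss = 1" "\<forall>s\<in>set ss. s < num_syms (machine c)"
      and d: "delta (machine c) q a ss = Some (q', mv, acts, b)" for q a ss q' mv acts b
  proof -
    obtain ks m where km: "state_dec c q = (ks, m)" by (cases "state_dec c q")
    obtain s where s: "ss = [s]" using ss by (cases ss) auto
    from d obtain ks' m' w mv' where 1: "ks \<in> continuations c" "transition ks m a s = Some ((ks', m'), mv, w, mv', b)"
      "q' = state_enc c (ks', m')" "acts = [(w, mv')]"
      by (auto simp: machine_def km s split: if_splits)
    have "ks' \<in> continuations c \<and> w < 2 + 2 ^ num_regs c"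
      using transition_closed[OF 1(2,1) cont_closed_continuations[OF cvars_num_regs]] ss by (simp add: s machine_def)
    then show ?thesis using 1 state_enc_less by (simp add: machine_def)
  qed
  moreover have "num_states (machine c) > 0" "num_syms (machine c) \<ge> 2" "num_tapes (machine c) = 1"
    by (auto simp: machine_def)
  ultimately show ?thesis unfolding wf_tm_def by (metis (no_types, lifting))
qed

section \<open>Register contents as columns of the tape\<close>

definition column :: "nat \<Rightarrow> (nat \<Rightarrow> nat) \<Rightarrow> nat \<Rightarrow> nat" where
  "column K \<sigma> i = horner_sum of_bool 2 (map (\<lambda>x. bit (\<sigma> x) i) [0..<K])"

lemma bit_column: "bit (column K \<sigma> i) x \<longleftrightarrow> x < K \<and> bit (\<sigma> x) i"
  by (auto simp: column_def bit_horner_sum_bit_iff)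

text \<open>\<open>len\<close> is the common bit length reserved for all registers. It never shrinks
  and grows by one column when a carry runs off the end.\<close>

definition tape :: "nat \<Rightarrow> (nat \<Rightarrow> nat) \<Rightarrow> nat \<Rightarrow> nat \<Rightarrow> nat" where
  "tape K \<sigma> len i = (if i = 0 then 1 else if i \<le> len then 2 + column K \<sigma> (i - 1) else 0)"

lemma tape_0 [simp]: "tape K \<sigma> len 0 = 1"
  and tape_Suc: "i < len \<Longrightarrow> tape K \<sigma> len (Suc i) = 2 + column K \<sigma> i"
  and tape_end: "tape K \<sigma> len (Suc len) = 0"
  and tape_neq_1: "tape K \<sigma> len (Suc i) \<noteq> 1"
  by (auto simp: tape_def)

lemma tape_set_bit:
  assumes "i < len" "x < K"
  shows "(tape K \<sigma> len)(Suc i := 2 + set_bit x (column K \<sigma> i)) = tape K (\<sigma>(x := set_bit i (\<sigma> x))) len"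
proof -
  have "set_bit x (column K \<sigma> i) = column K (\<sigma>(x := set_bit i (\<sigma> x))) i"
    using assms by (auto intro!: bit_eqI simp: bit_column bit_set_bit_iff split: if_splits)
  moreover have "column K \<sigma> j = column K (\<sigma>(x := set_bit i (\<sigma> x))) j" if "j \<noteq> i" for j
    using that by (auto intro!: bit_eqI simp: bit_column bit_set_bit_iff split: if_splits)
  ultimately show ?thesis using assms by (auto simp: tape_def fun_eq_iff)
qed

lemma tape_unset_bit:
  assumes "i < len" "x < K"
  shows "(tape K \<sigma> len)(Suc i := 2 + unset_bit x (column K \<sigma> i)) = tape K (\<sigma>(x := unset_bit i (\<sigma> x))) len"
proof -
  have "unset_bit x (column K \<sigma> i) = column K (\<sigma>(x := unset_bit i (\<sigma> x))) i"
    using assms by (auto intro!: bit_eqI simp: bit_column bit_unset_bit_iff split: if_splits)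
  moreover have "column K \<sigma> j = column K (\<sigma>(x := unset_bit i (\<sigma> x))) j" if "j \<noteq> i" for j
    using that by (auto intro!: bit_eqI simp: bit_column bit_unset_bit_iff split: if_splits)
  ultimately show ?thesis using assms by (auto simp: tape_def fun_eq_iff)
qed

text \<open>All registers fit into \<open>len\<close> bits, so the fresh column is zero except for
  the carry of \<open>x\<close>.\<close>

lemma tape_extend:
  assumes "\<forall>y<K. \<sigma> y < 2 ^ len" "x < K"
  shows "(tape K \<sigma> len)(Suc len := 2 + 2 ^ x) = tape K (\<sigma>(x := set_bit len (\<sigma> x))) (Suc len)"
proof -
  have "\<not> bit (\<sigma> y) len" if "y < K" for y
    using assms(1) that by (auto simp: less_exp_iff_bits)
  then have "2 ^ x = column K (\<sigma>(x := set_bit len (\<sigma> x))) len"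
    using assms(2) by (auto intro!: bit_eqI simp: bit_column bit_set_bit_iff bit_exp_iff split: if_splits)
  moreover have "column K \<sigma> j = column K (\<sigma>(x := set_bit len (\<sigma> x))) j" if "j < len" for j
    using that by (auto intro!: bit_eqI simp: bit_column bit_set_bit_iff split: if_splits)
  ultimately show ?thesis using assms by (auto simp: tape_def fun_eq_iff le_Suc_eq)
qed

text \<open>The content of a register in the middle of a sweep: \<open>Zero\<close> and the carry of
  \<open>Inc\<close> have erased the low \<open>i\<close> bits.\<close>

definition clear_low :: "nat \<Rightarrow> nat \<Rightarrow> nat" where
  "clear_low i v = push_bit i (drop_bit i v)"

lemma bit_clear_low: "bit (clear_low i v) j \<longleftrightarrow> i \<le> j \<and> bit v j"
  by (auto simp: clear_low_def bit_simps)

lemma clear_low_0: "clear_low 0 v = v"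
  by (simp add: clear_low_def)

lemma unset_bit_clear_low: "unset_bit i (clear_low i v) = clear_low (Suc i) v"
  by (auto intro!: bit_eqI simp: bit_clear_low bit_unset_bit_iff)

lemma clear_low_all: "v < 2 ^ i \<Longrightarrow> clear_low i v = 0"
  using less_exp_iff_bits[of v i] by (intro bit_eqI) (simp add: bit_clear_low)

text \<open>Binary increment: the trailing ones amount to \<open>2 ^ m - 1\<close> and are exchanged
  for the single bit \<open>2 ^ m\<close>.\<close>

lemma set_bit_clear_low:
  assumes "\<forall>i<m. bit v i" "\<not> bit v m"
  shows "set_bit m (clear_low m v) = Suc v"
proof -
  have "take_bit m v = mask m"
    using assms by (auto intro!: bit_eqI simp: bit_simps)
  then have 1: "v = clear_low m v + (2 ^ m - 1)"
    using bits_ident[of m v] by (simp add: clear_low_def mask_eq_exp_minus_1)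
  have "set_bit m (clear_low m v) = clear_low m v + 2 ^ m"
    using assms(2) by (simp add: set_bit_eq bit_clear_low)
  moreover have "(2::nat) ^ m > 0" by simp
  ultimately show ?thesis using 1 by linarith
qed

section \<open>Single commands as sequences of machine steps\<close>

definition machine_config :: "com \<Rightarrow> com list \<Rightarrow> sweep \<Rightarrow> nat \<Rightarrow> (nat \<Rightarrow> nat) \<Rightarrow> nat \<Rightarrow> bool list \<Rightarrow> config" where
  "machine_config c ks m h t pos out = \<lparr>cstate = state_enc c (ks, m), ihead = h, work = [(t, pos)], outp = out\<rparr>"

text \<open>The head bound is imposed on each configuration that is left, not on the last one; the
  halting configuration is treated separately.\<close>

definition steps :: "nat \<Rightarrow> nat \<Rightarrow> com \<Rightarrow> config \<Rightarrow> config \<Rightarrow> bool" where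
  "steps n H c = (\<lambda>x y. y = tm_step (machine c) n x \<and> (\<forall>(_, h) \<in> set (work x). h \<le> H))\<^sup>*\<^sup>*"

lemma steps_trans [trans]: "steps n H c x y \<Longrightarrow> steps n H c y z \<Longrightarrow> steps n H c x z"
  by (simp add: steps_def)

lemma steps_transition:
  assumes "ks \<in> continuations c" "pos \<le> H"
    "case transition ks m (unary_input n h) (t pos) of None \<Rightarrow> False
     | Some ((ks', m'), mv, w, mv', b) \<Rightarrow> y =
         machine_config c ks' m' (min (Suc n) (move_head mv h)) (t(pos := w)) (move_head mv' pos)
           (out @ (case b of None \<Rightarrow> [] | Some x \<Rightarrow> [x]))"
  shows "steps n H c (machine_config c ks m h t pos out) y"
proof -
  have "tm_step (machine c) n (machine_config c ks m h t pos out) = y"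
    using assms by (auto simp: tm_step_def tm_action_def machine_def machine_config_def split: option.splits)
  then show ?thesis
    unfolding steps_def using assms(2) by (intro r_into_rtranclp) (auto simp: machine_config_def)
qed

lemma steps_return:
  assumes "ks \<in> continuations c" "pos \<le> H" "h \<le> Suc n" "t 0 = 1" "\<forall>i<pos. t (Suc i) \<noteq> 1"
  shows "steps n H c (machine_config c ks Ret h t pos out) (machine_config c ks Fetch h t 0 out)"
  using assms
proof (induction pos)
  case 0
  then show ?case by (intro steps_transition) (auto simp: fun_upd_idem)
next
  case (Suc pos)
  have "steps n H c (machine_config c ks Ret h t (Suc pos) out) (machine_config c ks Ret h t pos out)"
    using Suc.prems by (intro steps_transition) (auto simp: fun_upd_idem)
  then show ?case using Suc by (auto intro: steps_trans)
qed

text \<open>The common shape of \<open>Zero\<close>, \<open>Inc\<close> and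
  \<open>WhileLess\<close>: \<open>t i\<close> and \<open>f i\<close> are tape and flag after
  \<open>i\<close> columns, and \<open>m\<close> is the column where the sweep turns back. This is
  the first zero bit for \<open>Inc\<close> and the first blank for the other two.\<close>

lemma steps_sweep:
  assumes "k # ks \<in> continuations c" "\<And>a s. transition (k # ks) Fetch a s = Some ((k # ks, Scan False), Stay, s, Move_Right, None)"
    and scan: "\<And>i. i < m \<Longrightarrow> transition (k # ks) (Scan (f i)) (unary_input n h) (t i (Suc i)) =
        Some ((k # ks, Scan (f (Suc i))), Stay, w i, Move_Right, None)"
      "\<And>i. i < m \<Longrightarrow> (t i)(Suc i := w i) = t (Suc i)"
    and stop: "transition (k # ks) (Scan (f m)) (unary_input n h) (t m (Suc m)) = Some ((ks', Ret), Stay, w m, Move_Left, None)"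
      "(t m)(Suc m := w m) = t'"
    and "f 0 = False" "m < H" "h \<le> Suc n" "ks' \<in> continuations c" "\<And>i. t' (Suc i) \<noteq> 1" "t' 0 = 1"
  shows "steps n H c (machine_config c (k # ks) Fetch h (t 0) 0 out) (machine_config c ks' Fetch h t' 0 out)"
proof -
  have "steps n H c (machine_config c (k # ks) Fetch h (t 0) 0 out) (machine_config c (k # ks) (Scan (f i)) h (t i) (Suc i) out)"
    if "i \<le> m" for i
    using that
  proof (induction i)
    case 0
    show ?case using assms by (intro steps_transition) auto
  next
    case (Suc i)
    have "steps n H c (machine_config c (k # ks) (Scan (f i)) h (t i) (Suc i) out)
      (machine_config c (k # ks) (Scan (f (Suc i))) h (t (Suc i)) (Suc (Suc i)) out)"
      using assms Suc.prems by (intro steps_transition) (auto simp: scan)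
    then show ?case using Suc by (auto intro: steps_trans)
  qed
  from this[of m] have "steps n H c (machine_config c (k # ks) Fetch h (t 0) 0 out) (machine_config c (k # ks) (Scan (f m)) h (t m) (Suc m) out)"
    by simp
  also have "steps n H c \<dots> (machine_config c ks' Ret h t' m out)" (is "steps _ _ _ _ ?y")
    using assms by (intro steps_transition) (auto simp: stop)
  also have "steps n H c \<dots> (machine_config c ks' Fetch h t' 0 out)"
    using assms by (intro steps_return) auto
  finally show ?thesis .
qed

lemma continuations_closed:
  assumes "k # ks \<in> continuations c"
  shows "ks \<in> continuations c" "cvars k \<subseteq> {..<num_regs c}"
    "k = Seq a b \<Longrightarrow> a # b # ks \<in> continuations c"
    "k = WhileIn a \<Longrightarrow> a # k # ks \<in> continuations c"
    "k = WhileLess x y a \<Longrightarrow> a # k # ks \<in> continuations c"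
  using cont_closed_continuations[OF cvars_num_regs, of c] assms unfolding cont_closed_def by blast+

lemma steps_Zero:
  assumes "Zero x # ks \<in> continuations c" "h \<le> Suc n" "len < H" "\<forall>y<num_regs c. \<sigma> y < 2 ^ len"
  shows "steps n H c (machine_config c (Zero x # ks) Fetch h (tape (num_regs c) \<sigma> len) 0 out)
    (machine_config c ks Fetch h (tape (num_regs c) (\<sigma>(x := 0)) len) 0 out)"
proof -
  let ?t = "\<lambda>i. tape (num_regs c) (\<sigma>(x := clear_low i (\<sigma> x))) len"
  have x: "x < num_regs c" using continuations_closed(2)[OF assms(1)] by simp
  have "steps n H c (machine_config c (Zero x # ks) Fetch h (?t 0) 0 out)
    (machine_config c ks Fetch h (tape (num_regs c) (\<sigma>(x := 0)) len) 0 out)"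
  proof (rule steps_sweep[where m = len and f = "\<lambda>_. False" and
      w = "\<lambda>i. if i < len then 2 + unset_bit x (column (num_regs c) (\<sigma>(x := clear_low i (\<sigma> x))) i) else 0"])
    show "(?t i)(Suc i := if i < len then 2 + unset_bit x (column (num_regs c) (\<sigma>(x := clear_low i (\<sigma> x))) i) else 0)
      = ?t (Suc i)" if "i < len" for i
      using tape_unset_bit[OF that x, of "\<sigma>(x := clear_low i (\<sigma> x))"] that by (simp add: unset_bit_clear_low)
    show "(?t len)(Suc len := if len < len then 2 + unset_bit x (column (num_regs c) (\<sigma>(x := clear_low len (\<sigma> x))) len) else 0)
      = tape (num_regs c) (\<sigma>(x := 0)) len"
      using assms(4) x by (simp add: clear_low_all fun_upd_idem tape_end)
  qed (use assms continuations_closed(1)[OF assms(1)] in \<open>auto simp: tape_Suc tape_end tape_neq_1[unfolded One_nat_def] simp del: fun_upd_apply\<close>)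
  then show ?thesis by (simp add: clear_low_0)
qed

lemma steps_Inc:
  assumes "Inc x # ks \<in> continuations c" "h \<le> Suc n" "len < H" "\<forall>y<num_regs c. \<sigma> y < 2 ^ len"
    "\<sigma> x < M" "2 ^ len \<le> 2 * M + 1"
  obtains len' where "\<forall>y<num_regs c. (\<sigma>(x := Suc (\<sigma> x))) y < 2 ^ len'" "2 ^ len' \<le> 2 * M + 1"
    "steps n H c (machine_config c (Inc x # ks) Fetch h (tape (num_regs c) \<sigma> len) 0 out)
    (machine_config c ks Fetch h (tape (num_regs c) (\<sigma>(x := Suc (\<sigma> x))) len') 0 out)"
proof -
  let ?K = "num_regs c"
  let ?t = "\<lambda>i. tape ?K (\<sigma>(x := clear_low i (\<sigma> x))) len"
  have x: "x < ?K" using continuations_closed(2)[OF assms(1)] by simp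
  \<comment> \<open>The carry stops at the first zero bit. If this is \<open>len\<close>, the
    register consists of ones only and the tape must grow.\<close>
  define m where "m = (LEAST i. \<not> bit (\<sigma> x) i)"
  have nb: "\<not> bit (\<sigma> x) len" using assms(4) x less_exp_iff_bits by blast
  have m: "\<not> bit (\<sigma> x) m" unfolding m_def using nb by (rule LeastI)
  have lm: "bit (\<sigma> x) i" if "i < m" for i using that not_less_Least unfolding m_def by blast
  have mlen: "m \<le> len" unfolding m_def using nb by (rule Least_le)
  have S: "set_bit m (clear_low m (\<sigma> x)) = Suc (\<sigma> x)"
    using lm m by (intro set_bit_clear_low) auto
  define len' where "len' = (if m < len then len else Suc len)"
  define w where "w = (\<lambda>i. if i < m then 2 + unset_bit x (column ?K (\<sigma>(x := clear_low i (\<sigma> x))) i)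
     else if m < len then 2 + set_bit x (column ?K (\<sigma>(x := clear_low m (\<sigma> x))) m) else 2 + 2 ^ x)"
  have bc: "bit (column ?K (\<sigma>(x := clear_low i (\<sigma> x))) i) x \<longleftrightarrow> bit (\<sigma> x) i" for i
    using x by (simp add: bit_column bit_clear_low)
  have fin: "(?t m)(Suc m := w m) = tape ?K (\<sigma>(x := Suc (\<sigma> x))) len'"
  proof (cases "m < len")
    case True
    then show ?thesis using tape_set_bit[OF True x, of "\<sigma>(x := clear_low m (\<sigma> x))"]
      by (simp add: w_def len'_def S)
  next
    case False
    then have "m = len" using mlen by simp
    moreover have "\<forall>y<?K. (\<sigma>(x := clear_low len (\<sigma> x))) y < 2 ^ len"
      using assms(4) by (simp add: clear_low_all)
    ultimately show ?thesis using S tape_extend[OF _ x, of "\<sigma>(x := clear_low m (\<sigma> x))" len]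
      by (simp add: w_def len'_def)
  qed
  have "steps n H c (machine_config c (Inc x # ks) Fetch h (?t 0) 0 out)
    (machine_config c ks Fetch h (tape ?K (\<sigma>(x := Suc (\<sigma> x))) len') 0 out)"
  proof (rule steps_sweep[where m = m and f = "\<lambda>_. False" and w = w])
    show "(?t i)(Suc i := w i) = ?t (Suc i)" if "i < m" for i
      using tape_unset_bit[OF _ x, of i len "\<sigma>(x := clear_low i (\<sigma> x))"] that mlen
      by (simp add: unset_bit_clear_low w_def)
    show "transition (Inc x # ks) (Scan False) (unary_input n h) (?t i (Suc i)) =
        Some ((Inc x # ks, Scan False), Stay, w i, Move_Right, None)" if "i < m" for i
      using that mlen lm by (simp add: tape_Suc w_def bc)
    show "transition (Inc x # ks) (Scan False) (unary_input n h) (?t m (Suc m)) = Some ((ks, Ret), Stay, w m, Move_Left, None)"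
    proof (cases "m < len")
      case True
      then show ?thesis using bc[of m] m by (simp add: tape_Suc w_def)
    next
      case False
      then have "m = len" using mlen by simp
      then show ?thesis by (simp add: tape_end w_def)
    qed
  qed (use assms mlen continuations_closed(1)[OF assms(1)] fin in \<open>auto simp: tape_neq_1[unfolded One_nat_def] simp del: fun_upd_apply\<close>)
  moreover have "\<forall>y<?K. (\<sigma>(x := Suc (\<sigma> x))) y < 2 ^ len' \<and> 2 ^ len' \<le> 2 * M + 1"
  proof (cases "m < len")
    case True
    then have "set_bit m (clear_low m (\<sigma> x)) < 2 ^ len"
      using assms(4) x less_exp_iff_bits[of "\<sigma> x"]
      by (intro set_bit_less) (auto simp: less_exp_iff_bits[of "clear_low m (\<sigma> x)"] bit_clear_low)
    then show ?thesis using True assms(4,6) by (simp add: S len'_def)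
  next
    case False
    then have ml: "m = len" using mlen by simp
    \<comment> \<open>A new column appears only when the new value is exactly
      \<open>2 ^ len\<close>. This value is at most \<open>M\<close>, so the new length still
      satisfies \<open>2 ^ len' \<le> 2 * M\<close>.\<close>
    then have "Suc (\<sigma> x) = set_bit len 0" using S assms(4) x by (simp add: clear_low_all)
    then have "Suc (\<sigma> x) = 2 ^ len" by (simp add: set_bit_eq)
    then show ?thesis using assms(4,5) ml by (auto simp: len'_def intro: less_le_trans)
  qed
  ultimately show thesis using that[of len'] x by (auto simp: clear_low_0)
qed

lemma steps_WhileLess:
  assumes "WhileLess x y a # ks \<in> continuations c" "h \<le> Suc n" "len < H" "\<forall>y<num_regs c. \<sigma> y < 2 ^ len"
  shows "steps n H c (machine_config c (WhileLess x y a # ks) Fetch h (tape (num_regs c) \<sigma> len) 0 out)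
    (machine_config c (if \<sigma> x < \<sigma> y then a # WhileLess x y a # ks else ks) Fetch h (tape (num_regs c) \<sigma> len) 0 out)"
proof -
  let ?K = "num_regs c"
  let ?t = "tape ?K \<sigma> len"
  have x: "x < ?K" "y < ?K" using continuations_closed(2)[OF assms(1)] by auto
  \<comment> \<open>The most significant differing bit decides, so each column either keeps the
    verdict on the lower bits or replaces it.\<close>
  have "(take_bit (Suc i) (\<sigma> x) < take_bit (Suc i) (\<sigma> y)) \<longleftrightarrow>
    (if bit (\<sigma> x) i = bit (\<sigma> y) i then take_bit i (\<sigma> x) < take_bit i (\<sigma> y) else bit (\<sigma> y) i)" for i
  proof -
    have "take_bit i (\<sigma> x) < 2 ^ i" "take_bit i (\<sigma> y) < 2 ^ i" by simp_all
    then show ?thesis unfolding take_bit_Suc_from_most by (auto simp del: take_bit_nat_less_exp)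
  qed
  note sc = this
  have "steps n H c (machine_config c (WhileLess x y a # ks) Fetch h ?t 0 out)
    (machine_config c (if \<sigma> x < \<sigma> y then a # WhileLess x y a # ks else ks) Fetch h ?t 0 out)"
  proof (rule steps_sweep[where m = len and f = "\<lambda>i. take_bit i (\<sigma> x) < take_bit i (\<sigma> y)" and
      w = "\<lambda>i. ?t (Suc i)" and t = "\<lambda>_. ?t"])
    show "transition (WhileLess x y a # ks) (Scan (take_bit i (\<sigma> x) < take_bit i (\<sigma> y))) (unary_input n h) (?t (Suc i)) =
        Some ((WhileLess x y a # ks, Scan (take_bit (Suc i) (\<sigma> x) < take_bit (Suc i) (\<sigma> y))), Stay,
           ?t (Suc i), Move_Right, None)" if "i < len" for i
      using x that by (simp add: tape_Suc bit_column sc)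
    have "take_bit len (\<sigma> x) = \<sigma> x" "take_bit len (\<sigma> y) = \<sigma> y"
      using assms(4) x by (auto simp: take_bit_nat_eq_self)
    then show "transition (WhileLess x y a # ks) (Scan (take_bit len (\<sigma> x) < take_bit len (\<sigma> y))) (unary_input n h) (?t (Suc len)) =
        Some ((if \<sigma> x < \<sigma> y then a # WhileLess x y a # ks else ks, Ret), Stay, ?t (Suc len), Move_Left, None)"
      by (simp add: tape_end)
  qed (use assms continuations_closed(1)[OF assms(1)] continuations_closed(5)[OF assms(1) refl] in \<open>auto simp: tape_neq_1[unfolded One_nat_def]\<close>)
  then show ?thesis .
qed

section \<open>Simulation of whole programs\<close>

fun ready_config :: "com \<Rightarrow> com list \<Rightarrow> store \<Rightarrow> nat \<Rightarrow> config" where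
  "ready_config c ks (\<sigma>, h, out) len = machine_config c ks Fetch h (tape (num_regs c) \<sigma> len) 0 out"

text \<open>Bounding \<open>2 ^ len\<close> by \<open>2 * M + 1\<close> ties the tape length to the
  register cap; the \<open>+ 1\<close> admits the empty tape when \<open>M = 0\<close>.\<close>

fun represents :: "com \<Rightarrow> nat \<Rightarrow> nat \<Rightarrow> nat \<Rightarrow> store \<Rightarrow> bool" where
  "represents c n M len (\<sigma>, h, out) \<longleftrightarrow> h \<le> Suc n \<and> (\<forall>y<num_regs c. \<sigma> y < 2 ^ len) \<and> 2 ^ len \<le> 2 * M + 1"

lemma represents_len:
  assumes "represents c n M len s" "2 * M + 1 < 2 ^ H"
  shows "len < H"
proof -
  have "2 ^ len \<le> 2 * M + 1" using assms(1) by (cases s) auto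
  then have "(2::nat) ^ len < 2 ^ H" using assms(2) by (rule le_less_trans)
  then show ?thesis by simp
qed

text \<open>The rest \<open>ks\<close> of the stack is arbitrary, so the induction hypotheses apply
  to a loop body or the first half of a sequence executed on top of the remaining work.\<close>

lemma simulate:
  assumes "big_step n M k s s'" "k # ks \<in> continuations c" "represents c n M len s" "2 * M + 1 < 2 ^ H"
  shows "\<exists>len'. represents c n M len' s' \<and> steps n H c (ready_config c (k # ks) s len) (ready_config c ks s' len')"
  using assms
proof (induction arbitrary: ks len rule: big_step.induct)
  case (1 b \<sigma> h out)
  then have "steps n H c (ready_config c (Emit b # ks) (\<sigma>, h, out) len) (ready_config c ks (\<sigma>, h, out @ [b]) len)"
    by (auto intro!: steps_transition simp: fun_upd_idem)
  then show ?case using 1 by auto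
next
  case (2 \<sigma> h out)
  then have "steps n H c (ready_config c (Adv # ks) (\<sigma>, h, out) len) (ready_config c ks (\<sigma>, min (Suc n) (Suc h), out) len)"
    by (auto intro!: steps_transition simp: fun_upd_idem)
  then show ?case using 2 by auto
next
  case (3 \<sigma> x h out)
  then have "len < H" by (blast intro: represents_len)
  moreover have "h \<le> Suc n" "\<forall>y<num_regs c. \<sigma> y < 2 ^ len" "2 ^ len \<le> 2 * M + 1" using 3(3) by auto
  ultimately obtain len' where "\<forall>y<num_regs c. (\<sigma>(x := Suc (\<sigma> x))) y < 2 ^ len'" "2 ^ len' \<le> 2 * M + 1"
    "steps n H c (machine_config c (Inc x # ks) Fetch h (tape (num_regs c) \<sigma> len) 0 out)
    (machine_config c ks Fetch h (tape (num_regs c) (\<sigma>(x := Suc (\<sigma> x))) len') 0 out)"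
    using steps_Inc[OF 3(2), of h n len H \<sigma> M out] 3(1) by blast
  with \<open>h \<le> Suc n\<close> show ?case by (intro exI[of _ len']) simp
next
  case (4 x \<sigma> h out)
  then have l: "len < H" by (blast intro: represents_len)
  have "represents c n M len (\<sigma>(x := 0), h, out)" using 4 by simp
  moreover have "steps n H c (ready_config c (Zero x # ks) (\<sigma>, h, out) len) (ready_config c ks (\<sigma>(x := 0), h, out) len)"
    using steps_Zero[OF 4(1), of h n len H \<sigma> out] l 4 by simp
  ultimately show ?case by blast
next
  case (5 a s s' b s'')
  obtain \<sigma> h out where s: "s = (\<sigma>, h, out)" by (cases s)
  have "a # b # ks \<in> continuations c" using continuations_closed(3)[OF 5(5) refl] .
  from 5(3)[OF this 5(6,7)] obtain len1 where 1: "represents c n M len1 s'"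
    "steps n H c (ready_config c (a # b # ks) s len) (ready_config c (b # ks) s' len1)" by blast
  from continuations_closed(1)[OF \<open>a # b # ks \<in> continuations c\<close>] 5(4)[OF _ 1(1) 5(7)] obtain len2 where
    2: "represents c n M len2 s''" "steps n H c (ready_config c (b # ks) s' len1) (ready_config c ks s'' len2)" by blast
  have "steps n H c (ready_config c (Seq a b # ks) s len) (ready_config c (a # b # ks) s len)"
    using 5 by (auto intro!: steps_transition simp: fun_upd_idem s)
  with 1 2 show ?case by (blast intro: steps_trans)
next
  case (6 \<sigma> x y a h out)
  then have l: "len < H" by (blast intro: represents_len)
  have "steps n H c (ready_config c (WhileLess x y a # ks) (\<sigma>, h, out) len) (ready_config c ks (\<sigma>, h, out) len)"
    using steps_WhileLess[OF 6(2), of h n len H \<sigma> out] l 6 by simp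
  then show ?case using 6 by blast
next
  case (7 \<sigma> x y a h out s' s'')
  let ?w = "WhileLess x y a"
  from 7 have l: "len < H" by (blast intro: represents_len)
  have "steps n H c (ready_config c (?w # ks) (\<sigma>, h, out) len) (ready_config c (a # ?w # ks) (\<sigma>, h, out) len)"
    using steps_WhileLess[OF 7(6), of h n len H \<sigma> out] l 7 by simp
  moreover obtain len1 where 1: "represents c n M len1 s'"
    "steps n H c (ready_config c (a # ?w # ks) (\<sigma>, h, out) len) (ready_config c (?w # ks) s' len1)"
    using 7(4)[OF continuations_closed(5)[OF 7(6) refl] 7(7,8)] by blast
  moreover obtain len2 where "represents c n M len2 s''"
    "steps n H c (ready_config c (?w # ks) s' len1) (ready_config c ks s'' len2)"
    using 7(5)[OF 7(6) 1(1) 7(8)] by blast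
  ultimately show ?case by (blast intro: steps_trans)
next
  case (8 h a \<sigma> out)
  then have "steps n H c (ready_config c (WhileIn a # ks) (\<sigma>, h, out) len) (ready_config c ks (\<sigma>, h, out) len)"
    by (auto intro!: steps_transition simp: fun_upd_idem)
  then show ?case using 8 by blast
next
  case (9 h a \<sigma> out s' s'')
  let ?w = "WhileIn a"
  have "steps n H c (ready_config c (?w # ks) (\<sigma>, h, out) len) (ready_config c (a # ?w # ks) (\<sigma>, h, out) len)"
    using 9 by (auto intro!: steps_transition simp: fun_upd_idem)
  moreover obtain len1 where 1: "represents c n M len1 s'"
    "steps n H c (ready_config c (a # ?w # ks) (\<sigma>, h, out) len) (ready_config c (?w # ks) s' len1)"
    using 9(4)[OF continuations_closed(4)[OF 9(6) refl] 9(7,8)] by blast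
  moreover obtain len2 where "represents c n M len2 s''"
    "steps n H c (ready_config c (?w # ks) s' len1) (ready_config c ks s'' len2)"
    using 9(5)[OF 9(6) 1(1) 9(8)] by blast
  ultimately show ?case by (blast intro: steps_trans)
qed

lemma steps_funpow:
  assumes "steps n H c x y"
  shows "\<exists>t. y = (tm_step (machine c) n ^^ t) x \<and>
    (\<forall>i<t. \<forall>(_, h) \<in> set (work ((tm_step (machine c) n ^^ i) x)). h \<le> H)"
  using assms unfolding steps_def
proof (induction rule: rtranclp_induct)
  case base
  show ?case by (intro exI[of _ 0]) simp
next
  case (step y z)
  then obtain t where "y = (tm_step (machine c) n ^^ t) x"
    "\<forall>i<t. \<forall>(_, h) \<in> set (work ((tm_step (machine c) n ^^ i) x)). h \<le> H" by blast
  with step.hyps show ?case by (intro exI[of _ "Suc t"]) (auto simp: less_Suc_eq)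
qed

lemma tm_computes_bs:
  assumes "big_step n M c (\<lambda>_. 0, 0, []) (\<sigma>, h, out)" "2 * M + 1 < 2 ^ H"
  shows "tm_computes (machine c) n out \<and> (\<forall>t. \<forall>(_, h) \<in> set (work (tm_run (machine c) n t)). h \<le> H)"
proof -
  let ?r = "tm_run (machine c) n"
  have "tape (num_regs c) (\<lambda>_. 0) 0 = (\<lambda>_. 0)(0 := 1)"
    by (auto simp: tape_def fun_eq_iff)
  then have init: "ready_config c [c] (\<lambda>_. 0, 0, []) 0 = init_config (machine c)"
    by (simp add: machine_config_def init_config_def machine_def state_enc_def)
  obtain len where "steps n H c (init_config (machine c)) (ready_config c [] (\<sigma>, h, out) len)"
    using simulate[OF assms(1) continuations_self _ assms(2), of 0] unfolding init by auto
  then obtain t where t: "?r t = ready_config c [] (\<sigma>, h, out) len"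
    "\<forall>i<t. \<forall>(_, h) \<in> set (work (?r i)). h \<le> H"
    using steps_funpow unfolding tm_run_def by metis
  have halt: "tm_action (machine c) n (?r t) = None"
    unfolding t(1) by (simp add: tm_action_def machine_config_def machine_def)
  \<comment> \<open>A halted machine repeats its configuration, so the space bound extends to all
    times.\<close>
  have "?r (t + i) = ?r t" for i
  proof (induction i)
    case (Suc i)
    then show ?case using halt by (simp add: tm_run_def tm_step_def)
  qed simp
  then have r: "?r i = ?r t" if "i \<ge> t" for i
    using that le_Suc_ex by blast
  have rt: "\<forall>(_, h) \<in> set (work (?r t)). h \<le> H" by (simp add: t(1) machine_config_def)
  have "\<forall>(_, h) \<in> set (work (?r i)). h \<le> H" for i
  proof (cases "i < t")
    case True
    then show ?thesis using t(2) by blast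
  next
    case False
    then have "?r i = ?r t" by (intro r) simp
    then show ?thesis using rt by simp
  qed
  moreover have "outp (?r t) = out" by (simp add: t(1) machine_config_def)
  ultimately show ?thesis using halt unfolding tm_computes_def by blast
qed

section \<open>A loop language\<close>

text \<open>Total correctness, because \<open>simulate\<close> has to be fed with an actual
  derivation.\<close>

definition wp :: "nat \<Rightarrow> nat \<Rightarrow> com \<Rightarrow> (store \<Rightarrow> bool) \<Rightarrow> store \<Rightarrow> bool" where
  "wp n M c Q s \<longleftrightarrow> (\<exists>s'. big_step n M c s s' \<and> Q s')"

lemma wp_mono: "wp n M c Q s \<Longrightarrow> (\<And>s. Q s \<Longrightarrow> R s) \<Longrightarrow> wp n M c R s"
  unfolding wp_def by blast

lemma wp_Emit: "Q (\<sigma>, h, out @ [b]) \<Longrightarrow> wp n M (Emit b) Q (\<sigma>, h, out)"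
  and wp_Adv: "Q (\<sigma>, min (Suc n) (Suc h), out) \<Longrightarrow> wp n M Adv Q (\<sigma>, h, out)"
  and wp_Inc: "\<sigma> x < M \<Longrightarrow> Q (\<sigma>(x := Suc (\<sigma> x)), h, out) \<Longrightarrow> wp n M (Inc x) Q (\<sigma>, h, out)"
  and wp_Zero: "Q (\<sigma>(x := 0), h, out) \<Longrightarrow> wp n M (Zero x) Q (\<sigma>, h, out)"
  and wp_Seq: "wp n M c (wp n M d Q) s \<Longrightarrow> wp n M (Seq c d) Q s"
  unfolding wp_def by (blast intro: big_step.intros)+

text \<open>The difference of the two compared registers is a built-in termination measure.\<close>

lemma wp_WhileLess:
  assumes "I (\<sigma>, h, out)"
    "\<And>\<sigma> h out. I (\<sigma>, h, out) \<Longrightarrow> \<sigma> x < \<sigma> y \<Longrightarrow>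
       wp n M c (\<lambda>s. I s \<and> fst s y - fst s x < \<sigma> y - \<sigma> x) (\<sigma>, h, out)"
    "\<And>\<sigma> h out. I (\<sigma>, h, out) \<Longrightarrow> \<not> \<sigma> x < \<sigma> y \<Longrightarrow> Q (\<sigma>, h, out)"
  shows "wp n M (WhileLess x y c) Q (\<sigma>, h, out)"
  using assms(1)
proof (induction "\<sigma> y - \<sigma> x" arbitrary: \<sigma> h out rule: less_induct)
  case less
  show ?case
  proof (cases "\<sigma> x < \<sigma> y")
    case True
    from assms(2)[OF less.prems this] obtain \<sigma>' h' out' where
      1: "big_step n M c (\<sigma>, h, out) (\<sigma>', h', out')" "I (\<sigma>', h', out')" "\<sigma>' y - \<sigma>' x < \<sigma> y - \<sigma> x"
      unfolding wp_def by auto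
    from less.hyps[OF this(3,2)] show ?thesis
      using 1(1) True unfolding wp_def by (blast intro: big_step.intros)
  next
    case False
    then show ?thesis using assms(3)[OF less.prems] unfolding wp_def by (blast intro: big_step.intros)
  qed
qed

text \<open>The fragment without input and output, so that arithmetic can be reasoned about on
  registers alone.\<close>

definition calc :: "nat \<Rightarrow> nat \<Rightarrow> com \<Rightarrow> (nat \<Rightarrow> nat) \<Rightarrow> ((nat \<Rightarrow> nat) \<Rightarrow> bool) \<Rightarrow> bool" where
  "calc n M c \<sigma> Q \<longleftrightarrow> (\<forall>h out. wp n M c (\<lambda>(\<sigma>', h', out'). h' = h \<and> out' = out \<and> Q \<sigma>') (\<sigma>, h, out))"

lemma calc_mono:
  assumes "calc n M c \<sigma> Q" "\<And>\<sigma>. Q \<sigma> \<Longrightarrow> R \<sigma>"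
  shows "calc n M c \<sigma> R"
  unfolding calc_def
proof (intro allI)
  fix h out
  show "wp n M c (\<lambda>(\<sigma>', h', out'). h' = h \<and> out' = out \<and> R \<sigma>') (\<sigma>, h, out)"
    by (rule wp_mono[OF assms(1)[unfolded calc_def, rule_format]]) (auto simp: assms(2))
qed

lemma calc_Inc: "\<sigma> x < M \<Longrightarrow> Q (\<sigma>(x := Suc (\<sigma> x))) \<Longrightarrow> calc n M (Inc x) \<sigma> Q"
  and calc_Zero: "Q (\<sigma>(x := 0)) \<Longrightarrow> calc n M (Zero x) \<sigma> Q"
  unfolding calc_def by (auto intro: wp_Inc wp_Zero)

lemma calc_Seq:
  assumes "calc n M c \<sigma> (\<lambda>\<sigma>. calc n M d \<sigma> Q)"
  shows "calc n M (Seq c d) \<sigma> Q"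
  unfolding calc_def
proof (intro allI wp_Seq)
  fix h out
  show "wp n M c (wp n M d (\<lambda>(\<sigma>', h', out'). h' = h \<and> out' = out \<and> Q \<sigma>')) (\<sigma>, h, out)"
    by (rule wp_mono[OF assms[unfolded calc_def[of _ _ c], rule_format]]) (auto simp: calc_def)
qed

lemma calc_WhileLess:
  assumes "I \<sigma>"
    "\<And>\<sigma>. I \<sigma> \<Longrightarrow> \<sigma> x < \<sigma> y \<Longrightarrow> calc n M c \<sigma> (\<lambda>\<sigma>'. I \<sigma>' \<and> \<sigma>' y - \<sigma>' x < \<sigma> y - \<sigma> x)"
    "\<And>\<sigma>. I \<sigma> \<Longrightarrow> \<not> \<sigma> x < \<sigma> y \<Longrightarrow> Q \<sigma>"
  shows "calc n M (WhileLess x y c) \<sigma> Q"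
  unfolding calc_def
proof (intro allI)
  fix h :: nat and out :: "bool list"
  let ?I = "\<lambda>(\<sigma>', h', out'). h' = h \<and> out' = out \<and> I \<sigma>'"
  show "wp n M (WhileLess x y c) (\<lambda>(\<sigma>', h', out'). h' = h \<and> out' = out \<and> Q \<sigma>') (\<sigma>, h, out)"
  proof (rule wp_WhileLess[where I = ?I])
    fix \<tau> h' out' assume I: "?I (\<tau>, h', out')"
    show "wp n M c (\<lambda>s. ?I s \<and> fst s y - fst s x < \<tau> y - \<tau> x) (\<tau>, h', out')" if "\<tau> x < \<tau> y"
      using assms(2)[OF _ that] I
      by (auto intro!: wp_mono[OF assms(2)[of \<tau>, unfolded calc_def, rule_format]] simp: that)
  qed (use assms(1,3) in auto)
qed

section \<open>Arithmetic by counting\<close>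

definition copy :: "nat \<Rightarrow> nat \<Rightarrow> com" where
  "copy a b = Seq (Zero a) (WhileLess a b (Inc a))"

lemma calc_copy:
  assumes "a \<noteq> b" "\<sigma> b \<le> M" "Q (\<sigma>(a := \<sigma> b))"
  shows "calc n M (copy a b) \<sigma> Q"
  unfolding copy_def
proof (intro calc_Seq calc_Zero, rule calc_WhileLess[where I = "\<lambda>\<sigma>'. \<exists>i\<le>\<sigma> b. \<sigma>' = \<sigma>(a := i)"], goal_cases)
  case (2 \<tau>)
  then obtain i where i: "i < \<sigma> b" "\<tau> = \<sigma>(a := i)" using assms by auto
  then have "\<tau>(a := Suc (\<tau> a)) = \<sigma>(a := Suc i)" by simp
  then show ?case using i assms by (intro calc_Inc) (auto intro!: exI[of _ "Suc i"])
qed (use assms in \<open>auto simp: not_less dest: antisym\<close>)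

definition add_to :: "nat \<Rightarrow> nat \<Rightarrow> nat \<Rightarrow> com" where
  "add_to a b t = Seq (Zero t) (WhileLess t b (Seq (Inc a) (Inc t)))"

lemma calc_add_to:
  assumes "a \<noteq> b" "a \<noteq> t" "b \<noteq> t" "\<sigma> a + \<sigma> b \<le> M" "Q (\<sigma>(t := \<sigma> b, a := \<sigma> a + \<sigma> b))"
  shows "calc n M (add_to a b t) \<sigma> Q"
  unfolding add_to_def
proof (intro calc_Seq calc_Zero,
    rule calc_WhileLess[where I = "\<lambda>\<sigma>'. \<exists>i\<le>\<sigma> b. \<sigma>' = \<sigma>(t := i, a := \<sigma> a + i)"], goal_cases)
  case 1
  show ?case by (rule exI[of _ 0]) (use assms in auto)
next
  case (2 \<tau>)
  then obtain i where i: "i < \<sigma> b" "\<tau> = \<sigma>(t := i, a := \<sigma> a + i)" using assms by auto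
  then have "(\<tau>(a := Suc (\<tau> a)))(t := Suc (\<tau> t)) = \<sigma>(t := Suc i, a := \<sigma> a + Suc i)"
    using assms by (auto simp: fun_eq_iff)
  then show ?case using i assms
    by (intro calc_Seq calc_Inc) (auto intro!: exI[of _ "Suc i"])
qed (use assms in \<open>auto simp: not_less dest: antisym\<close>)

datatype binop = Plus | Minus | Times | DivSuc

fun apply_op :: "binop \<Rightarrow> nat \<Rightarrow> nat \<Rightarrow> nat" where
  "apply_op Plus x y = x + y"
| "apply_op Minus x y = x - y"
| "apply_op Times x y = x * y"
| "apply_op DivSuc x y = x div Suc y"

text \<open>Calling convention: operands in \<open>f\<close> and \<open>f + 1\<close>, result in
  \<open>f\<close>, scratch above, everything below preserved. Running time is irrelevant, so
  repeated counting is good enough; only the size of the values matters. Dividing by a successor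
  saves a test for zero.\<close>

fun op_code :: "binop \<Rightarrow> nat \<Rightarrow> com" where
  "op_code Plus f = add_to f (f + 1) (f + 2)"
| "op_code Minus f = Seq (Zero (f + 2)) (Seq (WhileLess (f + 1) f (Seq (Inc (f + 1)) (Inc (f + 2)))) (copy f (f + 2)))"
| "op_code Times f = Seq (Zero (f + 2)) (Seq (Zero (f + 3))
     (Seq (WhileLess (f + 3) (f + 1) (Seq (add_to (f + 2) f (f + 4)) (Inc (f + 3)))) (copy f (f + 2))))"
| "op_code DivSuc f = Seq (Inc (f + 1)) (Seq (Inc f) (Seq (Zero (f + 2)) (Seq (copy (f + 3) (f + 1))
     (Seq (WhileLess (f + 3) f (Seq (Inc (f + 2)) (add_to (f + 3) (f + 1) (f + 4)))) (copy f (f + 2))))))"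

lemma calc_op_code:
  assumes M: "\<sigma> f * \<sigma> (f + 1) + \<sigma> f + \<sigma> (f + 1) + 3 \<le> M"
  shows "calc n M (op_code b f) \<sigma> (\<lambda>\<sigma>'. \<sigma>' f = apply_op b (\<sigma> f) (\<sigma> (f + 1)) \<and> (\<forall>r<f. \<sigma>' r = \<sigma> r))"
proof (cases b)
  case Plus
  then show ?thesis using M by (auto intro!: calc_add_to)
next
  case Minus
  show ?thesis unfolding Minus op_code.simps
    apply (intro calc_Seq calc_Zero)
    apply (rule calc_WhileLess[where I = "\<lambda>\<tau>. \<tau> f = \<sigma> f \<and> \<tau> (f + 1) = \<sigma> (f + 1) + \<tau> (f + 2) \<and>
          \<tau> (f + 2) \<le> \<sigma> f - \<sigma> (f + 1) \<and> (\<forall>r<f. \<tau> r = \<sigma> r)"])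
    using M by (auto intro!: calc_Seq calc_Inc calc_copy)
next
  case Times
  have le: "\<sigma> f * k + \<sigma> f \<le> M" if "k < \<sigma> (Suc f)" for k
  proof -
    have "\<sigma> f * Suc k \<le> \<sigma> f * \<sigma> (f + 1)" using that by (intro mult_left_mono) auto
    then show ?thesis using M by simp
  qed
  show ?thesis unfolding Times op_code.simps
    apply (intro calc_Seq calc_Zero)
    apply (rule calc_WhileLess[where I = "\<lambda>\<tau>. \<tau> f = \<sigma> f \<and> \<tau> (f + 1) = \<sigma> (f + 1) \<and>
          \<tau> (f + 2) = \<tau> (f + 3) * \<sigma> f \<and> \<tau> (f + 3) \<le> \<sigma> (f + 1) \<and> (\<forall>r<f. \<tau> r = \<sigma> r)"])
    using M apply (auto intro!: calc_Seq calc_Inc calc_add_to calc_copy simp: mult.commute)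
    subgoal for \<tau> using le[of "\<tau> (f + 3)"] by (simp add: mult.commute)
    done
next
  case DivSuc
  let ?y = "Suc (\<sigma> (f + 1))"
  have fin: "q = \<sigma> f div ?y" if "q * ?y \<le> \<sigma> f" "\<sigma> f < Suc q * ?y" for q
    using div_nat_eqI[of ?y q "\<sigma> f"] that by (simp add: mult.commute)
  \<comment> \<open>Register \<open>f + 3\<close> holds the next multiple of the divisor. The
    dividend is raised by one so that the strict loop test means
    \<open>Suc q * ?y \<le> \<sigma> f\<close> for the quotient \<open>q\<close> in
    \<open>f + 2\<close>.\<close>
  let ?I = "\<lambda>\<tau>. \<tau> f = Suc (\<sigma> f) \<and> \<tau> (f + 1) = ?y \<and> \<tau> (f + 3) = Suc (\<tau> (f + 2)) * ?y \<and>
    \<tau> (f + 2) * ?y \<le> \<sigma> f \<and> (\<forall>r<f. \<tau> r = \<sigma> r)"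
  show ?thesis unfolding DivSuc op_code.simps
  proof (intro calc_Seq calc_Zero calc_Inc calc_copy, goal_cases)
    case 5
    show ?case
    proof (rule calc_WhileLess[where I = ?I])
      fix \<tau> assume I: "?I \<tau>"
      show "calc n M (Seq (Inc (f + 2)) (add_to (f + 3) (f + 1) (f + 4))) \<tau>
        (\<lambda>\<sigma>'. ?I \<sigma>' \<and> \<sigma>' f - \<sigma>' (f + 3) < \<tau> f - \<tau> (f + 3))" if "\<tau> (f + 3) < \<tau> f"
      proof (intro calc_Seq calc_Inc calc_add_to)
        have 1: "Suc (\<tau> (f + 2)) * ?y \<le> \<sigma> f" using I that by auto
        have "Suc (\<tau> (f + 2)) * 1 \<le> Suc (\<tau> (f + 2)) * ?y" by (intro mult_left_mono) auto
        then have "Suc (\<tau> (f + 2)) \<le> \<sigma> f" using 1 by (metis le_trans mult.right_neutral)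
        then show "\<tau> (f + 2) < M" using M by linarith
      qed (use M I that in \<open>auto simp: algebra_simps\<close>)
      show "calc n M (copy f (f + 2)) \<tau> (\<lambda>\<sigma>'. \<sigma>' f = apply_op DivSuc (\<sigma> f) (\<sigma> (f + 1)) \<and> (\<forall>r<f. \<sigma>' r = \<sigma> r))"
        if "\<not> \<tau> (f + 3) < \<tau> f"
      proof -
        have q: "\<tau> (f + 2) = \<sigma> f div ?y" using I that by (intro fin) auto
        moreover have "\<sigma> f div ?y \<le> \<sigma> f" by simp
        ultimately have "\<tau> (f + 2) \<le> M" using M by linarith
        then show ?thesis using q I by (intro calc_copy) auto
      qed
    qed auto
  qed (use M in auto)
qed

datatype exp = Reg nat | Lit nat | Bin binop exp exp | FloorLog exp

fun eval :: "exp \<Rightarrow> (nat \<Rightarrow> nat) \<Rightarrow> nat" where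
  "eval (Reg r) \<sigma> = \<sigma> r"
| "eval (Lit c) \<sigma> = c"
| "eval (Bin b e e') \<sigma> = apply_op b (eval e \<sigma>) (eval e' \<sigma>)"
| "eval (FloorLog e) \<sigma> = floorlog 2 (eval e \<sigma>)"

fun evars :: "exp \<Rightarrow> nat set" where
  "evars (Reg r) = {r}"
| "evars (Lit c) = {}"
| "evars (Bin b e e') = evars e \<union> evars e'"
| "evars (FloorLog e) = evars e"

text \<open>Covers all intermediate values of the compiled code, not only the result; the summand 3
  pays for the extra increments in division and halving.\<close>

fun bound :: "exp \<Rightarrow> nat \<Rightarrow> nat" where
  "bound (Reg r) m = m"
| "bound (Lit c) m = c"
| "bound (Bin b e e') m = bound e m * bound e' m + bound e m + bound e' m + 3"
| "bound (FloorLog e) m = bound e m + 3"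

lemma floorlog_le_self: "floorlog 2 n \<le> n"
  using floorlog_leI[of n 2 n] by simp

lemma eval_le_bound: "\<forall>r\<in>evars e. \<sigma> r \<le> m \<Longrightarrow> eval e \<sigma> \<le> bound e m"
proof (induction e)
  case (Bin b e e')
  then have 1: "eval e \<sigma> \<le> bound e m" "eval e' \<sigma> \<le> bound e' m" by auto
  moreover have "eval e \<sigma> * eval e' \<sigma> \<le> bound e m * bound e' m"
    using 1 by (rule mult_le_mono)
  moreover have "eval e \<sigma> div Suc (eval e' \<sigma>) \<le> bound e m"
    using 1(1) div_le_dividend le_trans by blast
  ultimately show ?case by (cases b) auto
next
  case (FloorLog e)
  then show ?case using floorlog_le_self[of "eval e \<sigma>"] by simp
qed auto

lemma eval_cong: "(\<And>r. r \<in> evars e \<Longrightarrow> \<sigma> r = \<tau> r) \<Longrightarrow> eval e \<sigma> = eval e \<tau>"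
  by (induction e) auto

fun inc_code :: "nat \<Rightarrow> nat \<Rightarrow> com" where
  "inc_code 0 f = Zero f"
| "inc_code (Suc c) f = Seq (inc_code c f) (Inc f)"

lemma calc_inc_code: "c \<le> M \<Longrightarrow> calc n M (inc_code c f) \<sigma> (\<lambda>\<sigma>'. \<sigma>' = \<sigma>(f := c))"
proof (induction c)
  case (Suc c)
  then show ?case by (auto intro!: calc_Seq calc_Inc elim!: calc_mono)
qed (auto intro: calc_Zero)

text \<open>Register \<open>f + 4\<close> runs through the odd numbers below the argument, and their
  number is the half. Scratch starts at \<open>f + 3\<close> because \<open>log_code\<close>
  occupies \<open>f + 1\<close> and \<open>f + 2\<close>.\<close>

definition half_code :: "nat \<Rightarrow> com" where
  "half_code f = Seq (Zero (f + 3)) (Seq (Zero (f + 4)) (Seq (Inc (f + 4))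
     (Seq (WhileLess (f + 4) f (Seq (Inc (f + 3)) (Seq (Inc (f + 4)) (Inc (f + 4))))) (copy f (f + 3)))))"

lemma calc_half_code:
  assumes "\<sigma> f + 3 \<le> M"
  shows "calc n M (half_code f) \<sigma> (\<lambda>\<sigma>'. \<sigma>' f = \<sigma> f div 2 \<and> (\<forall>r<f + 3. r \<noteq> f \<longrightarrow> \<sigma>' r = \<sigma> r))"
  unfolding half_code_def
  apply (intro calc_Seq calc_Zero calc_Inc)
   apply (use assms in simp)
  apply (rule calc_WhileLess[where I = "\<lambda>\<tau>. \<tau> (f + 4) = 2 * \<tau> (f + 3) + 1 \<and>
     \<tau> (f + 4) \<le> \<sigma> f + 1 \<and> (\<forall>r<f + 3. \<tau> r = \<sigma> r)"])
  using assms by (auto intro!: calc_Seq calc_Inc calc_copy)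

text \<open>Register \<open>f + 2\<close> stays \<open>0\<close>, which turns the comparison loop
  into a loop while the argument is nonzero.\<close>

definition log_code :: "nat \<Rightarrow> com" where
  "log_code f = Seq (Zero (f + 1)) (Seq (Zero (f + 2))
     (Seq (WhileLess (f + 2) f (Seq (half_code f) (Inc (f + 1)))) (copy f (f + 1))))"

lemma floorlog_half: "x > 0 \<Longrightarrow> floorlog 2 x = Suc (floorlog 2 (x div 2))"
  by (subst compute_floorlog) simp

lemma calc_log_code:
  assumes "\<sigma> f + 3 \<le> M"
  shows "calc n M (log_code f) \<sigma> (\<lambda>\<sigma>'. \<sigma>' f = floorlog 2 (\<sigma> f) \<and> (\<forall>r<f. \<sigma>' r = \<sigma> r))"
  unfolding log_code_def
proof (intro calc_Seq calc_Zero,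
    rule calc_WhileLess[where I = "\<lambda>\<tau>. \<tau> (f + 1) + floorlog 2 (\<tau> f) = floorlog 2 (\<sigma> f) \<and>
     \<tau> f \<le> \<sigma> f \<and> \<tau> (f + 2) = 0 \<and> (\<forall>r<f. \<tau> r = \<sigma> r)"])
  fix \<tau>
  let ?I = "\<lambda>\<tau>. \<tau> (f + 1) + floorlog 2 (\<tau> f) = floorlog 2 (\<sigma> f) \<and>
     \<tau> f \<le> \<sigma> f \<and> \<tau> (f + 2) = 0 \<and> (\<forall>r<f. \<tau> r = \<sigma> r)"
  assume I: "?I \<tau>"
  show "calc n M (Seq (half_code f) (Inc (f + 1))) \<tau> (\<lambda>\<sigma>'. ?I \<sigma>' \<and> \<sigma>' f - \<sigma>' (f + 2) < \<tau> f - \<tau> (f + 2))"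
    if lt: "\<tau> (f + 2) < \<tau> f"
  proof (intro calc_Seq, rule calc_mono, rule calc_half_code)
    fix \<sigma>' assume s: "\<sigma>' f = \<tau> f div 2 \<and> (\<forall>r<f + 3. r \<noteq> f \<longrightarrow> \<sigma>' r = \<tau> r)"
    have "Suc (\<sigma>' (f + 1)) \<le> floorlog 2 (\<sigma> f)" using I s lt floorlog_half[of "\<tau> f"] by simp
    then have "\<sigma>' (f + 1) < M" using floorlog_le_self[of "\<sigma> f"] assms by linarith
    then show "calc n M (Inc (f + 1)) \<sigma>' (\<lambda>\<sigma>'. ?I \<sigma>' \<and> \<sigma>' f - \<sigma>' (f + 2) < \<tau> f - \<tau> (f + 2))"
      using I s lt floorlog_half[of "\<tau> f"] by (intro calc_Inc) auto
  qed (use I assms in auto)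
  show "calc n M (copy f (f + 1)) \<tau> (\<lambda>\<sigma>'. \<sigma>' f = floorlog 2 (\<sigma> f) \<and> (\<forall>r<f. \<sigma>' r = \<sigma> r))"
    if "\<not> \<tau> (f + 2) < \<tau> f"
  proof (intro calc_copy)
    have "\<tau> (f + 1) \<le> floorlog 2 (\<sigma> f)" using I by simp
    then show "\<tau> (f + 1) \<le> M" using floorlog_le_self[of "\<sigma> f"] assms by linarith
  qed (use I that in \<open>auto simp: floorlog_def\<close>)
qed auto

fun compile :: "exp \<Rightarrow> nat \<Rightarrow> com" where
  "compile (Reg r) f = copy f r"
| "compile (Lit c) f = inc_code c f"
| "compile (Bin b e e') f = Seq (compile e f) (Seq (compile e' (f + 1)) (op_code b f))"
| "compile (FloorLog e) f = Seq (compile e f) (log_code f)"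

lemma calc_compile:
  assumes "evars e \<subseteq> {..<f}" "\<forall>r\<in>evars e. \<sigma> r \<le> m" "bound e m \<le> M"
  shows "calc n M (compile e f) \<sigma> (\<lambda>\<sigma>'. \<sigma>' f = eval e \<sigma> \<and> (\<forall>r<f. \<sigma>' r = \<sigma> r))"
  using assms
proof (induction e arbitrary: f \<sigma>)
  case (Reg r)
  then show ?case by (auto intro!: calc_copy)
next
  case (Lit c)
  then show ?case by (auto intro: calc_mono[OF calc_inc_code])
next
  case (Bin b e e')
  show ?case unfolding compile.simps
  proof (intro calc_Seq, rule calc_mono[OF Bin.IH(1)], goal_cases)
    case (4 \<sigma>1)
    show ?case
    proof (intro calc_Seq, rule calc_mono[OF Bin.IH(2)], goal_cases)
      case (4 \<sigma>2)
      have ev: "eval e' \<sigma>1 = eval e' \<sigma>" using \<open>\<sigma>1 f = eval e \<sigma> \<and> _\<close> Bin.prems by (intro eval_cong) auto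
      have v: "\<sigma>2 f = eval e \<sigma>" "\<sigma>2 (f + 1) = eval e' \<sigma>"
        using \<open>\<sigma>1 f = eval e \<sigma> \<and> _\<close> 4 ev by auto
      have "eval e \<sigma> \<le> bound e m" "eval e' \<sigma> \<le> bound e' m"
        using Bin.prems by (auto intro!: eval_le_bound)
      moreover from this have "eval e \<sigma> * eval e' \<sigma> \<le> bound e m * bound e' m"
        by (rule mult_le_mono)
      ultimately show ?case using Bin.prems \<open>\<sigma>1 f = eval e \<sigma> \<and> _\<close> 4
        by (intro calc_mono[OF calc_op_code]) (auto simp: v[simplified])
    qed (use 4 Bin.prems in auto)
  qed (use Bin.prems in auto)
next
  case (FloorLog e)
  show ?case unfolding compile.simps
  proof (intro calc_Seq, rule calc_mono[OF FloorLog.IH], goal_cases)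
    case (4 \<sigma>1)
    moreover have "eval e \<sigma> \<le> bound e m"
      using FloorLog.prems by (intro eval_le_bound) auto
    ultimately show ?case using FloorLog.prems
      by (intro calc_mono[OF calc_log_code]) auto
  qed (use FloorLog.prems in auto)
qed

section \<open>Loop programs and the numbers they print\<close>

datatype loop_prog = EmitN exp | Then loop_prog loop_prog | For exp loop_prog

text \<open>A loop at level \<open>r\<close> keeps its counter in register \<open>r\<close> and its bound in register \<open>r + 1\<close>.\<close>

fun outs :: "nat \<Rightarrow> loop_prog \<Rightarrow> (nat \<Rightarrow> nat) \<Rightarrow> nat list" where
  "outs r (EmitN e) \<sigma> = [eval e \<sigma>]"
| "outs r (Then s t) \<sigma> = outs r s \<sigma> @ outs r t \<sigma>"
| "outs r (For e s) \<sigma> =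
     concat (map (\<lambda>i. outs (r + 2) s (\<sigma>(r := i, r + 1 := eval e \<sigma>))) [0..<eval e \<sigma>])"

text \<open>\<open>f\<close> is the first scratch register for expressions; all counters and loop
  bounds must lie below it.\<close>

fun wf_stm :: "nat \<Rightarrow> nat \<Rightarrow> loop_prog \<Rightarrow> bool" where
  "wf_stm r f (EmitN e) \<longleftrightarrow> evars e \<subseteq> {..<r} \<and> r \<le> f"
| "wf_stm r f (Then s t) \<longleftrightarrow> wf_stm r f s \<and> wf_stm r f t"
| "wf_stm r f (For e s) \<longleftrightarrow> evars e \<subseteq> {..<r} \<and> r + 1 < f \<and> wf_stm (r + 2) f s"

fun bound_stm :: "loop_prog \<Rightarrow> nat \<Rightarrow> nat" where
  "bound_stm (EmitN e) m = bound e m"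
| "bound_stm (Then s t) m = bound_stm s m + bound_stm t m"
| "bound_stm (For e s) m = bound e m + bound_stm s (m + bound e m)"

definition unary :: "nat \<Rightarrow> bool list" where
  "unary k = replicate k True @ [False]"

fun code :: "nat \<Rightarrow> nat \<Rightarrow> loop_prog \<Rightarrow> com" where
  "code r f (EmitN e) = Seq (compile e f) (Seq (Zero (f + 1))
     (Seq (WhileLess (f + 1) f (Seq (Emit True) (Inc (f + 1)))) (Emit False)))"
| "code r f (Then s t) = Seq (code r f s) (code r f t)"
| "code r f (For e s) = Seq (compile e f) (Seq (copy (r + 1) f) (Seq (Zero r)
     (WhileLess r (r + 1) (Seq (code (r + 2) f s) (Inc r)))))"

lemma outs_cong:
  assumes "wf_stm r f s" "\<And>q. q < r \<Longrightarrow> \<sigma> q = \<tau> q"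
  shows "outs r s \<sigma> = outs r s \<tau>"
  using assms
proof (induction s arbitrary: r \<sigma> \<tau>)
  case (EmitN e)
  then show ?case by (auto intro!: eval_cong)
next
  case (Then s t)
  have "outs r s \<sigma> = outs r s \<tau>" "outs r t \<sigma> = outs r t \<tau>"
    using Then.prems by (auto intro: Then.IH)
  then show ?case by simp
next
  case (For e s)
  have "eval e \<sigma> = eval e \<tau>" using For.prems by (auto intro!: eval_cong)
  moreover have "outs (r + 2) s (\<sigma>(r := i, r + 1 := v)) = outs (r + 2) s (\<tau>(r := i, r + 1 := v))" for i v
    using For.prems by (intro For.IH) (auto simp: less_Suc_eq)
  ultimately show ?case by simp
qed

lemma wp_calc:
  assumes "calc n M c \<sigma> Q" "\<And>\<sigma>'. Q \<sigma>' \<Longrightarrow> R (\<sigma>', h, out)"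
  shows "wp n M c R (\<sigma>, h, out)"
  by (rule wp_mono[OF assms(1)[unfolded calc_def, rule_format]]) (auto simp: assms(2))

text \<open>Preserving the registers below the level is what lets the surrounding loop find its
  counter and its bound intact after each pass.\<close>

lemma wp_code:
  assumes "wf_stm r f s" "\<forall>q<r. \<sigma> q \<le> m" "bound_stm s m \<le> M"
  shows "wp n M (code r f s) (\<lambda>(\<sigma>', h', out'). h' = h \<and>
      out' = out @ concat (map unary (outs r s \<sigma>)) \<and> (\<forall>q<r. \<sigma>' q = \<sigma> q)) (\<sigma>, h, out)"
  using assms
proof (induction s arbitrary: r \<sigma> m h out)
  case (EmitN e)
  have le: "eval e \<sigma> \<le> M"
    using EmitN.prems eval_le_bound[of e \<sigma> m] by (auto simp: subset_iff intro: le_trans)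
  show ?case unfolding code.simps
  proof (intro wp_Seq, rule wp_calc[OF calc_compile], goal_cases)
    case (4 \<sigma>1)
    show ?case
    proof (intro wp_Seq wp_Zero, rule wp_WhileLess[where I = "\<lambda>(\<tau>, h', out'). h' = h \<and> \<tau> f = eval e \<sigma> \<and>
        \<tau> (f + 1) \<le> eval e \<sigma> \<and> out' = out @ replicate (\<tau> (f + 1)) True \<and> (\<forall>q<r. \<tau> q = \<sigma> q)"])
      fix \<tau> h' out'
      assume "case (\<tau>, h', out') of (\<tau>, h', out') \<Rightarrow> h' = h \<and> \<tau> f = eval e \<sigma> \<and>
        \<tau> (f + 1) \<le> eval e \<sigma> \<and> out' = out @ replicate (\<tau> (f + 1)) True \<and> (\<forall>q<r. \<tau> q = \<sigma> q)"
        and "\<not> \<tau> (f + 1) < \<tau> f"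
      then show "wp n M (Emit False) (\<lambda>(\<sigma>', h', out'). h' = h \<and> out' = out @ concat (map unary (outs r (EmitN e) \<sigma>))
         \<and> (\<forall>q<r. \<sigma>' q = \<sigma> q)) (\<tau>, h', out')"
        by (intro wp_Emit) (auto simp: unary_def)
    qed (use 4 EmitN.prems le in \<open>auto intro!: wp_Seq wp_Emit wp_Inc simp: replicate_append_same\<close>)
  qed (use EmitN.prems in auto)
next
  case (Then s t)
  show ?case unfolding code.simps
  proof (intro wp_Seq, rule wp_mono[OF Then.IH(1)], goal_cases)
    case (4 st)
    obtain \<sigma>1 h1 out1 where st: "st = (\<sigma>1, h1, out1)" by (cases st)
    have "outs r t \<sigma>1 = outs r t \<sigma>" using 4 Then.prems by (intro outs_cong) (auto simp: st)
    then show ?case unfolding st using 4 Then.prems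
      by (intro wp_mono[OF Then.IH(2)]) (auto simp: st)
  qed (use Then.prems in auto)
next
  case (For e s)
  have le: "eval e \<sigma> \<le> bound e m"
    using For.prems eval_le_bound[of e \<sigma> m] by (auto simp: subset_iff)
  let ?o = "\<lambda>k. out @ concat (map unary (concat (map (\<lambda>i. outs (r + 2) s (\<sigma>(r := i, r + 1 := eval e \<sigma>))) [0..<k])))"
  show ?case unfolding code.simps
  proof (intro wp_Seq, rule wp_calc[OF calc_compile], goal_cases)
    case (4 \<sigma>1)
    show ?case
    proof (intro wp_Seq, rule wp_calc[OF calc_copy[where Q = "\<lambda>\<tau>. \<tau> = \<sigma>1(r + 1 := \<sigma>1 f)"]], goal_cases)
      case (4 \<sigma>2)
      let ?I = "\<lambda>(\<tau>, h', out'). h' = h \<and> \<tau> (r + 1) = eval e \<sigma> \<and>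
        \<tau> r \<le> eval e \<sigma> \<and> out' = ?o (\<tau> r) \<and> (\<forall>q<r. \<tau> q = \<sigma> q)"
      show ?case
      proof (intro wp_Seq wp_Zero, rule wp_WhileLess[where I = ?I])
        fix \<tau> h' out'
        assume I: "?I (\<tau>, h', out')" and lt: "\<tau> r < \<tau> (r + 1)"
        have oc: "outs (r + 2) s \<tau> = outs (r + 2) s (\<sigma>(r := \<tau> r, r + 1 := eval e \<sigma>))"
          using For.prems I by (intro outs_cong) (auto simp: less_Suc_eq)
        show "wp n M (Seq (code (r + 2) f s) (Inc r))
          (\<lambda>s. ?I s \<and> fst s (r + 1) - fst s r < \<tau> (r + 1) - \<tau> r) (\<tau>, h', out')"
        proof (intro wp_Seq, rule wp_mono[OF For.IH[where m = "m + bound e m"]], goal_cases)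
          case 2
          show ?case using For.prems I lt le by (auto simp: less_Suc_eq intro: trans_le_add1)
        next
          case (4 st)
          obtain \<sigma>3 h3 out3 where st: "st = (\<sigma>3, h3, out3)" by (cases st)
          show ?case unfolding st using 4 I lt le For.prems
            by (intro wp_Inc) (auto simp: st oc[simplified] less_Suc_eq)
        qed (use For.prems in auto)
      qed (use \<open>\<sigma>1 f = eval e \<sigma> \<and> _\<close> 4 For.prems in auto)
    qed (use 4 le For.prems in auto)
  qed (use For.prems in auto)
qed

text \<open>The head starts on the left marker, which also reads as nonzero; the first
  \<open>Adv\<close> keeps it from being counted.\<close>

definition read_input :: com where
  "read_input = Seq Adv (WhileIn (Seq (Inc 0) Adv))"

lemma wp_read_input:
  assumes "n \<le> M"
  shows "wp n M read_input (\<lambda>(\<sigma>', h', out'). out' = out \<and> \<sigma>' = (\<lambda>_. 0)(0 := n)) (\<lambda>_. 0, 0, out)"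
proof -
  have "wp n M (WhileIn (Seq (Inc 0) Adv)) (\<lambda>(\<sigma>', h', out'). out' = out \<and> \<sigma>' = (\<lambda>_. 0)(0 := n))
    ((\<lambda>_. 0)(0 := n - k), Suc (n - k), out)" if "k \<le> n" for k
    using that
  proof (induction k)
    case 0
    show ?case unfolding wp_def
      by (intro exI[of _ "((\<lambda>_. 0)(0 := n - 0), Suc n, out)"]) (auto intro!: big_step.intros simp: unary_input_def)
  next
    case (Suc k)
    then obtain s where s: "big_step n M (WhileIn (Seq (Inc 0) Adv)) ((\<lambda>_. 0)(0 := n - k), Suc (n - k), out) s"
      "case s of (\<sigma>', h', out') \<Rightarrow> out' = out \<and> \<sigma>' = (\<lambda>_. 0)(0 := n)" unfolding wp_def by auto
    have "Suc (n - Suc k) = n - k" using Suc.prems by simp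
    then have eq: "((\<lambda>_. 0)(0 := n - Suc k))(0 := Suc (((\<lambda>_. 0)(0 := n - Suc k)) 0)) = (\<lambda>_. 0)(0 := n - k)"
      "min (Suc n) (Suc (Suc (n - Suc k))) = Suc (n - k)"
      by auto
    have "big_step n M (Seq (Inc 0) Adv) ((\<lambda>_. 0)(0 := n - Suc k), Suc (n - Suc k), out)
      ((\<lambda>_. 0)(0 := n - k), Suc (n - k), out)"
      using big_step.intros(5)[OF big_step.intros(3)[of "(\<lambda>_. 0)(0 := n - Suc k)" 0 M n "Suc (n - Suc k)" out]
        big_step.intros(2)] Suc.prems assms unfolding eq by simp
    then have "big_step n M (WhileIn (Seq (Inc 0) Adv)) ((\<lambda>_. 0)(0 := n - Suc k), Suc (n - Suc k), out) s"
      using s(1) Suc.prems by (intro big_step.intros(9)) (auto simp: unary_input_def)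
    then show ?case using s(2) unfolding wp_def by blast
  qed
  from this[of n] have "wp n M (WhileIn (Seq (Inc 0) Adv)) (\<lambda>(\<sigma>', h', out'). out' = out \<and> \<sigma>' = (\<lambda>_. 0)(0 := n))
    (\<lambda>_. 0, Suc 0, out)" by (simp add: fun_upd_idem)
  then show ?thesis unfolding read_input_def by (intro wp_Seq wp_Adv) simp
qed

text \<open>With a base of at least 2 constants are absorbed into the exponent, so no leading factor
  and no restriction to large arguments is carried along.\<close>

definition poly_bounded :: "(nat \<Rightarrow> nat) \<Rightarrow> bool" where
  "poly_bounded g \<longleftrightarrow> (\<exists>k. \<forall>m. g m \<le> (m + 2) ^ k)"

lemma poly_boundedI: "(\<And>m. g m \<le> (m + 2) ^ k) \<Longrightarrow> poly_bounded g"
  unfolding poly_bounded_def by blast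

lemma poly_bounded_mono: "poly_bounded g \<Longrightarrow> (\<And>m. f m \<le> g m) \<Longrightarrow> poly_bounded f"
  unfolding poly_bounded_def by (meson le_trans)

lemma poly_bounded_id: "poly_bounded (\<lambda>m. m)"
  by (rule poly_boundedI[of _ 1]) simp

lemma poly_bounded_const: "poly_bounded (\<lambda>m. c)"
proof (rule poly_boundedI[of _ c])
  fix m :: nat
  have "c \<le> 2 ^ c" by (simp add: less_imp_le)
  also have "\<dots> \<le> (m + 2) ^ c" by (rule power_mono) auto
  finally show "c \<le> (m + 2) ^ c" .
qed

lemma poly_bounded_mult:
  assumes "poly_bounded f" "poly_bounded g"
  shows "poly_bounded (\<lambda>m. f m * g m)"
proof -
  from assms obtain k l where "\<And>m. f m \<le> (m + 2) ^ k" "\<And>m. g m \<le> (m + 2) ^ l"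
    unfolding poly_bounded_def by blast
  then show ?thesis
    by (intro poly_boundedI[of _ "k + l"]) (simp add: power_add mult_le_mono)
qed

lemma poly_bounded_add:
  assumes "poly_bounded f" "poly_bounded g"
  shows "poly_bounded (\<lambda>m. f m + g m)"
proof -
  have S: "poly_bounded (\<lambda>m. f m + 1)" if f: "poly_bounded f" for f
  proof -
    from f obtain k where k: "\<And>m. f m \<le> (m + 2) ^ k" unfolding poly_bounded_def by blast
    show ?thesis
    proof (rule poly_boundedI[of _ "Suc k"])
      fix m
      have "f m + 1 \<le> (m + 2) ^ k + (m + 2) ^ k" using k[of m] by (intro add_mono) auto
      also have "\<dots> = 2 * (m + 2) ^ k" by simp
      also have "\<dots> \<le> (m + 2) * (m + 2) ^ k" by (intro mult_right_mono) auto
      finally show "f m + 1 \<le> (m + 2) ^ Suc k" by simp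
    qed
  qed
  \<comment> \<open>A sum is at most the product of the successors, which reduces addition to
    multiplication.\<close>
  have "poly_bounded (\<lambda>m. (f m + 1) * (g m + 1))"
    by (intro poly_bounded_mult S assms)
  then show ?thesis by (rule poly_bounded_mono) simp
qed

lemma poly_bounded_power: "poly_bounded f \<Longrightarrow> poly_bounded (\<lambda>m. f m ^ c)"
  by (induction c) (auto intro: poly_bounded_mult poly_bounded_const[of 1, simplified])

lemma poly_bounded_compose:
  assumes "poly_bounded f" "poly_bounded g"
  shows "poly_bounded (\<lambda>m. f (g m))"
proof -
  from assms(1) obtain k where "\<And>m. f m \<le> (m + 2) ^ k" unfolding poly_bounded_def by blast
  then have "f (g m) \<le> (g m + 2) ^ k" for m by blast
  moreover have "poly_bounded (\<lambda>m. (g m + 2) ^ k)"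
    by (intro poly_bounded_power poly_bounded_add assms poly_bounded_const)
  ultimately show ?thesis by (blast intro: poly_bounded_mono)
qed

lemmas poly_bounded_intros = poly_bounded_id poly_bounded_const poly_bounded_mult poly_bounded_add poly_bounded_power

lemma poly_bounded_bound: "poly_bounded (bound e)"
  by (induction e) (auto intro!: poly_bounded_intros)

lemma poly_bounded_bound_stm: "poly_bounded (bound_stm s)"
proof (induction s)
  case (For e s)
  then show ?case
    by (auto intro!: poly_bounded_intros poly_bounded_compose[of "bound_stm s"] poly_bounded_bound)
qed (auto intro!: poly_bounded_intros poly_bounded_bound)

text \<open>The passage from polynomial register values to logarithmic space.\<close>

lemma poly_bounded_floorlog:
  assumes "poly_bounded g"
  obtains c where "\<And>n. floorlog 2 (g n) \<le> c * floorlog 2 n + c"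
proof -
  obtain k where k: "\<And>m. g m \<le> (m + 2) ^ k" using assms unfolding poly_bounded_def by blast
  have "floorlog 2 (g n) \<le> (2 * k + 1) * floorlog 2 n + (2 * k + 1)" for n
  proof (rule floorlog_leI)
    have "n + 2 \<le> 2 ^ (floorlog 2 n + 2)"
      using less_two_power_floorlog[of n] by simp
    then have "(n + 2) ^ k \<le> (2 ^ (floorlog 2 n + 2)) ^ k" by (rule power_mono) simp
    also have "\<dots> = 2 ^ ((floorlog 2 n + 2) * k)" by (simp only: power_mult)
    also have "\<dots> < 2 ^ ((2 * k + 1) * floorlog 2 n + (2 * k + 1))"
      by (rule power_strict_increasing) (auto simp: algebra_simps)
    finally show "g n < 2 ^ ((2 * k + 1) * floorlog 2 n + (2 * k + 1))" using k[of n] by simp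
  qed auto
  then show thesis by (rule that)
qed

text \<open>The interface to the uniformity proof: from here on it suffices to print the circuit
  description by nested loops, with \<open>n\<close> in register \<open>0\<close>.\<close>

theorem logspace_uniform_stm:
  assumes "wf_stm 1 f s" "\<And>n. encode_circuit (C n) = concat (map unary (outs 1 s ((\<lambda>_. 0)(0 := n))))"
  shows "logspace_uniform C"
proof -
  define M where "M = (\<lambda>n. n + bound_stm s n)"
  define c where "c = Seq read_input (code 1 f s)"
  have "poly_bounded (\<lambda>n. 2 * M n + 1)"
    unfolding M_def by (intro poly_bounded_intros poly_bounded_bound_stm)
  then obtain d where d: "\<And>n. floorlog 2 (2 * M n + 1) \<le> d * floorlog 2 n + d"
    by (rule poly_bounded_floorlog) blast
  have "tm_computes (machine c) n (encode_circuit (C n)) \<and>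
    (\<forall>t. \<forall>(_, h) \<in> set (work (tm_run (machine c) n t)). h \<le> d * floorlog 2 n + d)" for n
  proof -
    have "wp n (M n) c (\<lambda>(\<sigma>, h, out). out = encode_circuit (C n)) (\<lambda>_. 0, 0, [])"
      unfolding c_def
    proof (intro wp_Seq, rule wp_mono[OF wp_read_input], goal_cases)
      case (2 st)
      then obtain h where st: "st = ((\<lambda>_. 0)(0 := n), h, [])" by auto
      show ?case unfolding st
        by (rule wp_mono[OF wp_code[OF assms(1), where m = n]]) (auto simp: M_def assms(2))
    qed (auto simp: M_def)
    then obtain \<sigma> h where "big_step n (M n) c (\<lambda>_. 0, 0, []) (\<sigma>, h, encode_circuit (C n))"
      unfolding wp_def by auto
    moreover have "2 * M n + 1 < 2 ^ (d * floorlog 2 n + d)"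
      using d[of n] by (intro floorlog_leD) auto
    ultimately show ?thesis by (rule tm_computes_bs)
  qed
  then show ?thesis unfolding logspace_uniform_def using wf_machine by blast
qed

section \<open>Layered circuits\<close>

text \<open>\<open>W\<close> is a closed form guessed for all gate values. Local consistency at each
  gate makes it the true evaluation.\<close>

lemma foldl_gate_val:
  assumes "\<And>k. k < G \<Longrightarrow> gate_val x (map W [0..<k]) (g k) = W k"
  shows "foldl (\<lambda>vs g. vs @ [gate_val x vs g]) [] (map g [0..<G]) = map W [0..<G]"
  using assms by (induction G) auto

lemma foldl_gate_depth:
  assumes "\<And>k ds. k < G \<Longrightarrow> length ds = k \<Longrightarrow> \<forall>i<k. ds ! i \<le> B i \<Longrightarrow> gate_depth ds (g k) \<le> B k"
  shows "length (foldl (\<lambda>ds g. ds @ [gate_depth ds g]) [] (map g [0..<G])) = G \<and>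
    (\<forall>i<G. foldl (\<lambda>ds g. ds @ [gate_depth ds g]) [] (map g [0..<G]) ! i \<le> B i)"
  using assms by (induction G) (auto simp: nth_append less_Suc_eq)

text \<open>Node \<open>l\<close> lies in the subtree of \<open>r\<close>, where the parent of a
  heap node is its half.\<close>

definition heap_desc :: "nat \<Rightarrow> nat \<Rightarrow> bool" where
  "heap_desc r l \<longleftrightarrow> (\<exists>i. l div 2 ^ i = r)"

lemma div_power_Suc: "l div 2 ^ Suc i = l div 2 ^ i div (2 :: nat)"
  by (metis div_mult2_eq power_Suc2)

lemma floorlog_double:
  assumes "x > 0"
  shows "floorlog 2 (2 * x) = Suc (floorlog 2 x)" "floorlog 2 (2 * x + 1) = Suc (floorlog 2 x)"
  using assms by (subst compute_floorlog; simp)+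

lemma heap_desc_inner:
  assumes "r < l"
  shows "heap_desc r l \<longleftrightarrow> heap_desc (2 * r) l \<or> heap_desc (2 * r + 1) l"
proof
  assume "heap_desc r l"
  then obtain i where i: "l div 2 ^ i = r" unfolding heap_desc_def by blast
  then obtain i' where "i = Suc i'" using assms by (cases i) auto
  then have "l div 2 ^ i' div 2 = r" using i by (metis div_power_Suc)
  then have "l div 2 ^ i' = 2 * r \<or> l div 2 ^ i' = 2 * r + 1" by linarith
  then show "heap_desc (2 * r) l \<or> heap_desc (2 * r + 1) l" unfolding heap_desc_def by blast
next
  have "heap_desc r l" if "heap_desc v l" "v div 2 = r" for v
  proof -
    from that obtain i where "l div 2 ^ i = v" unfolding heap_desc_def by blast
    then have "l div 2 ^ Suc i = r" using that by (metis div_power_Suc)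
    then show ?thesis unfolding heap_desc_def by blast
  qed
  then show "heap_desc r l" if "heap_desc (2 * r) l \<or> heap_desc (2 * r + 1) l"
    using that by auto
qed

text \<open>Every proper ancestor of a node below \<open>2 * J\<close> is smaller than
  \<open>J\<close>.\<close>

lemma heap_desc_leaf:
  assumes "J \<le> r" "l < 2 * J"
  shows "heap_desc r l \<longleftrightarrow> l = r"
proof
  assume "heap_desc r l"
  then obtain i where i: "l div 2 ^ i = r" unfolding heap_desc_def by blast
  show "l = r"
  proof (cases i)
    case (Suc i')
    have "l div 2 ^ i = l div 2 div 2 ^ i'" using Suc by (simp add: div_mult2_eq)
    also have "\<dots> \<le> l div 2" by simp
    also have "\<dots> < J" using assms by linarith
    finally show ?thesis using i assms by simp
  qed (use i in simp)
qed (auto simp: heap_desc_def intro: exI[of _ 0])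

lemma heap_desc_root: "l \<ge> 1 \<Longrightarrow> heap_desc 1 l"
proof (induction l rule: less_induct)
  case (less l)
  show ?case
  proof (cases "l = 1")
    case False
    then have "heap_desc 1 (l div 2)" using less by (intro less.IH) auto
    then obtain i where "l div 2 div 2 ^ i = 1" unfolding heap_desc_def by blast
    then have "l div 2 ^ Suc i = 1" by (simp add: div_mult2_eq)
    then show ?thesis unfolding heap_desc_def by blast
  qed (auto simp: heap_desc_def intro: exI[of _ 0])
qed

text \<open>A cell occupies a block of \<open>2 * J\<close> gates: position \<open>2 * J - 1 - r\<close> of the block holds node \<open>r\<close>
  of a heap-ordered tree of disjunctions, whose leaves \<open>J, \<dots>, 2 * J - 1\<close> are conjunctions, and the
  last position (\<open>r = 0\<close>) holds the negation of the root. Literal \<open>2 * s\<close> stands for cell \<open>s\<close>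
  and \<open>2 * s + 1\<close> for its negation.\<close>

locale layered =
  fixes J S T l N :: nat and init :: "nat \<Rightarrow> gate" and trm :: "nat \<Rightarrow> nat \<Rightarrow> nat \<times> nat"
    and out_cell :: "nat \<Rightarrow> nat"
  assumes J_pos: "J > 0"
    and init: "\<And>s. s < S \<Longrightarrow> (\<exists>i<l. init s = In i) \<or> (\<exists>b. init s = Const b)"
    and trm: "\<And>s j. s < S \<Longrightarrow> j < J \<Longrightarrow> fst (trm s j) < 2 * S \<and> snd (trm s j) < 2 * S"
    and out_cell: "\<And>i. i < N \<Longrightarrow> out_cell i < S"
begin

text \<open>The last two positions of a block hold the root and its negation, so the parity of the
  literal is simply added.\<close>

definition lit_addr :: "nat \<Rightarrow> nat \<Rightarrow> nat" where
  "lit_addr t a = (t * S + a div 2) * (2 * J) + (2 * J - 2 + a mod 2)"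

text \<open>Operands must precede their gate, hence the reversed heap order: the children
  \<open>2 * r\<close> and \<open>2 * r + 1\<close> of position \<open>p\<close> sit at
  \<open>2 * (p - J) + 1\<close> and \<open>2 * (p - J)\<close>. Blocks of layer 0 are padded with
  constants so that all addresses follow one formula.\<close>

definition gate_at :: "nat \<Rightarrow> gate" where
  "gate_at k = (let q = k div (2 * J); p = k mod (2 * J); t = q div S; s = q mod S in
     if p = 2 * J - 1 then Neg (k - 1)
     else if t = 0 then (if p = 2 * J - 2 then init s else Const False)
     else if p < J then Conj (lit_addr (t - 1) (fst (trm s p))) (lit_addr (t - 1) (snd (trm s p)))
     else Disj (q * (2 * J) + 2 * (p - J)) (q * (2 * J) + 2 * (p - J) + 1))"

definition num_gates :: nat where
  "num_gates = Suc T * S * (2 * J)"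

definition circ :: circuit where
  "circ = \<lparr>num_inputs = l, gates = map gate_at [0..<num_gates],
     outputs = map (\<lambda>i. lit_addr T (2 * out_cell i)) [0..<N]\<rparr>"

fun mem :: "bool list \<Rightarrow> nat \<Rightarrow> nat \<Rightarrow> bool" where
  "mem x 0 s = gate_val x [] (init s)"
| "mem x (Suc t) s = (\<exists>j<J. (mem x t (fst (trm s j) div 2) \<noteq> odd (fst (trm s j))) \<and>
     (mem x t (snd (trm s j) div 2) \<noteq> odd (snd (trm s j))))"

definition lit :: "bool list \<Rightarrow> nat \<Rightarrow> nat \<Rightarrow> bool" where
  "lit x t a \<longleftrightarrow> (mem x t (a div 2) \<noteq> odd a)"

lemma mem_Suc: "mem x (Suc t) s \<longleftrightarrow> (\<exists>j<J. lit x t (fst (trm s j)) \<and> lit x t (snd (trm s j)))"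
  by (simp add: lit_def)

declare mem.simps(2) [simp del]

text \<open>An inner node of the tree is the disjunction of exactly those terms \<open>j\<close>
  whose leaf \<open>2 * J - 1 - j\<close> lies below it.\<close>

definition val :: "bool list \<Rightarrow> nat \<Rightarrow> nat \<Rightarrow> nat \<Rightarrow> bool" where
  "val x t s p \<longleftrightarrow> (if p = 2 * J - 1 then \<not> mem x t s else if t = 0 then p = 2 * J - 2 \<and> mem x 0 s
     else \<exists>j<J. heap_desc (2 * J - 1 - p) (2 * J - 1 - j) \<and>
       lit x (t - 1) (fst (trm s j)) \<and> lit x (t - 1) (snd (trm s j)))"

lemma val_root: "val x t s (2 * J - 2) \<longleftrightarrow> mem x t s"
proof (cases t)
  case 0
  then show ?thesis using J_pos by (auto simp: val_def)
next
  case (Suc t')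
  have "2 * J - 1 - (2 * J - 2) = 1" "2 * J - 2 \<noteq> 2 * J - 1" using J_pos by linarith+
  moreover have "heap_desc 1 (2 * J - 1 - j)" if "j < J" for j using that by (intro heap_desc_root) auto
  ultimately show ?thesis by (auto simp: Suc val_def mem_Suc)
qed

definition W :: "bool list \<Rightarrow> nat \<Rightarrow> bool" where
  "W x k = val x (k div (2 * J) div S) (k div (2 * J) mod S) (k mod (2 * J))"

lemma W_pos: "s < S \<Longrightarrow> p < 2 * J \<Longrightarrow> W x ((t * S + s) * (2 * J) + p) = val x t s p"
  using J_pos by (simp add: W_def)

lemma W_lit_addr:
  assumes "a < 2 * S"
  shows "W x (lit_addr t a) = lit x t a"
proof -
  have "a mod 2 = 0 \<or> a mod 2 = 1" by auto
  then have "val x t (a div 2) (2 * J - 2 + a mod 2) = lit x t a"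
  proof
    assume "a mod 2 = 1"
    moreover have "2 * J - 2 + 1 = 2 * J - 1" using J_pos by simp
    ultimately show ?thesis by (auto simp: val_def lit_def odd_iff_mod_2_eq_one)
  qed (auto simp: val_root lit_def)
  then show ?thesis using assms J_pos unfolding lit_addr_def by (subst W_pos) auto
qed

lemma lit_addr_less:
  assumes "a < 2 * S" "t < t'"
  shows "lit_addr t a < t' * S * (2 * J)"
proof -
  have "t * S + a div 2 < t' * S"
  proof -
    have "t * S + S \<le> t' * S" using assms(2) mult_le_mono1[of "Suc t" t' S] by simp
    then show ?thesis using assms(1) by linarith
  qed
  then have "Suc (t * S + a div 2) * (2 * J) \<le> t' * S * (2 * J)"
    by (intro mult_right_mono) auto
  moreover have "2 * J - 2 + a mod 2 < 2 * J" using J_pos by (cases "even a") auto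
  ultimately show ?thesis unfolding lit_addr_def by simp
qed

lemma gate_cases:
  assumes "k < num_gates"
  obtains t s p where "k = (t * S + s) * (2 * J) + p" "t \<le> T" "s < S" "p < 2 * J"
    "k div (2 * J) = t * S + s" "k mod (2 * J) = p" "(t * S + s) div S = t" "(t * S + s) mod S = s"
proof -
  let ?q = "k div (2 * J)"
  have "S \<noteq> 0" using assms unfolding num_gates_def by (intro notI) simp
  then have S: "S > 0" by simp
  have "?q < Suc T * S" using assms unfolding num_gates_def by (rule less_mult_imp_div_less)
  then have "?q div S < Suc T" by (rule less_mult_imp_div_less)
  moreover have k: "k = (?q div S * S + ?q mod S) * (2 * J) + k mod (2 * J)" by (simp only: div_mult_mod_eq)
  ultimately show thesis using S J_pos by (intro that[OF k]) auto
qed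

lemma gate_at_cases:
  assumes "k = (t * S + s) * (2 * J) + p" "s < S" "p < 2 * J"
  shows "gate_at k = (if p = 2 * J - 1 then Neg (k - 1)
     else if t = 0 then (if p = 2 * J - 2 then init s else Const False)
     else if p < J then Conj (lit_addr (t - 1) (fst (trm s p))) (lit_addr (t - 1) (snd (trm s p)))
     else Disj ((t * S + s) * (2 * J) + 2 * (p - J)) ((t * S + s) * (2 * J) + 2 * (p - J) + 1))"
proof -
  have "k div (2 * J) = t * S + s" "k mod (2 * J) = p" "(t * S + s) div S = t" "(t * S + s) mod S = s"
    using assms by auto
  then show ?thesis by (simp only: gate_at_def Let_def)
qed

lemma operand_less:
  assumes "k = (t * S + s) * (2 * J) + p" "s < S" "p < 2 * J" "t > 0" "a < 2 * S"
  shows "lit_addr (t - 1) a < k"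
proof -
  have "lit_addr (t - 1) a < t * S * (2 * J)" using assms by (intro lit_addr_less) auto
  also have "\<dots> \<le> k" by (simp add: assms(1) algebra_simps)
  finally show ?thesis .
qed

lemma gate_val_gate_at:
  assumes k: "k < num_gates"
  shows "gate_val x (map (W x) [0..<k]) (gate_at k) = W x k"
proof -
  obtain t s p where d: "k = (t * S + s) * (2 * J) + p" "t \<le> T" "s < S" "p < 2 * J"
    using gate_cases[OF k] by metis
  have Wk: "W x k = val x t s p" using d W_pos by simp
  have Wb: "W x ((t * S + s) * (2 * J) + p') = val x t s p'" if "p' < 2 * J" for p'
    using d(3) that by (rule W_pos)
  consider (neg) "p = 2 * J - 1" | (init) "p \<noteq> 2 * J - 1" "t = 0"
    | (leaf) "p \<noteq> 2 * J - 1" "t > 0" "p < J" | (inner) "p \<noteq> 2 * J - 1" "t > 0" "J \<le> p" by linarith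
  then show ?thesis
  proof cases
    case neg
    then have k1: "k - 1 = (t * S + s) * (2 * J) + (2 * J - 2)" "k - 1 < k" using d J_pos by auto
    have "W x (k - 1) = mem x t s" using J_pos unfolding k1(1) by (subst Wb) (auto simp: val_root)
    then show ?thesis using neg k1(2) by (simp add: gate_at_cases[OF d(1,3,4)] Wk val_def)
  next
    case init
    then show ?thesis using layered.init[OF layered_axioms d(3)]
      by (auto simp: gate_at_cases[OF d(1,3,4)] Wk val_def)
  next
    case leaf
    have l: "fst (trm s p) < 2 * S" "snd (trm s p) < 2 * S" using trm[OF d(3) leaf(3)] by auto
    have lt: "lit_addr (t - 1) (fst (trm s p)) < k" "lit_addr (t - 1) (snd (trm s p)) < k"
      using operand_less[OF d(1,3,4) leaf(2)] l by auto
    have "heap_desc (2 * J - 1 - p) (2 * J - 1 - j) \<longleftrightarrow> j = p" if "j < J" for j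
      using heap_desc_leaf[of J "2 * J - 1 - p" "2 * J - 1 - j"] leaf that by auto
    then have "val x t s p \<longleftrightarrow> lit x (t - 1) (fst (trm s p)) \<and> lit x (t - 1) (snd (trm s p))"
      using leaf by (auto simp: val_def)
    then show ?thesis using leaf lt l by (simp add: gate_at_cases[OF d(1,3,4)] Wk W_lit_addr)
  next
    case inner
    have p: "2 * (p - J) + 1 < p" using inner d(4) by linarith
    have r: "2 * J - 1 - (2 * (p - J) + 1) = 2 * (2 * J - 1 - p)"
      "2 * J - 1 - 2 * (p - J) = 2 * (2 * J - 1 - p) + 1" using inner d(4) by linarith+
    have "heap_desc (2 * J - 1 - p) (2 * J - 1 - j) \<longleftrightarrow>
       heap_desc (2 * J - 1 - (2 * (p - J) + 1)) (2 * J - 1 - j) \<or> heap_desc (2 * J - 1 - 2 * (p - J)) (2 * J - 1 - j)"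
      if "j < J" for j unfolding r using inner that d(4) by (intro heap_desc_inner) linarith
    then have "val x t s p \<longleftrightarrow> val x t s (2 * (p - J)) \<or> val x t s (2 * (p - J) + 1)"
      using inner p d(4) by (auto simp: val_def)
    moreover have "(t * S + s) * (2 * J) + 2 * (p - J) + 1 < k" using p d(1) by simp
    ultimately show ?thesis using inner p d(4) Wb[of "2 * (p - J)"] Wb[of "2 * (p - J) + 1"]
      by (simp add: gate_at_cases[OF d(1,3,4)] Wk)
  qed
qed

lemma circuit_eval_circ: "circuit_eval circ x = map (\<lambda>i. mem x T (out_cell i)) [0..<N]"
proof -
  have "foldl (\<lambda>vs g. vs @ [gate_val x vs g]) [] (map gate_at [0..<num_gates]) = map (W x) [0..<num_gates]"
    by (rule foldl_gate_val[OF gate_val_gate_at])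
  moreover have "lit_addr T (2 * out_cell i) < num_gates" if "i < N" for i
    unfolding num_gates_def using out_cell[OF that] by (intro lit_addr_less) auto
  moreover have "W x (lit_addr T (2 * out_cell i)) = mem x T (out_cell i)" if "i < N" for i
    using out_cell[OF that] by (subst W_lit_addr) (auto simp: lit_def)
  ultimately show ?thesis by (auto simp: circuit_eval_def circ_def Let_def)
qed

lemma wf_circ: "wf_circuit circ"
proof -
  have "wf_gate l k (gate_at k)" if k: "k < num_gates" for k
  proof -
    obtain t s p where d: "k = (t * S + s) * (2 * J) + p" "t \<le> T" "s < S" "p < 2 * J"
      using gate_cases[OF k] by metis
    show ?thesis
      using d init[OF d(3)] trm[OF d(3)] operand_less[OF d(1,3,4)] J_pos
      unfolding gate_at_cases[OF d(1,3,4)] by auto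
  qed
  moreover have "lit_addr T (2 * out_cell i) < num_gates" if "i < N" for i
    unfolding num_gates_def using out_cell[OF that] by (intro lit_addr_less) auto
  ultimately show ?thesis by (auto simp: wf_circuit_def circ_def)
qed

lemma circuit_depth_circ: "circuit_depth circ \<le> Suc T * (floorlog 2 (2 * J - 1) + 2)"
proof -
  let ?L = "floorlog 2 (2 * J - 1)"
  \<comment> \<open>Depth budget: a tree node of bit length \<open>b\<close> gets
    \<open>?L - b\<close>, one more per level towards the root. The negation then fits into
    \<open>?L\<close>, and the \<open>+ 2\<close> per layer leaves room for the conjunctions that
    read the previous layer.\<close>
  let ?B = "\<lambda>t p. t * (?L + 2) + (if p = 2 * J - 1 then ?L else ?L - floorlog 2 (2 * J - 1 - p))"
  define B where "B = (\<lambda>k. ?B (k div (2 * J) div S) (k mod (2 * J)))"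
  have L: "?L \<ge> 1" using J_pos by (intro floorlog_geI) auto
  have fl1: "floorlog 2 (Suc 0) = 1" by (simp add: floorlog_def)
  have Bpos: "B ((t * S + s) * (2 * J) + p) = ?B t p" if "s < S" "p < 2 * J" for t s p
    using that J_pos by (simp add: B_def)
  have Blit: "B (lit_addr t a) \<le> t * (?L + 2) + ?L" if "a < 2 * S" for t a
  proof -
    have "a div 2 < S" using that by auto
    moreover have "2 * J - 2 + a mod 2 < 2 * J" using J_pos by (cases "even a") auto
    ultimately show ?thesis unfolding lit_addr_def by (subst Bpos) auto
  qed
  have "gate_depth ds (gate_at k) \<le> B k"
    if k: "k < num_gates" and ds: "\<forall>i<k. ds ! i \<le> B i" for k ds
  proof -
    obtain t s p where d: "k = (t * S + s) * (2 * J) + p" "t \<le> T" "s < S" "p < 2 * J"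
      using gate_cases[OF k] by metis
    have Bk: "B k = ?B t p" using d Bpos by simp
    consider (neg) "p = 2 * J - 1" | (init) "p \<noteq> 2 * J - 1" "t = 0"
      | (leaf) "p \<noteq> 2 * J - 1" "t > 0" "p < J" | (inner) "p \<noteq> 2 * J - 1" "t > 0" "J \<le> p" by linarith
    then show ?thesis
    proof cases
      case neg
      then have k1: "k - 1 = (t * S + s) * (2 * J) + (2 * J - 2)" "k - 1 < k" using d J_pos by auto
      have "B (k - 1) = t * (?L + 2) + (?L - 1)"
      proof -
        have "2 * J - 1 - (2 * J - 2) = 1" "2 * J - 2 \<noteq> 2 * J - 1" "2 * J - 2 < 2 * J"
          using J_pos by linarith+
        then show ?thesis unfolding k1(1) by (subst Bpos[OF d(3)]) (simp_all add: fl1)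
      qed
      then have "ds ! (k - 1) \<le> t * (?L + 2) + (?L - 1)" using ds k1(2) by metis
      then show ?thesis using neg L by (simp add: gate_at_cases[OF d(1,3,4)] Bk)
    next
      case init
      then show ?thesis using layered.init[OF layered_axioms d(3)]
        by (auto simp: gate_at_cases[OF d(1,3,4)])
    next
      case leaf
      have l: "fst (trm s p) < 2 * S" "snd (trm s p) < 2 * S" using trm[OF d(3) leaf(3)] by auto
      obtain t' where t': "t = Suc t'" using leaf by (cases t) auto
      have "ds ! lit_addr t' a \<le> t' * (?L + 2) + ?L" if "a < 2 * S" for a
        using ds operand_less[OF d(1,3,4) leaf(2) that] Blit[OF that, of t'] by (auto simp: t' intro: le_trans)
      from this[OF l(1)] this[OF l(2)] show ?thesis
        using leaf by (simp add: gate_at_cases[OF d(1,3,4)] Bk t')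
    next
      case inner
      let ?r = "2 * J - 1 - p"
      have r: "?r > 0" "2 * ?r + 1 \<le> 2 * J - 1" using inner d(4) by linarith+
      have e: "2 * J - 1 - (2 * (p - J) + 1) = 2 * ?r" "2 * J - 1 - 2 * (p - J) = 2 * ?r + 1"
        and p: "2 * (p - J) + 1 < p" and n: "2 * (p - J) \<noteq> 2 * J - 1" "2 * (p - J) + 1 \<noteq> 2 * J - 1"
        using inner d(4) by linarith+
      \<comment> \<open>The children are one bit longer than \<open>?r\<close>; as this length is
        still at most \<open>?L\<close>, the truncated differences decrease strictly.\<close>
      have "floorlog 2 (2 * ?r + 1) \<le> ?L" using r(2) by (rule floorlog_mono)
      then have "?L - floorlog 2 (2 * ?r) < ?L - floorlog 2 ?r" "?L - floorlog 2 (2 * ?r + 1) < ?L - floorlog 2 ?r"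
        using floorlog_double[OF r(1)] by linarith+
      then have "?B t (2 * (p - J)) < ?B t p" "?B t (2 * (p - J) + 1) < ?B t p"
        by (simp_all only: e n inner(1) if_False add_less_cancel_left)
      moreover have "ds ! ((t * S + s) * (2 * J) + p') \<le> ?B t p'" if "p' < p" for p'
        using ds[rule_format, of "(t * S + s) * (2 * J) + p'"] Bpos[OF d(3), of p'] that d by simp
      from this[of "2 * (p - J)"] this[of "2 * (p - J) + 1"]
      have "ds ! ((t * S + s) * (2 * J) + 2 * (p - J)) \<le> ?B t (2 * (p - J))"
        "ds ! ((t * S + s) * (2 * J) + 2 * (p - J) + 1) \<le> ?B t (2 * (p - J) + 1)"
        using p by (simp_all add: add.assoc)
      ultimately have "Suc (max (ds ! ((t * S + s) * (2 * J) + 2 * (p - J)))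
        (ds ! ((t * S + s) * (2 * J) + 2 * (p - J) + 1))) \<le> ?B t p"
        by (intro Suc_leI max_less_iff_conj[THEN iffD2] conjI) (blast intro: le_less_trans)+
      then show ?thesis using inner unfolding gate_at_cases[OF d(1,3,4)] Bk by simp
    qed
  qed
  then have fd: "length (foldl (\<lambda>ds g. ds @ [gate_depth ds g]) [] (map gate_at [0..<num_gates])) = num_gates \<and>
    (\<forall>i<num_gates. foldl (\<lambda>ds g. ds @ [gate_depth ds g]) [] (map gate_at [0..<num_gates]) ! i \<le> B i)"
    by (intro foldl_gate_depth) blast
  have "d \<le> Suc T * (?L + 2)"
    if "d \<in> set (foldl (\<lambda>ds g. ds @ [gate_depth ds g]) [] (map gate_at [0..<num_gates]))" for d
  proof -
    let ?ds = "foldl (\<lambda>ds g. ds @ [gate_depth ds g]) [] (map gate_at [0..<num_gates])"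
    from that obtain i where "i < length ?ds" "?ds ! i = d" unfolding in_set_conv_nth by blast
    with fd have i: "i < num_gates" "d \<le> B i" by (simp_all only:) blast
    obtain t s p where d: "i = (t * S + s) * (2 * J) + p" "t \<le> T" "s < S" "p < 2 * J"
      using gate_cases[OF i(1)] by metis
    have "B i \<le> t * (?L + 2) + (?L + 2)" unfolding d(1) Bpos[OF d(3,4)]
      using diff_le_self[of ?L "floorlog 2 (2 * J - 1 - p)"] by (intro add_left_mono) (simp only: split: if_splits, linarith)
    also have "\<dots> \<le> T * (?L + 2) + (?L + 2)" using d(2) by (intro add_right_mono mult_right_mono) auto
    finally show ?thesis using i(2) by simp
  qed
  then show ?thesis by (auto simp: circuit_depth_def circ_def)
qed

end

section \<open>Cut metrics of trees\<close>

definition reach :: "'a set set \<Rightarrow> 'a \<Rightarrow> 'a \<Rightarrow> bool" where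
  "reach E u v \<longleftrightarrow> (\<exists>xs. simple_path E u xs v)"

lemma simple_path_Nil [simp]: "\<not> simple_path E u [] v"
  by (simp add: simple_path_def)

lemma simple_path_single [simp]: "simple_path E u [x] v \<longleftrightarrow> x = u \<and> x = v"
  by (auto simp: simple_path_def)

lemma simple_path_Cons [simp]:
  "simple_path E u (x # y # ys) v \<longleftrightarrow> x = u \<and> u \<notin> set (y # ys) \<and> {u, y} \<in> E \<and> simple_path E y (y # ys) v"
  by (auto simp: simple_path_def)

lemma simple_path_hd: "simple_path E u (x # xs) v \<Longrightarrow> x = u"
  by (auto simp: simple_path_def)

lemma simple_path_last_in: "simple_path E u xs v \<Longrightarrow> v \<in> set xs"
  by (auto simp: simple_path_def)

lemma simple_path_rev:
  assumes "simple_path E u xs v"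
  shows "simple_path E v (rev xs) u"
proof -
  have "(\<lambda>x y. {y, x} \<in> E) = (\<lambda>x y. {x, y} \<in> E)" by (auto simp: insert_commute)
  then have "successively (\<lambda>x y. {y, x} \<in> E) xs = successively (\<lambda>x y. {x, y} \<in> E) xs" by (simp only:)
  then show ?thesis using assms by (simp add: simple_path_def hd_rev last_rev)
qed

lemma reach_refl: "reach E u u"
  unfolding reach_def by (rule exI[of _ "[u]"]) simp

lemma reach_sym: "reach E u v \<Longrightarrow> reach E v u"
  unfolding reach_def by (auto dest: simple_path_rev)

text \<open>If \<open>a\<close> already lies on the path, the tail starting at \<open>a\<close> is
  the simple path sought.\<close>

lemma reach_step:
  assumes "{a, u} \<in> E" "reach E u v"
  shows "reach E a v"
proof -
  obtain xs where xs: "simple_path E u xs v" using assms(2) unfolding reach_def by blast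
  show ?thesis
  proof (cases "a \<in> set xs")
    case False
    obtain ys where "xs = u # ys" using xs by (cases xs) (auto dest: simple_path_hd)
    then have "simple_path E a (a # xs) v" using xs False assms(1) by simp
    then show ?thesis unfolding reach_def by blast
  next
    case True
    then obtain ys zs where "xs = ys @ a # zs" by (meson split_list)
    then have "simple_path E a (a # zs) v" using xs
      by (auto simp: simple_path_def successively_append_iff)
    then show ?thesis unfolding reach_def by blast
  qed
qed

lemma reach_trans:
  assumes "reach E u v" "reach E v z"
  shows "reach E u z"
proof -
  obtain xs where "simple_path E u xs v" using assms(1) unfolding reach_def by blast
  then show ?thesis
  proof (induction xs arbitrary: u)
    case (Cons x xs)
    then show ?case using assms(2) by (cases xs) (auto intro: reach_step)
  qed simp
qed

text \<open>Membership in the component of one endpoint after removal of \<open>e\<close>. The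
  choice of the endpoint is immaterial, since only equality of sides is ever used.\<close>

definition side :: "'a set set \<Rightarrow> 'a set \<Rightarrow> 'a \<Rightarrow> bool" where
  "side T e v \<longleftrightarrow> reach (T - {e}) v (SOME a. a \<in> e)"

lemma side_same:
  assumes "{x, y} \<in> T" "{x, y} \<noteq> e"
  shows "side T e x \<longleftrightarrow> side T e y"
  using reach_step[of x y "T - {e}"] reach_step[of y x "T - {e}"] assms
  by (auto simp: side_def insert_commute)

text \<open>A path between the ends that avoids the edge would close up with it to a cycle of length
  at least 3.\<close>

lemma side_differs:
  assumes "{a, b} \<in> T" "a \<noteq> b" "\<nexists>xs. graph_cycle T xs"
  shows "side T {a, b} a \<noteq> side T {a, b} b"
proof -
  have sep: "\<not> reach (T - {{a, b}}) a b"
  proof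
    assume "reach (T - {{a, b}}) a b"
    then obtain xs where xs: "simple_path (T - {{a, b}}) a xs b" unfolding reach_def by blast
    have "length xs \<ge> 3"
    proof (rule ccontr)
      assume "\<not> length xs \<ge> 3"
      then consider "xs = []" | x where "xs = [x]" | x y where "xs = [x, y]"
        by (cases xs; cases "tl xs"; cases "tl (tl xs)") auto
      then show False using xs assms(2) by cases auto
    qed
    moreover have "successively (\<lambda>x y. {x, y} \<in> T) xs"
      using xs by (auto simp: simple_path_def elim: successively_mono)
    ultimately have "graph_cycle T xs"
      using xs assms(1) by (auto simp: graph_cycle_def simple_path_def insert_commute)
    then show False using assms(3) by blast
  qed
  have "(SOME x. x \<in> {a, b}) \<in> {a, b}" by (rule someI[of _ a]) simp
  then consider "(SOME x. x \<in> {a, b}) = a" | "(SOME x. x \<in> {a, b}) = b" by blast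
  then show ?thesis
    using sep reach_sym[of "T - {{a, b}}" b a] by cases (auto simp: side_def reach_refl)
qed

text \<open>A path that misses an endpoint of \<open>e\<close> cannot use \<open>e\<close>.\<close>

lemma side_path:
  assumes "simple_path T y xs v" "u \<notin> set xs" "u \<in> e"
  shows "side T e y \<longleftrightarrow> side T e v"
  using assms
proof (induction xs arbitrary: y)
  case (Cons x xs)
  show ?case
  proof (cases xs)
    case (Cons z zs)
    have "{y, z} \<in> T" "{y, z} \<noteq> e" using Cons.prems by (auto simp: Cons)
    then have "side T e y \<longleftrightarrow> side T e z" by (rule side_same)
    then show ?thesis using Cons.IH[of z] Cons.prems by (auto simp: Cons)
  qed (use Cons.prems in auto)
qed simp

text \<open>A distance without paths: it is linear in \<open>w\<close> and satisfies the triangle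
  inequality edge by edge, for arbitrary \<open>T\<close>.\<close>

definition cut_dist :: "'a set set \<Rightarrow> ('a set \<Rightarrow> nat) \<Rightarrow> 'a \<Rightarrow> 'a \<Rightarrow> nat" where
  "cut_dist T w u v = (\<Sum>e\<in>T. w e * of_bool (side T e u \<noteq> side T e v))"

locale forest =
  fixes T :: "'a set set"
  assumes finite_T: "finite T"
    and edges: "\<And>a b. {a, b} \<in> T \<Longrightarrow> a \<noteq> b"
    and acyclic: "\<nexists>xs. graph_cycle T xs"
begin

text \<open>The first edge separates \<open>u\<close> from the rest of the path, which never returns
  to \<open>u\<close>; every other edge has \<open>u\<close> and \<open>y\<close> on the same
  side.\<close>

lemma path_weight_cut: "simple_path T u xs v \<Longrightarrow> path_weight w xs = cut_dist T w u v"
proof (induction xs arbitrary: u)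
  case (Cons x xs)
  show ?case
  proof (cases xs)
    case Nil
    then show ?thesis using Cons.prems by (auto simp: path_weight_def cut_dist_def)
  next
    case (Cons y ys)
    have p: "u \<notin> set xs" "{u, y} \<in> T" "simple_path T y xs v" "x = u"
      using Cons.prems by (auto simp: Cons)
    have *: "of_bool (side T e u \<noteq> side T e v) = (of_bool (e = {u, y}) + of_bool (side T e y \<noteq> side T e v) :: nat)"
      if "e \<in> T" for e
    proof (cases "e = {u, y}")
      case True
      have "side T e u \<noteq> side T e y" using side_differs[OF p(2) edges[OF p(2)] acyclic] True by simp
      moreover have "side T e y \<longleftrightarrow> side T e v" using side_path[OF p(3,1)] True by simp
      ultimately show ?thesis using True by simp
    next
      case False
      then show ?thesis using side_same[OF p(2), of e] by simp
    qed
    have "cut_dist T w u v = (\<Sum>e\<in>T. w e * of_bool (e = {u, y}) + w e * of_bool (side T e y \<noteq> side T e v))"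
      unfolding cut_dist_def by (intro sum.cong refl) (simp only: * distrib_left)
    also have "\<dots> = (\<Sum>e\<in>T. w e * of_bool (e = {u, y})) + cut_dist T w y v"
      by (simp add: sum.distrib cut_dist_def)
    also have "(\<Sum>e\<in>T. w e * of_bool (e = {u, y})) = w {u, y}"
      using finite_T p(2) by (simp add: of_bool_def if_distrib cong: if_cong)
    finally show ?thesis using Cons.IH[OF p(3)] p(4) by (simp add: Cons path_weight_def)
  qed
qed simp

text \<open>Two different first edges at \<open>u\<close> are impossible: the first edge of one path
  separates \<open>u\<close> from \<open>v\<close>, whereas the other path never crosses it.\<close>

lemma simple_path_unique: "simple_path T u xs v \<Longrightarrow> simple_path T u ys v \<Longrightarrow> xs = ys"
proof (induction xs arbitrary: u ys)
  case (Cons x xs)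
  obtain ys' where ys: "ys = u # ys'" using Cons.prems(2) by (cases ys) (auto dest: simple_path_hd)
  have x: "x = u" using Cons.prems(1) by (rule simple_path_hd)
  show ?case
  proof (cases xs)
    case Nil
    then have "u = v" using Cons.prems(1) by auto
    then have "ys' = []" using Cons.prems(2) ys by (cases ys') (auto dest: simple_path_last_in)
    then show ?thesis using Nil ys x by simp
  next
    case (Cons y zs)
    have p: "u \<notin> set xs" "{u, y} \<in> T" "simple_path T y xs v" using Cons.prems by (auto simp: Cons)
    have "ys' \<noteq> []" using Cons.prems(2) p simple_path_last_in[OF p(3)] ys by auto
    then obtain y' zs' where ys': "ys' = y' # zs'" by (cases ys') auto
    have q: "u \<notin> set ys'" "{u, y'} \<in> T" "simple_path T y' ys' v" using Cons.prems(2) by (auto simp: ys ys')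
    have "y' = y"
    proof (rule ccontr)
      assume "y' \<noteq> y"
      then have "{u, y'} \<noteq> {u, y}" by (auto simp: doubleton_eq_iff)
      then have "side T {u, y} u \<longleftrightarrow> side T {u, y} v"
        using side_same[OF q(2)] side_path[OF q(3,1), of "{u, y}"] by simp
      moreover have "side T {u, y} u \<noteq> side T {u, y} y"
        by (rule side_differs[OF p(2) edges[OF p(2)] acyclic])
      moreover have "side T {u, y} y \<longleftrightarrow> side T {u, y} v" using side_path[OF p(3,1)] by simp
      ultimately show False by simp
    qed
    then show ?thesis using Cons.IH[OF p(3)] q(3) ys x by simp
  qed
qed simp

lemma tree_dist_cut: "simple_path T u xs v \<Longrightarrow> tree_dist w T u v = cut_dist T w u v"
  unfolding tree_dist_def using simple_path_unique path_weight_cut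
  by (metis (mono_tags, lifting) the_equality)

end

lemma cut_dist_sym: "cut_dist T w u v = cut_dist T w v u"
  by (simp add: cut_dist_def eq_commute)

lemma cut_dist_triangle: "cut_dist T w u v \<le> cut_dist T w u x + cut_dist T w v x"
proof -
  have "cut_dist T w u v \<le> (\<Sum>e\<in>T. w e * of_bool (side T e u \<noteq> side T e x) + w e * of_bool (side T e v \<noteq> side T e x))"
    unfolding cut_dist_def by (rule sum_mono) auto
  then show ?thesis by (simp add: sum.distrib cut_dist_def)
qed

text \<open>The cut metric of one edge: with \<open>q = n \<rho> + R a\<close> the left side is \<open>4 n R q - 2 q\<^sup>2\<close> and the
  right side is \<open>4 n R q - 8 n R \<rho> a\<close>, where \<open>a\<close> and \<open>\<rho>\<close> are the number and the requirement of
  the vertices on one side.\<close>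

lemma cut_averaging:
  fixes V :: "'a set" and r :: "'a \<Rightarrow> int" and s :: "'a \<Rightarrow> bool"
  defines "n \<equiv> int (card V)" and "R \<equiv> sum r V"
  shows "(\<Sum>x\<in>V. (n * r x + R) * (\<Sum>u\<in>V. \<Sum>v\<in>V. r u * (of_bool (s u \<noteq> s x) + of_bool (s v \<noteq> s x))))
    \<le> 4 * n * R * (\<Sum>u\<in>V. \<Sum>v\<in>V. r u * of_bool (s u \<noteq> s v))"
proof -
  define c :: "'a \<Rightarrow> int" where "c = (\<lambda>v. of_bool (s v))"
  define a \<rho> where "a = (\<Sum>v\<in>V. c v)" and "\<rho> = (\<Sum>v\<in>V. r v * c v)"
  define q where "q = n * \<rho> + R * a"
  \<comment> \<open>Exclusive or as a polynomial in the indicator \<open>c\<close>; with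
    \<open>c v * c v = c v\<close> all sums collapse to \<open>n\<close>, \<open>R\<close>,
    \<open>a\<close> and \<open>\<rho>\<close>.\<close>
  have ne: "of_bool (s u \<noteq> s v) = c u + c v - 2 * c u * c v" for u v by (simp add: c_def)
  have cc [simp]: "c v * c v = c v" for v by (simp add: c_def)
  have cc' [simp]: "c v * (c v * z) = c v * z" for v z by (simp add: c_def)
  have in1: "(\<Sum>v\<in>V. r u * ((c u + c x - 2 * c u * c x) + (c v + c x - 2 * c v * c x))) =
    n * (r u * (c u + c x - 2 * c u * c x)) + r u * (a + n * c x - 2 * a * c x)" for u x
    unfolding a_def n_def
    by (simp add: sum.distrib sum_subtractf algebra_simps flip: sum_distrib_left sum_distrib_right)
  have lin: "(\<Sum>u\<in>V. \<alpha> * r u + \<beta> * (r u * c u)) = \<alpha> * R + \<beta> * \<rho>" for \<alpha> \<beta>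
    unfolding R_def \<rho>_def by (simp add: sum.distrib sum_distrib_left)
  have "n * (r u * (c u + k - 2 * c u * k)) + r u * (a + n * k - 2 * a * k) =
    (n * k + a + n * k - 2 * a * k) * r u + (n - 2 * n * k) * (r u * c u)" for u k
    by (simp add: algebra_simps)
  then have "(\<Sum>u\<in>V. n * (r u * (c u + c x - 2 * c u * c x)) + r u * (a + n * c x - 2 * a * c x)) =
    n * (\<rho> + R * c x - 2 * \<rho> * c x) + R * (a + n * c x - 2 * a * c x)" for x
    by (simp only: lin) (simp add: algebra_simps)
  then have inner: "(\<Sum>u\<in>V. \<Sum>v\<in>V. r u * ((c u + c x - 2 * c u * c x) + (c v + c x - 2 * c v * c x)))
    = q + (2 * n * R - 2 * q) * c x" for x
    unfolding in1 by (simp only: q_def) (simp add: algebra_simps)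
  have m1: "(\<Sum>x\<in>V. n * r x + R) = 2 * n * R"
    unfolding n_def by (simp add: sum.distrib R_def flip: sum_distrib_left)
  have m2: "(\<Sum>x\<in>V. (n * r x + R) * c x) = q"
    unfolding q_def \<rho>_def a_def
    by (simp add: sum.distrib algebra_simps flip: sum_distrib_left sum_distrib_right)
  have "(\<Sum>x\<in>V. m x * (q + K * c x)) = (\<Sum>x\<in>V. m x) * q + K * (\<Sum>x\<in>V. m x * c x)" for m :: "'a \<Rightarrow> int" and K
    by (simp add: sum.distrib sum_distrib_left sum_distrib_right algebra_simps)
  from this[of "\<lambda>x. n * r x + R" "2 * n * R - 2 * q"]
  have L: "(\<Sum>x\<in>V. (n * r x + R) * (q + (2 * n * R - 2 * q) * c x)) = 4 * n * R * q - 2 * (q * q)"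
    unfolding m1 m2 by (simp add: algebra_simps)
  have in2: "(\<Sum>v\<in>V. r u * (c u + c v - 2 * c u * c v)) = r u * (n * c u + a - 2 * a * c u)" for u
    unfolding a_def n_def
    by (simp add: sum.distrib sum_subtractf algebra_simps flip: sum_distrib_left sum_distrib_right)
  have "r u * (n * c u + a - 2 * a * c u) = a * r u + (n - 2 * a) * (r u * c u)" for u
    by (simp add: algebra_simps)
  then have "(\<Sum>u\<in>V. r u * (n * c u + a - 2 * a * c u)) = n * \<rho> + R * a - 2 * a * \<rho>"
    by (simp only: lin) (simp add: algebra_simps)
  then have Rr: "(\<Sum>u\<in>V. \<Sum>v\<in>V. r u * (c u + c v - 2 * c u * c v)) = q - 2 * a * \<rho>"
    unfolding in2 by (simp add: q_def)
  \<comment> \<open>This is \<open>4 * y * z \<le> (y + z) * (y + z)\<close> for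
    \<open>y = n * \<rho>\<close> and \<open>z = R * a\<close>.\<close>
  have "4 * n * R * (2 * a * \<rho>) \<le> 2 * (q * q)"
    using zero_le_square[of "n * \<rho> - R * a"] by (simp add: q_def algebra_simps)
  then show ?thesis unfolding ne inner L Rr by (simp add: algebra_simps)
qed

text \<open>The weights \<open>n * r x + R\<close> have total mass \<open>2 * n * R\<close>, while
  \<open>cut_averaging\<close> summed over the edges gives \<open>4 * n * R * c\<close>, so the mean
  of \<open>F\<close> is at most \<open>2 * c\<close>. If all requirements vanish the weights do
  too, but then both sides are zero.\<close>

lemma exists_good_root:
  fixes r :: "'a \<Rightarrow> nat"
  assumes "finite V" "V \<noteq> {}"
  shows "\<exists>x\<in>V. (\<Sum>u\<in>V. \<Sum>v\<in>V. r u * (cut_dist T w u x + cut_dist T w v x))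
    \<le> 2 * (\<Sum>u\<in>V. \<Sum>v\<in>V. r u * cut_dist T w u v)"
proof (cases "sum r V = 0")
  case True
  then have "\<forall>u\<in>V. r u = 0" using assms by simp
  then show ?thesis using assms by auto
next
  case False
  define n where "n = card V"
  define R where "R = sum r V"
  define F where "F = (\<lambda>x. \<Sum>u\<in>V. \<Sum>v\<in>V. r u * (cut_dist T w u x + cut_dist T w v x))"
  define c where "c = (\<Sum>u\<in>V. \<Sum>v\<in>V. r u * cut_dist T w u v)"
  let ?b = "\<lambda>e u v. of_bool (side T e u \<noteq> side T e v) :: nat"
  have swap3: "(\<Sum>x\<in>V. m x * (\<Sum>u\<in>V. \<Sum>v\<in>V. \<Sum>e\<in>T. w e * f e u v x)) =
    (\<Sum>e\<in>T. w e * (\<Sum>x\<in>V. m x * (\<Sum>u\<in>V. \<Sum>v\<in>V. f e u v x)))" for m :: "'a \<Rightarrow> nat" and f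
  proof -
    have "(\<Sum>u\<in>V. \<Sum>v\<in>V. \<Sum>e\<in>T. w e * f e u v x) = (\<Sum>e\<in>T. w e * (\<Sum>u\<in>V. \<Sum>v\<in>V. f e u v x))" for x
      by (simp add: sum_distrib_left sum.swap[of _ T V])
    then show ?thesis by (simp add: sum_distrib_left sum.swap[of _ T V] mult.left_commute)
  qed
  have Fx: "F x = (\<Sum>u\<in>V. \<Sum>v\<in>V. \<Sum>e\<in>T. w e * (r u * (?b e u x + ?b e v x)))" for x
    unfolding F_def cut_dist_def
    by (intro sum.cong refl) (simp add: sum_distrib_left sum.distrib[symmetric] algebra_simps)
  have cx: "c = (\<Sum>u\<in>V. \<Sum>v\<in>V. \<Sum>e\<in>T. w e * (r u * ?b e u v))"
    unfolding c_def cut_dist_def by (intro sum.cong refl) (simp add: sum_distrib_left algebra_simps)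
  have "(\<Sum>x\<in>V. (n * r x + R) * F x) =
    (\<Sum>e\<in>T. w e * (\<Sum>x\<in>V. (n * r x + R) * (\<Sum>u\<in>V. \<Sum>v\<in>V. r u * (?b e u x + ?b e v x))))"
    unfolding Fx by (rule swap3)
  also have "\<dots> \<le> (\<Sum>e\<in>T. w e * (4 * n * R * (\<Sum>u\<in>V. \<Sum>v\<in>V. r u * ?b e u v)))"
  proof (intro sum_mono mult_left_mono)
    fix e
    have "int (\<Sum>x\<in>V. (n * r x + R) * (\<Sum>u\<in>V. \<Sum>v\<in>V. r u * (?b e u x + ?b e v x)))
      \<le> int (4 * n * R * (\<Sum>u\<in>V. \<Sum>v\<in>V. r u * ?b e u v))"
      using cut_averaging[of V "\<lambda>u. int (r u)" "side T e"] unfolding n_def R_def by simp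
    then show "(\<Sum>x\<in>V. (n * r x + R) * (\<Sum>u\<in>V. \<Sum>v\<in>V. r u * (?b e u x + ?b e v x)))
      \<le> 4 * n * R * (\<Sum>u\<in>V. \<Sum>v\<in>V. r u * ?b e u v)" by linarith
  qed simp
  also have "\<dots> = 4 * n * R * c"
    unfolding cx by (simp add: sum_distrib_left sum.swap[of _ T V] algebra_simps)
  finally have le: "(\<Sum>x\<in>V. (n * r x + R) * F x) \<le> 4 * n * R * c" .
  have "\<exists>x\<in>V. F x \<le> 2 * c"
  proof (rule ccontr)
    assume "\<not> ?thesis"
    \<comment> \<open>Every weight is at least \<open>R > 0\<close>, so the strict inequality
      survives the weighted sum.\<close>
    then have "(\<Sum>x\<in>V. (n * r x + R) * (2 * c)) < (\<Sum>x\<in>V. (n * r x + R) * F x)"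
      using assms False by (intro sum_strict_mono mult_strict_left_mono) (auto simp: R_def not_le)
    moreover have "(\<Sum>x\<in>V. (n * r x + R) * (2 * c)) = (\<Sum>x\<in>V. n * r x + R) * (2 * c)"
      by (simp add: sum_distrib_right)
    moreover have "(\<Sum>x\<in>V. n * r x + R) = 2 * n * R"
      by (simp add: sum.distrib R_def n_def flip: sum_distrib_left)
    ultimately show False using le by simp
  qed
  then show ?thesis by (simp add: F_def c_def)
qed

section \<open>Shortest-path trees\<close>

text \<open>Vertices may repeat, so walks concatenate freely and the minimum has an obvious last
  step.\<close>

inductive walk :: "'a set set \<Rightarrow> ('a set \<Rightarrow> nat) \<Rightarrow> 'a \<Rightarrow> 'a \<Rightarrow> nat \<Rightarrow> bool" for E w x where
  walk_refl: "walk E w x x 0"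
| walk_step: "walk E w x u d \<Longrightarrow> {u, v} \<in> E \<Longrightarrow> walk E w x v (d + w {u, v})"

definition graph_dist :: "'a set set \<Rightarrow> ('a set \<Rightarrow> nat) \<Rightarrow> 'a \<Rightarrow> 'a \<Rightarrow> nat" where
  "graph_dist E w x v = (LEAST d. walk E w x v d)"

lemma walk_Cons: "walk E w x v d \<Longrightarrow> {a, x} \<in> E \<Longrightarrow> walk E w a v (w {a, x} + d)"
proof (induction rule: walk.induct)
  case walk_refl
  then show ?case using walk_step[OF walk.walk_refl, of a x E w] by simp
next
  case (walk_step u d v)
  then show ?case using walk.walk_step[of E w a u "w {a, x} + d" v] by (simp add: add.assoc)
qed

lemma path_weight_Cons: "path_weight w (x # y # ys) = w {x, y} + path_weight w (y # ys)"
  by (simp add: path_weight_def)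

lemma walk_of_path: "simple_path E x xs v \<Longrightarrow> walk E w x v (path_weight w xs)"
proof (induction xs arbitrary: x)
  case (Cons y ys)
  show ?case
  proof (cases ys)
    case Nil
    then show ?thesis using Cons.prems by (auto simp: path_weight_def intro: walk_refl)
  next
    case (Cons z zs)
    then have "walk E w z v (path_weight w ys)" "{x, z} \<in> E" "y = x"
      using Cons.IH[of z] Cons.prems by auto
    then show ?thesis using walk_Cons[of E w z v _ x] by (simp add: Cons path_weight_Cons)
  qed
qed simp

lemma graph_dist_le: "walk E w x v d \<Longrightarrow> graph_dist E w x v \<le> d"
  unfolding graph_dist_def by (rule Least_le)

lemma graph_dist_refl: "graph_dist E w x x = 0"
  using graph_dist_le[OF walk_refl, of E w x] by simp

lemma walk_graph_dist: "walk E w x v d \<Longrightarrow> walk E w x v (graph_dist E w x v)"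
  unfolding graph_dist_def by (rule LeastI)

lemma graph_dist_pred:
  assumes "walk E w x v d" "v \<noteq> x"
  obtains u where "{u, v} \<in> E" "graph_dist E w x u + w {u, v} \<le> graph_dist E w x v"
  using walk_graph_dist[OF assms(1)]
proof cases
  case (walk_step u d')
  then show ?thesis using that[of u] graph_dist_le[OF walk_step(2)] by simp
qed (use assms in auto)

lemma simple_graph_edge:
  assumes "simple_graph V E" "{u, v} \<in> E"
  shows "u \<in> V" "v \<in> V" "u \<noteq> v"
  using assms unfolding simple_graph_def by (auto simp: doubleton_eq_iff dest!: bspec)

lemma simple_graph_edges: "simple_graph V E \<Longrightarrow> E \<subseteq> (\<lambda>(u, v). {u, v}) ` (V \<times> V)"
  unfolding simple_graph_def by fastforce

lemma simple_graph_finite: "simple_graph V E \<Longrightarrow> finite E"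
  using simple_graph_edges[of V E] by (auto simp: simple_graph_def intro: finite_subset)

lemma simple_graph_card_edges:
  assumes "simple_graph V E"
  shows "card E \<le> card V * card V"
proof -
  have "card E \<le> card ((\<lambda>(u, v). {u, v}) ` (V \<times> V))"
    using simple_graph_edges[OF assms] assms by (intro card_mono) (auto simp: simple_graph_def)
  also have "\<dots> \<le> card (V \<times> V)" using assms by (intro card_image_le) (auto simp: simple_graph_def)
  finally show ?thesis by (simp add: card_cartesian_product)
qed

lemma forest_spanning_tree:
  assumes "simple_graph V E" "spanning_tree V E T"
  shows "forest T"
proof
  have "T \<subseteq> E" using assms(2) by (simp add: spanning_tree_def)
  then show "finite T" "\<And>a b. {a, b} \<in> T \<Longrightarrow> a \<noteq> b"
    using simple_graph_finite[OF assms(1)] simple_graph_edge(3)[OF assms(1)] by (blast intro: finite_subset)+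
  show "\<nexists>xs. graph_cycle T xs" using assms(2) by (simp add: spanning_tree_def)
qed

lemma simple_path_mono: "simple_path T u xs v \<Longrightarrow> T \<subseteq> E \<Longrightarrow> simple_path E u xs v"
  by (auto simp: simple_path_def elim!: successively_mono)

lemma graph_dist_le_tree_dist:
  assumes "simple_graph V E" "spanning_tree V E T" "u \<in> V" "v \<in> V"
  shows "graph_dist E w u v \<le> cut_dist T w u v"
proof -
  interpret forest T using assms(1,2) by (rule forest_spanning_tree)
  obtain xs where "simple_path T u xs v"
    using assms unfolding spanning_tree_def connected_graph_def by blast
  moreover have "T \<subseteq> E" using assms(2) by (simp add: spanning_tree_def)
  ultimately show ?thesis
    using graph_dist_le[OF walk_of_path[OF simple_path_mono]] path_weight_cut by metis
qed

text \<open>In the second form the two requirement terms are merged by exchanging \<open>u\<close>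
  and \<open>v\<close>; one-sided sums are what averaging and root costs work with.\<close>

lemma sum_req_cost_cut:
  assumes "simple_graph V E" "spanning_tree V E T"
  shows "sum_req_cost V w r T = (\<Sum>u\<in>V. \<Sum>v\<in>V. (r u + r v) * cut_dist T w u v)"
    and "sum_req_cost V w r T = 2 * (\<Sum>u\<in>V. \<Sum>v\<in>V. r u * cut_dist T w u v)"
proof -
  interpret forest T using assms by (rule forest_spanning_tree)
  have "tree_dist w T u v = cut_dist T w u v" if "u \<in> V" "v \<in> V" for u v
    using assms(2) that tree_dist_cut unfolding spanning_tree_def connected_graph_def by blast
  then show 1: "sum_req_cost V w r T = (\<Sum>u\<in>V. \<Sum>v\<in>V. (r u + r v) * cut_dist T w u v)"
    unfolding sum_req_cost_def by (auto intro!: sum.cong)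
  have "(\<Sum>u\<in>V. \<Sum>v\<in>V. r v * cut_dist T w u v) = (\<Sum>u\<in>V. \<Sum>v\<in>V. r u * cut_dist T w u v)"
    by (subst sum.swap) (simp add: cut_dist_sym)
  then show "sum_req_cost V w r T = 2 * (\<Sum>u\<in>V. \<Sum>v\<in>V. r u * cut_dist T w u v)"
    unfolding 1 by (simp add: distrib_right sum.distrib)
qed

definition root_cost :: "'a set \<Rightarrow> 'a set set \<Rightarrow> ('a set \<Rightarrow> nat) \<Rightarrow> ('a \<Rightarrow> nat) \<Rightarrow> 'a \<Rightarrow> nat" where
  "root_cost V E w r x = (\<Sum>u\<in>V. \<Sum>v\<in>V. r u * (graph_dist E w x u + graph_dist E w x v))"

locale shortest_path_tree =
  fixes V :: "'a set" and E :: "'a set set" and w :: "'a set \<Rightarrow> nat" and x :: 'a and par :: "'a \<Rightarrow> 'a"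
  assumes G: "simple_graph V E"
    and w_pos: "\<And>e. e \<in> E \<Longrightarrow> w e > 0"
    and x: "x \<in> V"
    and par_edge: "\<And>v. v \<in> V - {x} \<Longrightarrow> {par v, v} \<in> E"
    and par_dist: "\<And>v. v \<in> V - {x} \<Longrightarrow> graph_dist E w x (par v) + w {par v, v} \<le> graph_dist E w x v"
begin

abbreviation D :: "'a \<Rightarrow> nat" where "D \<equiv> graph_dist E w x"

definition Y :: "'a set set" where "Y = (\<lambda>v. {par v, v}) ` (V - {x})"

lemma par:
  assumes "v \<in> V - {x}"
  shows "par v \<in> V \<and> D (par v) < D v"
  using par_dist[OF assms] w_pos[OF par_edge[OF assms]] simple_graph_edge(1)[OF G par_edge[OF assms]] by auto

text \<open>The last conjunct serves the induction: distances along the path of the parent are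
  smaller than \<open>D v\<close>, so \<open>v\<close> can be prepended without repetition.\<close>

lemma Y_path: "v \<in> V \<Longrightarrow> \<exists>xs. simple_path Y v xs x \<and> path_weight w xs \<le> D v \<and> (\<forall>y\<in>set xs. D y \<le> D v)"
proof (induction "D v" arbitrary: v rule: less_induct)
  case less
  show ?case
  proof (cases "v = x")
    case True
    then show ?thesis by (intro exI[of _ "[x]"]) (simp add: path_weight_def)
  next
    case False
    then have v: "v \<in> V - {x}" using less by simp
    obtain xs where xs: "simple_path Y (par v) xs x" "path_weight w xs \<le> D (par v)" "\<forall>y\<in>set xs. D y \<le> D (par v)"
      using less.hyps par[OF v] by blast
    obtain ys where ys: "xs = par v # ys" using xs(1) by (cases xs) (auto dest: simple_path_hd)
    have "v \<notin> set xs" using xs(3) par[OF v] by auto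
    moreover have "{v, par v} \<in> Y" using v by (auto simp: Y_def insert_commute)
    ultimately have "simple_path Y v (v # xs) x" using xs(1) by (simp add: ys)
    moreover have "path_weight w (v # xs) \<le> D v"
      using xs(2) par_dist[OF v] by (simp add: ys path_weight_Cons insert_commute)
    moreover have "\<forall>y\<in>set (v # xs). D y \<le> D v" using xs(3) par[OF v] by (auto intro: order.trans less_imp_le)
    ultimately show ?thesis by blast
  qed
qed

lemma Y_edge: "{a, b} \<in> Y \<Longrightarrow> (b \<in> V - {x} \<and> a = par b) \<or> (a \<in> V - {x} \<and> b = par a)"
  by (auto simp: Y_def doubleton_eq_iff)

text \<open>A vertex of maximal distance on a cycle would have two parents.\<close>

lemma Y_acyclic: "\<nexists>xs. graph_cycle Y xs"
proof
  assume "\<exists>xs. graph_cycle Y xs"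
  then obtain xs where xs: "length xs \<ge> 3" "distinct xs" "successively (\<lambda>x y. {x, y} \<in> Y) xs" "{last xs, hd xs} \<in> Y"
    by (auto simp: graph_cycle_def)
  let ?m = "length xs"
  have edge: "{xs ! i, xs ! (Suc i mod ?m)} \<in> Y" if "i < ?m" for i
  proof (cases "Suc i = ?m")
    case True
    then have "i = ?m - 1" "xs \<noteq> []" using xs(1) by auto
    then have "xs ! i = last xs" "hd xs = xs ! 0" by (simp_all add: last_conv_nth hd_conv_nth)
    then show ?thesis using xs(4) True by simp
  next
    case False
    then show ?thesis using xs(3) that by (simp add: successively_conv_nth)
  qed
  obtain i where i: "i < ?m" "\<forall>j<?m. D (xs ! j) \<le> D (xs ! i)"
  proof -
    have "Max ((\<lambda>j. D (xs ! j)) ` {..<?m}) \<in> (\<lambda>j. D (xs ! j)) ` {..<?m}"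
      using xs(1) by (intro Max_in) (auto simp: lessThan_empty_iff)
    then obtain i where i: "i < ?m" "Max ((\<lambda>j. D (xs ! j)) ` {..<?m}) = D (xs ! i)" by auto
    have "D (xs ! j) \<le> D (xs ! i)" if "j < ?m" for j
      unfolding i(2)[symmetric] using that by (intro Max_ge) auto
    then show thesis using that i(1) by blast
  qed
  define j where "j = (if i = 0 then ?m - 1 else i - 1)"
  define k where "k = Suc i mod ?m"
  have j: "j < ?m" "Suc j mod ?m = i" using i(1) by (auto simp: j_def)
  have k: "k < ?m" unfolding k_def using i(1) by (intro mod_less_divisor) linarith
  have jk: "j \<noteq> k"
    using i(1) xs(1) by (cases "Suc i = ?m") (auto simp: j_def k_def)
  have "xs ! j = par (xs ! i)"
    using edge[OF j(1)] i(2) j(1) par[of "xs ! j"] Y_edge[of "xs ! j" "xs ! i"] unfolding j(2) by (metis not_le)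
  moreover have "xs ! k = par (xs ! i)"
    using edge[OF i(1)] i(2) k par[of "xs ! k"] Y_edge[of "xs ! i" "xs ! k"] unfolding k_def[symmetric] by (metis not_le)
  ultimately show False using jk j(1) k xs(2) by (metis nth_eq_iff_index_eq)
qed

lemma Y_spanning: "spanning_tree V E Y"
proof -
  have "reach Y u v" if "u \<in> V" "v \<in> V" for u v
    using reach_trans[OF _ reach_sym] Y_path[OF that(1)] Y_path[OF that(2)] unfolding reach_def by metis
  then show ?thesis
    using Y_acyclic par_edge by (auto simp: spanning_tree_def connected_graph_def reach_def Y_def)
qed

text \<open>Every pair is routed through the root.\<close>

lemma cost_Y: "sum_req_cost V w r Y \<le> 2 * root_cost V E w r x"
proof -
  interpret forest Y using G Y_spanning by (rule forest_spanning_tree)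
  have d: "cut_dist Y w u x \<le> D u" if "u \<in> V" for u
    using Y_path[OF that] path_weight_cut by metis
  have "cut_dist Y w u v \<le> D u + D v" if "u \<in> V" "v \<in> V" for u v
    using cut_dist_triangle[of Y w u v x] d[OF that(1)] d[OF that(2)] by linarith
  then show ?thesis
    unfolding sum_req_cost_cut(2)[OF G Y_spanning] root_cost_def
    by (intro mult_left_mono sum_mono) auto
qed

end

text \<open>Scaled cost is \<open>N\<close> times the true cost plus the cost for unit weights.
  Twice the latter stays below \<open>N\<close> for \<open>T\<close>, so the inequality for scaled
  weights, divided by \<open>N\<close>, leaves an error below 1, and the costs are integers.\<close>

theorem shortest_path_tree_approx:
  fixes w :: "'a set \<Rightarrow> nat"
  assumes G: "simple_graph V E" and T: "spanning_tree V E T"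
    and r: "\<And>v. v \<in> V \<Longrightarrow> r v < B" and N: "N = 4 * card V ^ 4 * B + 1"
    and spt: "shortest_path_tree V E (\<lambda>e. N * w e + 1) x par"
    and best: "\<And>y. y \<in> V \<Longrightarrow> root_cost V E (\<lambda>e. N * w e + 1) r x \<le> root_cost V E (\<lambda>e. N * w e + 1) r y"
  shows "sum_req_cost V w r (shortest_path_tree.Y V x par) \<le> 2 * sum_req_cost V w r T"
proof -
  let ?w = "\<lambda>e. N * w e + 1"
  interpret shortest_path_tree V E ?w x par by fact
  have split: "sum_req_cost V ?w r S = N * sum_req_cost V w r S + sum_req_cost V (\<lambda>_. 1) r S"
    if S: "spanning_tree V E S" for S
  proof -
    have "cut_dist S ?w u v = N * cut_dist S w u v + cut_dist S (\<lambda>_. 1) u v" for u v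
      by (simp add: cut_dist_def distrib_right sum.distrib sum_distrib_left mult.assoc)
    then show ?thesis unfolding sum_req_cost_cut(2)[OF G S]
      by (simp add: distrib_left sum.distrib sum_distrib_left mult.left_commute)
  qed
  have fV: "finite V" "V \<noteq> {}" using G by (auto simp: simple_graph_def)
  obtain y where y: "y \<in> V" "(\<Sum>u\<in>V. \<Sum>v\<in>V. r u * (cut_dist T ?w u y + cut_dist T ?w v y))
    \<le> 2 * (\<Sum>u\<in>V. \<Sum>v\<in>V. r u * cut_dist T ?w u v)"
    using exists_good_root[OF fV] by blast
  have "root_cost V E ?w r y \<le> (\<Sum>u\<in>V. \<Sum>v\<in>V. r u * (cut_dist T ?w u y + cut_dist T ?w v y))"
    unfolding root_cost_def using graph_dist_le_tree_dist[OF G T y(1), of _ ?w]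
    by (intro sum_mono mult_left_mono add_mono) (auto simp: cut_dist_sym[of _ _ _ y])
  also note y(2)
  also have "2 * (\<Sum>u\<in>V. \<Sum>v\<in>V. r u * cut_dist T ?w u v) = sum_req_cost V ?w r T"
    by (simp only: sum_req_cost_cut(2)[OF G T])
  finally have "sum_req_cost V ?w r Y \<le> 2 * sum_req_cost V ?w r T"
    using cost_Y[of r] best[OF y(1)] by linarith
  then have main: "N * sum_req_cost V w r Y \<le> 2 * (N * sum_req_cost V w r T) + 2 * sum_req_cost V (\<lambda>_. 1) r T"
    unfolding split[OF T] split[OF Y_spanning] by simp
  have cT: "cut_dist T (\<lambda>_. 1) u v \<le> card V * card V" for u v
  proof -
    have "T \<subseteq> E" using T by (simp add: spanning_tree_def)
    then have "card T \<le> card V * card V"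
      using simple_graph_card_edges[OF G] card_mono[OF simple_graph_finite[OF G]] by (meson le_trans)
    moreover have "cut_dist T (\<lambda>_. 1) u v \<le> (\<Sum>e\<in>T. 1)" unfolding cut_dist_def by (rule sum_mono) simp
    ultimately show ?thesis by simp
  qed
  have "(\<Sum>u\<in>V. \<Sum>v\<in>V. r u * cut_dist T (\<lambda>_. 1) u v) \<le> (\<Sum>u\<in>V. \<Sum>v\<in>V. B * (card V * card V))"
    using r cT by (intro sum_mono mult_mono) (auto intro: less_imp_le)
  also have "\<dots> = card V ^ 4 * B" by (simp add: power4_eq_xxxx)
  \<comment> \<open>Origin of \<open>N\<close>: a unit distance is at most the number of tree edges,
    crudely \<open>card V * card V\<close>; one factor 2 comes from both endpoints of a pair, the
    other from the approximation ratio.\<close>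
  finally have "2 * sum_req_cost V (\<lambda>_. 1) r T < N"
    unfolding sum_req_cost_cut(2)[OF G T] N by simp
  with main have "N * sum_req_cost V w r Y < N * (2 * sum_req_cost V w r T + 1)" by simp
  then have "sum_req_cost V w r Y < 2 * sum_req_cost V w r T + 1" by (simp only: mult_less_cancel1)
  then show ?thesis by simp
qed

text \<open>There are finitely many spanning trees and at least one, so \<open>arg_min_on\<close>
  picks one of them.\<close>

lemma SROCT_spanning:
  assumes G: "simple_graph V E" and T: "spanning_tree V E T"
  shows "spanning_tree V E (SROCT V E w r)"
proof -
  have "{T. spanning_tree V E T} \<subseteq> Pow E" by (auto simp: spanning_tree_def)
  then have "finite {T. spanning_tree V E T}"
    using simple_graph_finite[OF G] by (meson finite_Pow_iff finite_subset)
  then have "SROCT V E w r \<in> {T. spanning_tree V E T}"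
    unfolding SROCT_def using T by (intro arg_min_if_finite) auto
  then show ?thesis by simp
qed

section \<open>The circuit\<close>

text \<open>The circuit keeps a memory of cells indexed by a region and three coordinates below \<open>size_bd\<close>.
  Region 2 holds distance thresholds \<open>R a b d\<close> for one weighted digraph. Its nodes are the
  vertices \<open>0, \<dots>, n - 1\<close> of the graph; then a line of \<open>val_bd\<close> arcs for every pair of vertices,
  whose length is the weight of the edge (the arc \<open>\<alpha>\<close> has length one if bit \<open>floorlog 2 \<alpha> - 1\<close> of the
  weight is set, and there are \<open>2\<^sup>j\<close> numbers \<open>\<alpha>\<close> with \<open>floorlog 2 \<alpha> = j + 1\<close>); then for every vertex
  \<open>x\<close> a line whose length is the cost of the root \<open>x\<close>, obtained in the same way from the
  requirements and the distances. The weight of an arc \<open>u v\<close> of the graph part is read off from the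
  line of \<open>u v\<close>. All regions are updated in every step; the thresholds only ever grow and are
  never too optimistic, and the other regions become correct once the thresholds are complete.\<close>

definition width :: "nat \<Rightarrow> nat \<Rightarrow> nat" where
  "width f n = f * floorlog 2 n"

text \<open>An upper bound for \<open>2 ^ width f n\<close> when \<open>n > 0\<close>, by
  \<open>2 ^ floorlog 2 n \<le> 2 * n\<close>. The constant exponent keeps it expressible as an
  iterated product.\<close>

definition val_bd :: "nat \<Rightarrow> nat \<Rightarrow> nat" where
  "val_bd f n = (2 * n) ^ f"

text \<open>The \<open>N\<close> of \<open>shortest_path_tree_approx\<close> for requirements below
  \<open>val_bd f n\<close>.\<close>

definition scale :: "nat \<Rightarrow> nat \<Rightarrow> nat" where
  "scale f n = 4 * n ^ 4 * val_bd f n + 1"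

definition in_len :: "nat \<Rightarrow> nat \<Rightarrow> nat" where
  "in_len f n = n * n * (1 + width f n) + n * width f n"

text \<open>A simple path has at most \<open>n\<close> vertices, and each of its edges weighs at
  most \<open>scale f n * val_bd f n + 1\<close>.\<close>

definition dist_bd :: "nat \<Rightarrow> nat \<Rightarrow> nat" where
  "dist_bd f n = n * (scale f n * val_bd f n + 1)"

text \<open>One block of \<open>val_bd f n\<close> arcs for each pair \<open>u\<close>,
  \<open>v\<close> and each of the summands \<open>r u * D x u\<close> and
  \<open>r u * D x v\<close>.\<close>

definition line_len :: "nat \<Rightarrow> nat \<Rightarrow> nat" where
  "line_len f n = n * n * (2 * val_bd f n)"

text \<open>One side length that exceeds all coordinates ever used: input positions, nodes of the
  digraph, distances, and root costs, which \<open>line_len f n * dist_bd f n\<close>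
  bounds.\<close>

definition size_bd :: "nat \<Rightarrow> nat \<Rightarrow> nat" where
  "size_bd f n = in_len f n + n + n * n * val_bd f n + n * line_len f n
     + line_len f n * dist_bd f n + dist_bd f n + 10"

definition cell :: "nat \<Rightarrow> nat \<Rightarrow> nat \<Rightarrow> nat \<Rightarrow> nat \<Rightarrow> nat" where
  "cell X reg a b c = ((reg * X + a) * X + b) * X + c"

definition pos_lit :: "nat \<Rightarrow> nat \<Rightarrow> nat \<Rightarrow> nat \<Rightarrow> nat \<Rightarrow> nat \<Rightarrow> nat" where
  "pos_lit f n reg a b c = 2 * cell (size_bd f n) reg a b c"

definition neg_lit :: "nat \<Rightarrow> nat \<Rightarrow> nat \<Rightarrow> nat \<Rightarrow> nat \<Rightarrow> nat \<Rightarrow> nat" where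
  "neg_lit f n reg a b c = 2 * cell (size_bd f n) reg a b c + 1"

text \<open>The literals \<open>0\<close> and \<open>1\<close> are constantly true and false, respectively.\<close>

definition edge_line :: "nat \<Rightarrow> nat \<Rightarrow> nat \<Rightarrow> nat \<Rightarrow> nat" where
  "edge_line f n u v = n + (u * n + v) * val_bd f n"

definition root_line :: "nat \<Rightarrow> nat \<Rightarrow> nat \<Rightarrow> nat" where
  "root_line f n x = n + n * n * val_bd f n + x * line_len f n"

text \<open>The arc number decodes as
  \<open>(((x * n + u) * n + v) * 2 + s) * val_bd f n + \<alpha>\<close>, with \<open>s\<close>
  choosing between \<open>D x u\<close> and \<open>D x v\<close>. A zero bit of \<open>r u\<close>
  makes the arc free (term \<open>e = 0\<close>); otherwise its length is read from region
  2.\<close>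

definition root_arc_term :: "nat \<Rightarrow> nat \<Rightarrow> nat \<Rightarrow> nat \<Rightarrow> nat \<Rightarrow> nat \<times> nat" where
  "root_arc_term f n i c e = (let \<alpha> = i mod val_bd f n; q = i div val_bd f n;
     v = q div 2 mod n; u = q div 2 div n mod n; x = q div 2 div n div n in
     if \<not> i < n * line_len f n then (1, 1)
     else if \<alpha> = 0 \<or> width f n < floorlog 2 \<alpha> then (0, 0)
     else if e = 0 then (neg_lit f n 1 0 0 (n * n * (1 + width f n) + u * width f n + (floorlog 2 \<alpha> - 1)), 0)
     else (pos_lit f n 2 x (if q mod 2 = 0 then u else v) c, 0))"

text \<open>The arc \<open>\<alpha> = 0\<close> carries no bit of the weight and is used as the test
  for the edge: at a non-edge the line is broken.\<close>

definition arc_term :: "nat \<Rightarrow> nat \<Rightarrow> nat \<Rightarrow> nat \<Rightarrow> nat \<Rightarrow> nat \<times> nat" where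
  "arc_term f n i c e = (let \<alpha> = i mod val_bd f n; q = i div val_bd f n in
     if \<not> i < n * n * val_bd f n then root_arc_term f n (i - n * n * val_bd f n) c e
     else if \<alpha> = 0 then (pos_lit f n 1 0 0 (q * (1 + width f n)), 0)
     else if c = 0 \<and> floorlog 2 \<alpha> \<le> width f n
       then (neg_lit f n 1 0 0 (q * (1 + width f n) + floorlog 2 \<alpha>), 0)
     else (0, 0))"

text \<open>For \<open>c > 0\<close>, \<open>(c - 1) div scale f n\<close> is the largest weight
  \<open>v\<close> with \<open>scale f n * v + 1 \<le> c\<close>, so the scaled weight is compared
  through the line for the raw weight.\<close>

definition base_term :: "nat \<Rightarrow> nat \<Rightarrow> nat \<Rightarrow> nat \<Rightarrow> nat \<Rightarrow> nat \<Rightarrow> nat \<times> nat" where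
  "base_term f n a b c e =
    (if a = b then (0, 0)
     else if a < n \<and> b < n then
       (if c = 0 then (1, 1)
        else (pos_lit f n 2 (edge_line f n a b) (edge_line f n a b + val_bd f n) ((c - 1) div scale f n), 0))
     else if n \<le> a \<and> b = a + 1 then arc_term f n (a - n) c e
     else (1, 1))"

text \<open>The indices \<open>k\<close>, \<open>z\<close> and \<open>e\<close> act as existential
  quantifiers. Regions: 0 constant; 1 input; 2 thresholds; 3
  \<open>D a u + scale f n * c < D a v\<close> where \<open>b = u * n + v\<close>; 4
  \<open>b\<close> is a parent of \<open>c\<close> for root \<open>a\<close>; 5 some vertex below
  \<open>b\<close> is; 6 root \<open>b\<close> is cheaper than root \<open>a\<close>; 7 root
  \<open>a\<close> is beaten, ties going to the smaller index; 8 \<open>b\<close> is the first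
  parent of \<open>c\<close>; 9 the output matrix.\<close>

definition update_term :: "nat \<Rightarrow> nat \<Rightarrow> nat \<Rightarrow> nat \<Rightarrow> nat \<Rightarrow> nat \<Rightarrow> nat \<Rightarrow> nat \<Rightarrow> nat \<Rightarrow> nat \<times> nat" where
  "update_term f n reg a b c k z e = (
     if reg = 0 then (0, 0)
     else if reg = 1 then (pos_lit f n 1 a b c, 0)
     else if reg = 2 then
       (if k = 0 then (pos_lit f n 2 a z (e mod (c + 1)), pos_lit f n 2 z b (c - e mod (c + 1)))
        else base_term f n a b c e)
     else if reg = 3 then
       (if e + scale f n * c < size_bd f n
        then (pos_lit f n 2 a (b div n) e, neg_lit f n 2 a (b mod n) (e + scale f n * c)) else (1, 1))
     else if reg = 4 then
       (pos_lit f n 3 a (b * n + c) e, pos_lit f n 2 (edge_line f n b c) (edge_line f n b c + val_bd f n) e)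
     else if reg = 5 then (if z < b then (pos_lit f n 4 a z c, 0) else (1, 1))
     else if reg = 6 then (pos_lit f n 2 (root_line f n b) (root_line f n (b + 1)) e,
        neg_lit f n 2 (root_line f n a) (root_line f n (a + 1)) e)
     else if reg = 7 then
       (if k = 0 then (if z < n then (pos_lit f n 6 a z 0, 0) else (1, 1))
        else (if z < a then (neg_lit f n 6 z a 0, 0) else (1, 1)))
     else if reg = 8 then (pos_lit f n 4 a b c, neg_lit f n 5 a b c)
     else (if z < n then (neg_lit f n 7 z 0 0, if k = 0 then pos_lit f n 8 z a b else pos_lit f n 8 z b a)
       else (1, 1)))"

definition num_cells :: "nat \<Rightarrow> nat \<Rightarrow> nat" where
  "num_cells f n = 10 * size_bd f n * size_bd f n * size_bd f n"

definition num_terms :: "nat \<Rightarrow> nat \<Rightarrow> nat" where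
  "num_terms f n = 2 * size_bd f n * size_bd f n"

text \<open>Coordinates outside their intended range can produce literals beyond the memory; these
  become false, so the circuit is well formed for all indices.\<close>

definition clip :: "nat \<Rightarrow> nat \<Rightarrow> nat \<Rightarrow> nat" where
  "clip f n l = (if l < 2 * num_cells f n then l else 1)"

definition cell_term :: "nat \<Rightarrow> nat \<Rightarrow> nat \<Rightarrow> nat \<Rightarrow> nat \<times> nat" where
  "cell_term f n s j = (let X = size_bd f n; t = update_term f n (s div X div X div X) (s div X div X mod X)
     (s div X mod X) (s mod X) (j div X div X) (j div X mod X) (j mod X) in (clip f n (fst t), clip f n (snd t)))"

text \<open>Region 0 is true and region 1 starts with the input; all else is false, so no threshold
  is claimed at the start.\<close>

definition init_gate :: "nat \<Rightarrow> nat \<Rightarrow> nat \<Rightarrow> gate" where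
  "init_gate f n s = (let b = cell (size_bd f n) 1 0 0 0 in
     if s < b then Const True else if s < b + in_len f n then In (s - b) else Const False)"

text \<open>Cell \<open>0\<close> is constantly true and doubles as the success bit of the
  answer.\<close>

definition output_cell :: "nat \<Rightarrow> nat \<Rightarrow> nat \<Rightarrow> nat" where
  "output_cell f n i = (if i = 0 then 0 else cell (size_bd f n) 9 ((i - 1) div n) ((i - 1) mod n) 0)"

text \<open>Three stages of path doubling, for edge lines, distances and root lines, and a constant
  number of layers that read off their results; \<open>out_iff\<close> asks for
  \<open>3 * K + 9\<close>.\<close>

definition num_layers :: "nat \<Rightarrow> nat \<Rightarrow> nat" where
  "num_layers f n = 3 * floorlog 2 (size_bd f n) + 11"

locale sroct_circuit =
  fixes f n :: nat
begin

abbreviation X :: nat where "X \<equiv> size_bd f n"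

lemma X_pos: "X > 0" and n_less_X: "n < X" and in_len_less_X: "in_len f n < X"
  by (simp_all add: size_bd_def)

lemma cell_less: "reg < 10 \<Longrightarrow> a < X \<Longrightarrow> b < X \<Longrightarrow> c < X \<Longrightarrow> cell X reg a b c < num_cells f n"
proof -
  assume *: "reg < 10" "a < X" "b < X" "c < X"
  have step: "q * X + d < Q * X" if "q < Q" "d < X" for q d Q
  proof -
    have "q * X + d < Suc q * X" using that by simp
    also have "\<dots> \<le> Q * X" using that by (intro mult_right_mono) auto
    finally show ?thesis .
  qed
  show ?thesis unfolding cell_def num_cells_def by (intro step *)
qed

lemma cell_decode:
  assumes "a < X" "b < X" "c < X"
  shows "cell X reg a b c div X div X div X = reg" "cell X reg a b c div X div X mod X = a"
    "cell X reg a b c div X mod X = b" "cell X reg a b c mod X = c"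
  using assms by (auto simp: cell_def)

lemma cell_1: "cell X 1 0 0 c = cell X 1 0 0 0 + c"
  by (simp add: cell_def)

sublocale layered "num_terms f n" "num_cells f n" "num_layers f n" "in_len f n" "n * n + 1"
  "init_gate f n" "cell_term f n" "output_cell f n"
proof
  show "num_terms f n > 0" using X_pos by (simp add: num_terms_def)
  show "(\<exists>i<in_len f n. init_gate f n s = In i) \<or> (\<exists>b. init_gate f n s = Const b)" for s
    by (auto simp: init_gate_def Let_def)
  have "X * X * X > 0" using X_pos by simp
  moreover have "num_cells f n = 10 * (X * X * X)" by (simp add: num_cells_def)
  ultimately have "2 * num_cells f n > 1" by linarith
  then show "fst (cell_term f n s j) < 2 * num_cells f n \<and> snd (cell_term f n s j) < 2 * num_cells f n" for s j
    by (auto simp: cell_term_def clip_def Let_def)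
  show "output_cell f n i < num_cells f n" if "i < n * n + 1" for i
  proof (cases "i = 0")
    case True
    then show ?thesis using X_pos by (simp add: output_cell_def num_cells_def)
  next
    case False
    then have "i - 1 < n * n" using that by auto
    then have "n > 0" "(i - 1) div n < n" by (auto simp: less_mult_imp_div_less) (cases n; simp)
    then show ?thesis using False n_less_X X_pos
      by (auto simp: output_cell_def intro!: cell_less less_trans[OF _ n_less_X])
  qed
qed

definition M :: "bool list \<Rightarrow> nat \<Rightarrow> nat \<Rightarrow> nat \<Rightarrow> nat \<Rightarrow> nat \<Rightarrow> bool" where
  "M x t reg a b c = mem x t (cell X reg a b c)"

definition L :: "bool list \<Rightarrow> nat \<Rightarrow> nat \<Rightarrow> bool" where
  "L x t l = lit x t (clip f n l)"

lemma L_pos: "reg < 10 \<Longrightarrow> a < X \<Longrightarrow> b < X \<Longrightarrow> c < X \<Longrightarrow> L x t (pos_lit f n reg a b c) = M x t reg a b c"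
  and L_neg: "reg < 10 \<Longrightarrow> a < X \<Longrightarrow> b < X \<Longrightarrow> c < X \<Longrightarrow> L x t (neg_lit f n reg a b c) = (\<not> M x t reg a b c)"
  using cell_less[of reg a b c] by (auto simp: L_def lit_def pos_lit_def neg_lit_def clip_def M_def)

lemma ex_less_2: "(\<exists>k<2. P k) \<longleftrightarrow> P 0 \<or> P (1 :: nat)"
  by (auto simp: less_2_cases_iff)

lemma M_Suc:
  assumes "a < X" "b < X" "c < X"
  shows "M x (Suc t) reg a b c \<longleftrightarrow> (\<exists>k<2. \<exists>z<X. \<exists>e<X.
    L x t (fst (update_term f n reg a b c k z e)) \<and> L x t (snd (update_term f n reg a b c k z e)))"
    (is "_ \<longleftrightarrow> ?R")
proof -
  have "M x (Suc t) reg a b c \<longleftrightarrow> (\<exists>j<num_terms f n.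
    L x t (fst (update_term f n reg a b c (j div X div X) (j div X mod X) (j mod X))) \<and>
    L x t (snd (update_term f n reg a b c (j div X div X) (j div X mod X) (j mod X))))"
    unfolding M_def mem_Suc cell_term_def Let_def L_def by (simp add: cell_decode assms)
  also have "\<dots> \<longleftrightarrow> ?R"
  proof
    assume "\<exists>j<num_terms f n.
      L x t (fst (update_term f n reg a b c (j div X div X) (j div X mod X) (j mod X))) \<and>
      L x t (snd (update_term f n reg a b c (j div X div X) (j div X mod X) (j mod X)))"
    then obtain j where j: "j < num_terms f n"
      "L x t (fst (update_term f n reg a b c (j div X div X) (j div X mod X) (j mod X)))"
      "L x t (snd (update_term f n reg a b c (j div X div X) (j div X mod X) (j mod X)))" by blast
    have "j div X div X < 2"
      using j(1) unfolding num_terms_def by (intro less_mult_imp_div_less) (simp add: mult.assoc)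
    then show ?R using j(2,3) X_pos by (metis mod_less_divisor)
  next
    assume ?R
    then obtain k z e where k: "k < 2" "z < X" "e < X"
      "L x t (fst (update_term f n reg a b c k z e))" "L x t (snd (update_term f n reg a b c k z e))" by blast
    let ?j = "(k * X + z) * X + e"
    have d: "?j div X div X = k" "?j div X mod X = z" "?j mod X = e" using k by auto
    have "?j < num_terms f n"
    proof -
      have "k * X + z < Suc k * X" using k by simp
      also have "\<dots> \<le> 2 * X" using k(1) by (intro mult_right_mono) auto
      finally have "Suc (k * X + z) * X \<le> 2 * X * X" by (intro mult_right_mono) auto
      then show ?thesis using k(3) by (simp add: num_terms_def)
    qed
    then show "\<exists>j<num_terms f n.
      L x t (fst (update_term f n reg a b c (j div X div X) (j div X mod X) (j mod X))) \<and>
      L x t (snd (update_term f n reg a b c (j div X div X) (j div X mod X) (j mod X)))"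
      using k d by (intro exI[of _ ?j]) simp
  qed
  finally show ?thesis .
qed

lemma ex_X: "\<exists>z. z < X" and ex_2: "\<exists>k. k < (2 :: nat)"
  using X_pos by (auto intro: exI[of _ 0])

text \<open>Cell \<open>0\<close> refers to itself: its terms are the literal \<open>0\<close>, so
  its initial truth is passed on from layer to layer.\<close>

lemma M_0: "M x t 0 0 0 0"
proof (cases t)
  case 0
  then show ?thesis using X_pos by (simp add: M_def init_gate_def cell_def)
next
  case (Suc t')
  have "M x t' 0 0 0 0 \<Longrightarrow> L x t' 0"
    using L_pos[of 0 0 0 0 x t'] X_pos by (simp add: pos_lit_def cell_def)
  then show ?thesis unfolding Suc
  proof (induction t')
    case 0
    have "M x 0 0 0 0 0" using X_pos by (simp add: M_def init_gate_def cell_def)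
    then show ?case using 0 X_pos M_Suc[of 0 0 0 x 0 0] by (auto simp: update_term_def intro!: exI[of _ 0])
  next
    case (Suc t')
    have "M x (Suc t') 0 0 0 0" using L_pos[of 0 0 0 0 x t'] X_pos by (intro Suc.IH) (simp add: pos_lit_def cell_def)
    then show ?case using Suc.prems X_pos M_Suc[of 0 0 0 x "Suc t'" 0] by (auto simp: update_term_def intro!: exI[of _ 0])
  qed
qed

lemma L_0 [simp]: "L x t 0"
  using L_pos[of 0 0 0 0 x t] X_pos M_0 by (simp add: pos_lit_def cell_def)

lemma L_1 [simp]: "\<not> L x t (Suc 0)"
  using L_neg[of 0 0 0 0 x t] X_pos M_0 by (simp add: neg_lit_def cell_def)

lemma M_init:
  assumes "reg \<ge> 2"
  shows "\<not> M x 0 reg a b c"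
proof -
  define Y where "Y = X * X * X"
  have "2 * Y \<le> reg * Y" using assms by (rule mult_right_mono) simp
  moreover have "reg * Y \<le> cell X reg a b c" by (simp add: cell_def Y_def algebra_simps)
  moreover have "X * 1 \<le> X * (X * X)" using X_pos by (intro mult_left_mono) auto
  moreover have "cell X 1 0 0 0 = Y" by (simp add: cell_def Y_def)
  moreover have "X * (X * X) = Y" by (simp add: Y_def)
  ultimately have "cell X 1 0 0 0 + in_len f n \<le> cell X reg a b c"
    using in_len_less_X by linarith
  then show ?thesis by (simp add: M_def init_gate_def Let_def)
qed

lemma M_input: "i < in_len f n \<Longrightarrow> M x t 1 0 0 i = x ! i"
proof (induction t)
  case 0
  then show ?case by (simp add: M_def init_gate_def Let_def cell_1[of i, unfolded One_nat_def])
next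
  case (Suc t)
  then have "i < X" using in_len_less_X by simp
  then show ?case using Suc X_pos M_Suc[of 0 0 i x t 1] ex_X ex_2 by (auto simp: update_term_def L_pos)
qed

abbreviation R :: "bool list \<Rightarrow> nat \<Rightarrow> nat \<Rightarrow> nat \<Rightarrow> nat \<Rightarrow> bool" where
  "R x t a b c \<equiv> M x t 2 a b c"

text \<open>The remainder \<open>e mod (c + 1)\<close> runs through precisely the splits of the
  budget \<open>c\<close>.\<close>

lemma R_Suc:
  assumes "a < X" "b < X" "c < X"
  shows "R x (Suc t) a b c \<longleftrightarrow> (\<exists>z<X. \<exists>e\<le>c. R x t a z e \<and> R x t z b (c - e)) \<or>
    (\<exists>e<X. L x t (fst (base_term f n a b c e)) \<and> L x t (snd (base_term f n a b c e)))"
proof -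
  have "(\<exists>e<X. L x t (pos_lit f n 2 a z (e mod (c + 1))) \<and> L x t (pos_lit f n 2 z b (c - e mod (c + 1))))
    \<longleftrightarrow> (\<exists>e\<le>c. R x t a z e \<and> R x t z b (c - e))" (is "?A \<longleftrightarrow> ?B") if "z < X" for z
  proof
    assume ?A
    then obtain e where "L x t (pos_lit f n 2 a z (e mod (c + 1)))" "L x t (pos_lit f n 2 z b (c - e mod (c + 1)))" by blast
    moreover have le: "e mod (c + 1) \<le> c" by (metis Suc_eq_plus1 mod_Suc_le_divisor)
    moreover have "e mod (c + 1) < X" using le assms(3) by linarith
    ultimately show ?B using assms that by (intro exI[of _ "e mod (c + 1)"]) (auto simp: L_pos)
  next
    assume ?B
    then obtain e where "e \<le> c" "R x t a z e" "R x t z b (c - e)" by blast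
    then show ?A using assms that by (intro exI[of _ e]) (auto simp: L_pos)
  qed
  then have "(\<exists>z<X. \<exists>e<X. L x t (pos_lit f n 2 a z (e mod (c + 1))) \<and> L x t (pos_lit f n 2 z b (c - e mod (c + 1))))
    \<longleftrightarrow> (\<exists>z<X. \<exists>e\<le>c. R x t a z e \<and> R x t z b (c - e))" by blast
  then show ?thesis
    unfolding M_Suc[OF assms] ex_less_2 using ex_X by (simp add: update_term_def)
qed

lemma H_Suc:
  assumes "a < X" "b < X" "c < X" "b div n < X" "b mod n < X"
  shows "M x (Suc t) 3 a b c \<longleftrightarrow> (\<exists>e. e + scale f n * c < X \<and>
    R x t a (b div n) e \<and> \<not> R x t a (b mod n) (e + scale f n * c))"
  using M_Suc[OF assms(1-3), of x t 3] assms ex_X ex_2 by (auto simp: update_term_def L_pos L_neg)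

lemma good_Suc:
  assumes "a < X" "b < X" "c < X" "b * n + c < X" "edge_line f n b c + val_bd f n < X"
  shows "M x (Suc t) 4 a b c \<longleftrightarrow> (\<exists>e<X. M x t 3 a (b * n + c) e \<and>
    R x t (edge_line f n b c) (edge_line f n b c + val_bd f n) e)"
  using M_Suc[OF assms(1-3), of x t 4] assms ex_X ex_2 by (auto simp: update_term_def L_pos L_neg)

lemma bad_Suc:
  assumes "a < X" "b < X" "c < X"
  shows "M x (Suc t) 5 a b c \<longleftrightarrow> (\<exists>z<b. M x t 4 a z c)"
  using M_Suc[OF assms(1-3), of x t 5] assms ex_X ex_2 by (auto simp: update_term_def L_pos L_neg)

lemma gt_Suc:
  assumes "a < X" "b < X" "root_line f n (a + 1) < X" "root_line f n (b + 1) < X"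
  shows "M x (Suc t) 6 a b 0 \<longleftrightarrow> (\<exists>e<X. R x t (root_line f n b) (root_line f n (b + 1)) e \<and>
    \<not> R x t (root_line f n a) (root_line f n (a + 1)) e)"
proof -
  have "root_line f n a < X" "root_line f n b < X"
    using assms by (auto simp: root_line_def)
  then show ?thesis using M_Suc[OF assms(1,2) X_pos, of x t 6] assms ex_X ex_2
    by (auto simp: update_term_def L_pos L_neg)
qed

lemma lose_Suc:
  assumes "a < X"
  shows "M x (Suc t) 7 a 0 0 \<longleftrightarrow> (\<exists>z<n. M x t 6 a z 0) \<or> (\<exists>z<a. \<not> M x t 6 z a 0)"
proof -
  have z: "L x t (pos_lit f n 6 a z 0) = M x t 6 a z 0" if "z < n" for z
    using that assms n_less_X X_pos by (intro L_pos) auto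
  have z': "L x t (neg_lit f n 6 z a 0) = (\<not> M x t 6 z a 0)" if "z < a" for z
    using that assms X_pos by (intro L_neg) auto
  have "z < X" if "z < n \<or> z < a" for z using that assms n_less_X by auto
  then show ?thesis
    unfolding M_Suc[OF assms X_pos X_pos] ex_less_2 using ex_X
    by (auto simp: update_term_def z z' split: if_splits)
qed

lemma sel_Suc:
  assumes "a < X" "b < X" "c < X"
  shows "M x (Suc t) 8 a b c \<longleftrightarrow> M x t 4 a b c \<and> \<not> M x t 5 a b c"
  using M_Suc[OF assms(1-3), of x t 8] assms ex_X ex_2 by (auto simp: update_term_def L_pos L_neg)

lemma out_Suc:
  assumes "a < X" "b < X"
  shows "M x (Suc t) 9 a b 0 \<longleftrightarrow> (\<exists>z<n. \<not> M x t 7 z 0 0 \<and> (M x t 8 z a b \<or> M x t 8 z b a))"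
proof -
  have z: "L x t (neg_lit f n 7 z 0 0) = (\<not> M x t 7 z 0 0)" "L x t (pos_lit f n 8 z a b) = M x t 8 z a b"
    "L x t (pos_lit f n 8 z b a) = M x t 8 z b a" if "z < n" for z
    using less_trans[OF that n_less_X] assms X_pos by (simp_all add: L_pos L_neg)
  have "z < X" if "z < n" for z using that n_less_X by auto
  then show ?thesis
    unfolding M_Suc[OF assms X_pos] ex_less_2 using ex_X
    by (auto simp: update_term_def z split: if_splits)
qed

end

section \<open>Correctness of the circuit\<close>

lemma nth_concat_blocks:
  assumes "\<And>i. i < m \<Longrightarrow> length (g i) = k" "i < m" "j < k"
  shows "concat (map g [0..<m]) ! (i * k + j) = g i ! j"
  using assms
proof (induction m)
  case (Suc m)
  have len: "length (concat (map g [0..<m])) = m * k"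
  proof -
    have "map (length \<circ> g) [0..<m] = map (\<lambda>_. k) [0..<m]" using Suc.prems(1) by auto
    then show ?thesis by (simp only: length_concat map_map) (simp add: sum_list_triv)
  qed
  show ?case
  proof (cases "i < m")
    case True
    have "i * k + j < Suc i * k" using Suc.prems by simp
    also have "\<dots> \<le> m * k" using True by (intro mult_right_mono) auto
    finally show ?thesis using Suc True len by (simp add: nth_append)
  next
    case False
    then have "i = m" using Suc.prems by simp
    then show ?thesis using len by (simp add: nth_append)
  qed
qed simp

text \<open>Passing from \<open>k\<close> to \<open>Suc k\<close> adds the \<open>2 ^ k\<close>
  numbers of bit length \<open>Suc k\<close>, all of which test bit \<open>k\<close>.\<close>

lemma sum_bits_below:
  fixes v :: nat
  shows "(\<Sum>\<alpha><2 ^ k. of_bool (\<alpha> \<noteq> 0 \<and> bit v (floorlog 2 \<alpha> - 1))) = take_bit k v"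
proof (induction k)
  case (Suc k)
  let ?F = "\<lambda>\<alpha>. of_bool (\<alpha> \<noteq> 0 \<and> bit v (floorlog 2 \<alpha> - 1)) :: nat"
  have "floorlog 2 \<alpha> = Suc k" if "2 ^ k \<le> \<alpha>" "\<alpha> < 2 ^ Suc k" for \<alpha> :: nat
    using that floorlog_leI[of \<alpha> 2 "Suc k"] floorlog_ge_SucI[of 2 k \<alpha>] by simp
  then have "(\<Sum>\<alpha>\<in>{2 ^ k..<2 ^ Suc k}. ?F \<alpha>) = (\<Sum>\<alpha>\<in>{2 ^ k..<2 ^ Suc k :: nat}. of_bool (bit v k))"
    by (intro sum.cong refl) auto
  also have "\<dots> = 2 ^ k * of_bool (bit v k)" by (cases "bit v k") simp_all
  finally have 1: "(\<Sum>\<alpha>\<in>{2 ^ k..<2 ^ Suc k}. ?F \<alpha>) = 2 ^ k * of_bool (bit v k)" .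
  have "(2 :: nat) ^ k \<le> 2 ^ Suc k" by simp
  from sum.atLeastLessThan_concat[OF le0 this, of ?F, symmetric]
  have "(\<Sum>\<alpha><2 ^ Suc k. ?F \<alpha>) = (\<Sum>\<alpha><2 ^ k. ?F \<alpha>) + (\<Sum>\<alpha>\<in>{2 ^ k..<2 ^ Suc k}. ?F \<alpha>)"
    unfolding atLeast0LessThan .
  then show ?case unfolding 1 Suc.IH take_bit_Suc_from_most by (simp only: add.commute)
qed simp

lemma sum_bits:
  assumes "v < 2 ^ W" "2 ^ W \<le> B"
  shows "(\<Sum>\<alpha><B. of_bool (\<alpha> \<noteq> 0 \<and> floorlog 2 \<alpha> \<le> W \<and> bit v (floorlog 2 \<alpha> - 1))) = (v :: nat)"
proof -
  have "floorlog 2 \<alpha> \<le> W \<longleftrightarrow> \<alpha> < 2 ^ W" for \<alpha> by (simp add: floorlog_le_iff)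
  then have "(\<Sum>\<alpha><B. of_bool (\<alpha> \<noteq> 0 \<and> floorlog 2 \<alpha> \<le> W \<and> bit v (floorlog 2 \<alpha> - 1))) =
    (\<Sum>\<alpha><2 ^ W. of_bool (\<alpha> \<noteq> 0 \<and> bit v (floorlog 2 \<alpha> - 1)) :: nat)"
    using assms(2) by (intro sum.mono_neutral_cong_right) auto
  then show ?thesis unfolding sum_bits_below using assms(1) by (simp only: take_bit_nat_eq_self)
qed

lemma block_mod: "b < B \<Longrightarrow> (a * B + b) mod B = (b :: nat)"
  and block_div: "b < B \<Longrightarrow> (a * B + b) div B = (a :: nat)"
  by auto

lemma sum_mult_split: "(\<Sum>k<A * B. g k) = (\<Sum>a<A. \<Sum>b<B. g (a * B + b :: nat))"
  for g :: "nat \<Rightarrow> nat"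
proof (induction A)
  case (Suc A)
  have "(\<Sum>k<Suc A * B. g k) = (\<Sum>k<A * B. g k) + (\<Sum>k\<in>{A * B..<A * B + B}. g k)"
    by (subst sum.union_disjoint[symmetric]) (auto intro!: sum.cong simp: add.commute)
  also have "(\<Sum>k\<in>{A * B..<A * B + B}. g k) = (\<Sum>b<B. g (A * B + b))"
    using sum.shift_bounds_nat_ivl[of g 0 "A * B" B] by (simp add: atLeast0LessThan add.commute)
  finally show ?case using Suc by simp
qed simp

lemma walk_trans:
  assumes "walk E w u v d'" "walk E w x u d"
  shows "walk E w x v (d + d')"
  using assms
proof (induction rule: walk.induct)
  case (walk_step y d' v)
  then show ?case using walk.walk_step[of E w x y "d + d'" v] by (simp add: add.assoc)
qed simp

lemma walk_chain:
  "walk E w x v d \<Longrightarrow> \<exists>m g. g 0 = x \<and> g m = v \<and> (\<forall>i<m. {g i, g (Suc i)} \<in> E) \<and> d = (\<Sum>i<m. w {g i, g (Suc i)})"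
proof (induction rule: walk.induct)
  case walk_refl
  show ?case by (intro exI[of _ 0] exI[of _ "\<lambda>_. x"]) simp
next
  case (walk_step u d v)
  then obtain m g where g: "g 0 = x" "g m = u" "\<forall>i<m. {g i, g (Suc i)} \<in> E" "d = (\<Sum>i<m. w {g i, g (Suc i)})"
    by blast
  have "(\<Sum>i<m. w {(g(Suc m := v)) i, (g(Suc m := v)) (Suc i)}) = d"
    unfolding g(4) by (intro sum.cong) auto
  then show ?case using g(1-3) walk_step.hyps(2)
    by (intro exI[of _ "Suc m"] exI[of _ "g(Suc m := v)"]) (auto simp: less_Suc_eq)
qed

lemma simple_path_vertices:
  assumes "simple_graph V E" "simple_path E u xs v" "u \<in> V"
  shows "set xs \<subseteq> V"
  using assms(2,3)
proof (induction xs arbitrary: u)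
  case (Cons x xs)
  then show ?case using simple_graph_edge(2)[OF assms(1)] by (cases xs) auto
qed simp

lemma path_weight_le:
  assumes "\<And>e. e \<in> E \<Longrightarrow> w e \<le> b"
  shows "simple_path E u xs v \<Longrightarrow> path_weight w xs \<le> length xs * b"
proof (induction xs arbitrary: u)
  case (Cons x xs)
  show ?case
  proof (cases xs)
    case Nil
    then show ?thesis by (simp add: path_weight_def)
  next
    case (Cons y ys)
    then have "w {x, y} \<le> b" "path_weight w xs \<le> length xs * b"
      using Cons.prems Cons.IH[of y] assms by auto
    then show ?thesis by (simp add: Cons path_weight_Cons)
  qed
qed (simp add: path_weight_def)

section \<open>Reading the instance: the lines of arcs and their lengths\<close>

locale sroct_run =
  fixes p :: "real poly" and n :: nat and E :: "nat set set" and w :: "nat set \<Rightarrow> nat" and r :: "nat \<Rightarrow> nat"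
  assumes inst: "sroct_instance p n E w r"
begin

abbreviation f :: nat where "f \<equiv> width_factor p"

sublocale sroct_circuit f n .

abbreviation inp :: "bool list" where "inp \<equiv> encode_instance p n E w r"
abbreviation W' :: nat where "W' \<equiv> width f n"
abbreviation B :: nat where "B \<equiv> val_bd f n"
abbreviation w' :: "nat set \<Rightarrow> nat" where "w' \<equiv> \<lambda>e. scale f n * w e + 1"
abbreviation D :: "nat \<Rightarrow> nat \<Rightarrow> nat" where "D \<equiv> graph_dist E w'"

lemma G: "simple_graph {..<n} E" and conn: "connected_graph {..<n} E"
  using inst by (auto simp: sroct_instance_def)

lemma n_pos: "n > 0"
  using G by (auto simp: simple_graph_def)

lemma W'_eq: "W' = field_width p n"
  by (simp add: width_def field_width_def)

lemma le_poly_less: "real v \<le> poly p (real n) \<Longrightarrow> v < 2 ^ W'"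
  using field_width_sufficient[of n p] n_pos unfolding W'_eq
  by (metis One_nat_def Suc_leI le_less_trans of_nat_less_iff of_nat_numeral of_nat_power)

lemma w_less: "e \<in> E \<Longrightarrow> w e < 2 ^ W'" and r_less: "v < n \<Longrightarrow> r v < 2 ^ W'"
  using inst by (auto simp: sroct_instance_def intro!: le_poly_less)

lemma pow_W'_le: "2 ^ W' \<le> B"
proof -
  have "2 ^ (floorlog 2 n - 1) \<le> n" using floorlog_bounds[of n 2] n_pos by simp
  then have "2 * 2 ^ (floorlog 2 n - 1) \<le> 2 * n" by simp
  moreover have "floorlog 2 n \<noteq> 0" using n_pos by (simp add: floorlog_eq_zero_iff)
  ultimately have "2 ^ floorlog 2 n \<le> 2 * n" by (metis Suc_pred' neq0_conv power_Suc)
  then have "(2 ^ floorlog 2 n) ^ f \<le> (2 * n) ^ f" by (rule power_mono) simp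
  then show ?thesis by (simp add: width_def val_bd_def mult.commute flip: power_mult)
qed

lemma B_pos: "B > 0"
  using pow_W'_le by (meson le_less_trans not_gr_zero not_le zero_less_numeral zero_less_power)

definition wt :: "nat \<Rightarrow> nat \<Rightarrow> nat" where
  "wt u v = (if {u, v} \<in> E then w {u, v} else 0)"

lemma wt_less: "wt u v < 2 ^ W'"
  using w_less by (simp add: wt_def)

lemma length_part: "length (concat (map (\<lambda>(i, j). ({i, j} \<in> E) # bits_of (field_width p n)
    (if {i, j} \<in> E then w {i, j} else 0)) (List.product [0..<n] [0..<n]))) = n * n * (1 + W')"
  by (simp add: length_concat comp_def bits_of_def sum_list_triv split_def W'_eq)

lemma product_upt: "List.product [0..<n] [0..<n] = map (\<lambda>q. (q div n, q mod n)) [0..<n * n]"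
  using n_pos by (intro nth_equalityI) (auto simp: product_nth less_mult_imp_div_less)

lemma inp_edges:
  assumes "q < n * n" "j < 1 + W'"
  shows "inp ! (q * (1 + W') + j) = (({q div n, q mod n} \<in> E) # bits_of W' (wt (q div n) (q mod n))) ! j"
proof -
  have "q * (1 + W') + j < Suc q * (1 + W')" using assms(2) by simp
  also have "\<dots> \<le> n * n * (1 + W')" using assms(1) by (intro mult_right_mono) auto
  finally have "inp ! (q * (1 + W') + j) = concat (map (\<lambda>(i, j). ({i, j} \<in> E) # bits_of (field_width p n)
    (if {i, j} \<in> E then w {i, j} else 0)) (List.product [0..<n] [0..<n])) ! (q * (1 + W') + j)"
    unfolding encode_instance_def using length_part by (subst nth_append) simp
  also have "\<dots> = concat (map (\<lambda>q. ({q div n, q mod n} \<in> E) # bits_of W' (wt (q div n) (q mod n))) [0..<n * n]) ! (q * (1 + W') + j)"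
    by (simp add: product_upt comp_def wt_def W'_eq)
  also have "\<dots> = (({q div n, q mod n} \<in> E) # bits_of W' (wt (q div n) (q mod n))) ! j"
    by (rule nth_concat_blocks) (use assms in \<open>auto simp: bits_of_def\<close>)
  finally show ?thesis .
qed

lemma inp_edge: "q < n * n \<Longrightarrow> inp ! (q * (1 + W')) = ({q div n, q mod n} \<in> E)"
  using inp_edges[of q 0] by simp

lemma inp_weight: "q < n * n \<Longrightarrow> 0 < j \<Longrightarrow> j \<le> W' \<Longrightarrow> inp ! (q * (1 + W') + j) = bit (wt (q div n) (q mod n)) (j - 1)"
  using inp_edges[of q j] by (simp add: bits_of_def nth_Cons')

lemma inp_req:
  assumes "u < n" "j < W'"
  shows "inp ! (n * n * (1 + W') + u * W' + j) = bit (r u) j"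
proof -
  have "inp ! (n * n * (1 + W') + u * W' + j) = concat (map (\<lambda>i. bits_of W' (r i)) [0..<n]) ! (u * W' + j)"
    unfolding encode_instance_def using length_part by (subst nth_append) (simp add: W'_eq)
  also have "\<dots> = bits_of W' (r u) ! j"
    by (rule nth_concat_blocks) (use assms in \<open>auto simp: bits_of_def\<close>)
  finally show ?thesis using assms by (simp add: bits_of_def)
qed

lemma in_len_edges: "q < n * n \<Longrightarrow> j \<le> W' \<Longrightarrow> q * (1 + W') + j < in_len f n"
proof -
  assume *: "q < n * n" "j \<le> W'"
  have "q * (1 + W') + j < Suc q * (1 + W')" using *(2) by simp
  also have "\<dots> \<le> n * n * (1 + W')" using *(1) by (intro mult_right_mono) auto
  finally show ?thesis by (simp add: in_len_def)
qed

lemma in_len_req: "u < n \<Longrightarrow> j < W' \<Longrightarrow> n * n * (1 + W') + u * W' + j < in_len f n"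
proof -
  assume *: "u < n" "j < W'"
  have "u * W' + j < Suc u * W'" using *(2) by simp
  also have "\<dots> \<le> n * W'" using *(1) by (intro mult_right_mono) auto
  finally show ?thesis by (simp add: in_len_def)
qed

lemma L_input: "i < in_len f n \<Longrightarrow> L inp t (pos_lit f n 1 0 0 i) = inp ! i"
  and L_neg_input: "i < in_len f n \<Longrightarrow> L inp t (neg_lit f n 1 0 0 i) = (\<not> inp ! i)"
  using in_len_less_X X_pos M_input[of i inp t] by (simp_all add: L_pos L_neg)

definition arc_ok :: "nat \<Rightarrow> bool" where
  "arc_ok i \<longleftrightarrow> (if i < n * n * B then i mod B = 0 \<longrightarrow> {i div B div n, i div B mod n} \<in> E
     else i - n * n * B < n * line_len f n)"

text \<open>The intended length. For root arcs it mentions the final distances \<open>D\<close>,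
  whereas a layer only sees its current thresholds; soundness and completeness bridge the
  gap.\<close>

definition arc_wt :: "nat \<Rightarrow> nat" where
  "arc_wt i = (let on = (\<lambda>v \<alpha>. of_bool (\<alpha> \<noteq> 0 \<and> floorlog 2 \<alpha> \<le> W' \<and> bit v (floorlog 2 \<alpha> - 1)) :: nat) in
     if i < n * n * B then on (wt (i div B div n) (i div B mod n)) (i mod B)
     else let i' = i - n * n * B; q = i' div B; v = q div 2 mod n; u = q div 2 div n mod n; x = q div 2 div n div n in
       on (r u) (i' mod B) * D x (if q mod 2 = 0 then u else v))"

lemma floorlog_pos: "\<alpha> \<noteq> 0 \<Longrightarrow> 0 < floorlog 2 \<alpha>"
  by (simp add: floorlog_def)

text \<open>These arcs look at input bits only and are therefore exact in every layer.\<close>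

lemma edge_arc:
  assumes "i < n * n * B" "c < X"
  shows "(\<exists>e<X. L inp t (fst (arc_term f n i c e)) \<and> L inp t (snd (arc_term f n i c e))) \<longleftrightarrow> arc_ok i \<and> arc_wt i \<le> c"
proof -
  define \<alpha> q where "\<alpha> = i mod B" and "q = i div B"
  define l1 where "l1 = pos_lit f n 1 0 0 (q * (1 + W'))"
  define l2 where "l2 = neg_lit f n 1 0 0 (q * (1 + W') + floorlog 2 \<alpha>)"
  have q: "q < n * n" unfolding q_def using assms(1) by (rule less_mult_imp_div_less)
  have term_eq: "arc_term f n i c e = (if \<alpha> = 0 then (l1, 0)
     else if c = 0 \<and> floorlog 2 \<alpha> \<le> W' then (l2, 0) else (0, 0))" for e
    using assms(1) unfolding arc_term_def Let_def \<alpha>_def q_def l1_def l2_def by simp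
  have 1: "L inp t l1 = ({q div n, q mod n} \<in> E)"
    using in_len_edges[OF q, of 0] unfolding l1_def by (subst L_input) (simp_all only: inp_edge[OF q] le0 add_0_right)
  have 2: "L inp t l2 = (\<not> bit (wt (q div n) (q mod n)) (floorlog 2 \<alpha> - 1))" if "\<alpha> \<noteq> 0" "floorlog 2 \<alpha> \<le> W'"
    unfolding l2_def using L_neg_input[OF in_len_edges[OF q that(2)]] inp_weight[OF q floorlog_pos[OF that(1)] that(2)] by simp
  have ok: "arc_ok i \<longleftrightarrow> (\<alpha> = 0 \<longrightarrow> {q div n, q mod n} \<in> E)"
    "arc_wt i = of_bool (\<alpha> \<noteq> 0 \<and> floorlog 2 \<alpha> \<le> W' \<and> bit (wt (q div n) (q mod n)) (floorlog 2 \<alpha> - 1))"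
    using assms(1) by (simp_all add: arc_ok_def arc_wt_def Let_def \<alpha>_def q_def)
  show ?thesis
  proof (cases "\<alpha> = 0")
    case True
    then show ?thesis using ex_X by (simp add: term_eq 1 ok)
  next
    case False
    then show ?thesis using ex_X 2[OF False] by (auto simp: term_eq ok)
  qed
qed

lemma root_arc_indices:
  assumes "i < n * line_len f n"
  shows "i div B div 2 mod n < n" "i div B div 2 div n mod n < n" "i div B div 2 div n div n < n"
proof -
  have "i < n * n * n * 2 * B" using assms by (simp add: line_len_def algebra_simps)
  then have "i div B < n * n * n * 2" by (rule less_mult_imp_div_less)
  then have "i div B div 2 < n * n * n" by (rule less_mult_imp_div_less)
  then have "i div B div 2 div n < n * n" by (rule less_mult_imp_div_less)
  then show "i div B div 2 div n div n < n" by (rule less_mult_imp_div_less)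
qed (use n_pos in auto)

lemma root_arc:
  assumes "\<not> i < n * n * B" "c < X"
  shows "(\<exists>e<X. L inp t (fst (arc_term f n i c e)) \<and> L inp t (snd (arc_term f n i c e))) \<longleftrightarrow>
    (let i' = i - n * n * B; \<alpha> = i' mod B; q = i' div B; v = q div 2 mod n; u = q div 2 div n mod n; x = q div 2 div n div n in
     i' < n * line_len f n \<and> (\<alpha> = 0 \<or> W' < floorlog 2 \<alpha> \<or> \<not> bit (r u) (floorlog 2 \<alpha> - 1) \<or>
       R inp t x (if q mod 2 = 0 then u else v) c))"
proof -
  define i' where "i' = i - n * n * B"
  define \<alpha> where "\<alpha> = i' mod B"
  define q where "q = i' div B"
  define u where "u = q div 2 div n mod n"
  define v where "v = q div 2 mod n"
  define x where "x = q div 2 div n div n"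
  define l1 where "l1 = neg_lit f n 1 0 0 (n * n * (1 + W') + u * W' + (floorlog 2 \<alpha> - 1))"
  define l2 where "l2 = pos_lit f n 2 x (if q mod 2 = 0 then u else v) c"
  have term_eq: "arc_term f n i c e = (if \<not> i' < n * line_len f n then (1, 1)
     else if \<alpha> = 0 \<or> W' < floorlog 2 \<alpha> then (0, 0)
     else if e = 0 then (l1, 0) else (l2, 0))" for e
    using assms(1) unfolding arc_term_def root_arc_term_def Let_def l1_def l2_def i'_def \<alpha>_def q_def u_def v_def x_def by simp
  have "(\<exists>e<X. L inp t (fst (arc_term f n i c e)) \<and> L inp t (snd (arc_term f n i c e))) \<longleftrightarrow>
     i' < n * line_len f n \<and> (\<alpha> = 0 \<or> W' < floorlog 2 \<alpha> \<or> \<not> bit (r u) (floorlog 2 \<alpha> - 1) \<or>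
       R inp t x (if q mod 2 = 0 then u else v) c)" (is "?A \<longleftrightarrow> ?B")
  proof (cases "i' < n * line_len f n \<and> \<alpha> \<noteq> 0 \<and> floorlog 2 \<alpha> \<le> W'")
    case False
    then consider "\<not> i' < n * line_len f n" | "i' < n * line_len f n" "\<alpha> = 0 \<or> W' < floorlog 2 \<alpha>"
      by linarith
    then show ?thesis
    proof cases
      case 1
      then show ?thesis by (simp add: term_eq)
    next
      case 2
      then have "arc_term f n i c e = (0, 0)" for e unfolding term_eq by simp
      then show ?thesis using 2 ex_X by auto
    qed
  next
    case True
    then have uvx: "u < n" "v < n" "x < n" unfolding u_def v_def x_def q_def using root_arc_indices by auto
    have fl: "floorlog 2 \<alpha> - 1 < W'"
      using True floorlog_pos[of \<alpha>] by linarith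
    have 1: "L inp t l1 = (\<not> bit (r u) (floorlog 2 \<alpha> - 1))"
      unfolding l1_def L_neg_input[OF in_len_req[OF uvx(1) fl]] inp_req[OF uvx(1) fl] ..
    have 2: "L inp t l2 = R inp t x (if q mod 2 = 0 then u else v) c"
      unfolding l2_def using uvx n_less_X assms(2) by (intro L_pos) auto
    have "1 < X" by (simp add: size_bd_def)
    then have "?A \<longleftrightarrow> \<not> bit (r u) (floorlog 2 \<alpha> - 1) \<or> R inp t x (if q mod 2 = 0 then u else v) c"
    proof -
      have t: "arc_term f n i c e = (if e = 0 then (l1, 0) else (l2, 0))" for e
        using True unfolding term_eq by simp
      show ?thesis
      proof
        assume ?A
        then show "\<not> bit (r u) (floorlog 2 \<alpha> - 1) \<or> R inp t x (if q mod 2 = 0 then u else v) c"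
          unfolding t 1[symmetric] 2[symmetric] by (auto split: if_splits)
      next
        assume "\<not> bit (r u) (floorlog 2 \<alpha> - 1) \<or> R inp t x (if q mod 2 = 0 then u else v) c"
        then consider "L inp t l1" | "L inp t l2" unfolding 1 2 by blast
        then show ?A
          unfolding t using X_pos \<open>1 < X\<close> by cases (auto intro: exI[of _ 0] exI[of _ 1])
      qed
    qed
    then show ?thesis using True by auto
  qed
  then show ?thesis unfolding Let_def i'_def \<alpha>_def q_def u_def v_def x_def .
qed

lemma sum_edge_line:
  assumes "u < n" "v < n"
  shows "(\<Sum>i=edge_line f n u v..<edge_line f n u v + B. arc_wt (i - n)) = wt u v"
proof -
  have q: "u * n + v < n * n"
  proof -
    have "u * n + v < Suc u * n" using assms by simp
    also have "\<dots> \<le> n * n" using assms by (intro mult_right_mono) auto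
    finally show ?thesis .
  qed
  have "(\<Sum>i=edge_line f n u v..<edge_line f n u v + B. arc_wt (i - n)) = (\<Sum>\<alpha><B. arc_wt ((u * n + v) * B + \<alpha>))"
    using sum.shift_bounds_nat_ivl[of "\<lambda>i. arc_wt (i - n)" 0 "edge_line f n u v" B]
    by (simp add: edge_line_def atLeast0LessThan add.commute)
  also have "\<dots> = (\<Sum>\<alpha><B. of_bool (\<alpha> \<noteq> 0 \<and> floorlog 2 \<alpha> \<le> W' \<and> bit (wt u v) (floorlog 2 \<alpha> - 1)))"
  proof (intro sum.cong refl)
    fix \<alpha> assume "\<alpha> \<in> {..<B}"
    then have a: "\<alpha> < B" by simp
    have "(u * n + v) * B + \<alpha> < Suc (u * n + v) * B" using a by simp
    also have "\<dots> \<le> n * n * B" using q by (intro mult_right_mono) auto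
    finally show "arc_wt ((u * n + v) * B + \<alpha>) = of_bool (\<alpha> \<noteq> 0 \<and> floorlog 2 \<alpha> \<le> W' \<and> bit (wt u v) (floorlog 2 \<alpha> - 1))"
      using a assms by (simp add: arc_wt_def Let_def)
  qed
  also have "\<dots> = wt u v" by (rule sum_bits[OF wt_less pow_W'_le])
  finally show ?thesis .
qed

text \<open>Undoing the mixed-radix numbering gives sums over \<open>u\<close>, \<open>v\<close>,
  \<open>s\<close> and \<open>\<alpha>\<close>; the innermost one reassembles \<open>r u\<close>
  from its bits.\<close>

lemma sum_root_line:
  assumes "x < n"
  shows "(\<Sum>i=root_line f n x..<root_line f n (Suc x). arc_wt (i - n)) = root_cost {..<n} E w' r x"
proof -
  have e: "root_line f n (Suc x) = root_line f n x + n * n * 2 * B" by (simp add: root_line_def line_len_def)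
  have "(\<Sum>i=root_line f n x..<root_line f n (Suc x). arc_wt (i - n)) =
    (\<Sum>k<n * n * 2 * B. arc_wt (n * n * B + (x * line_len f n + k)))"
    unfolding e using sum.shift_bounds_nat_ivl[of "\<lambda>i. arc_wt (i - n)" 0 "root_line f n x" "n * n * 2 * B"]
    by (simp add: root_line_def atLeast0LessThan ac_simps)
  also have "\<dots> = (\<Sum>u<n. \<Sum>v<n. \<Sum>s<(2::nat). \<Sum>\<alpha><B. arc_wt (n * n * B + (x * line_len f n + (((u * n + v) * 2 + s) * B + \<alpha>))))"
    by (simp only: sum_mult_split)
  also have "\<dots> = (\<Sum>u<n. \<Sum>v<n. \<Sum>s<(2::nat). \<Sum>\<alpha><B. of_bool (\<alpha> \<noteq> 0 \<and> floorlog 2 \<alpha> \<le> W' \<and> bit (r u) (floorlog 2 \<alpha> - 1))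
     * D x (if s = 0 then u else v))"
  proof (intro sum.cong refl)
    fix u v s \<alpha> assume "u \<in> {..<n}" "v \<in> {..<n}" "s \<in> {..<2 :: nat}" "\<alpha> \<in> {..<B}"
    then have a: "u < n" "v < n" "s < 2" "\<alpha> < B" by auto
    have eq: "x * line_len f n + (((u * n + v) * 2 + s) * B + \<alpha>) = ((((x * n + u) * n + v) * 2 + s) * B + \<alpha>)"
      by (simp add: line_len_def algebra_simps)
    have "((((x * n + u) * n + v) * 2 + s) * B + \<alpha>) mod B = \<alpha>"
      "((((x * n + u) * n + v) * 2 + s) * B + \<alpha>) div B = ((x * n + u) * n + v) * 2 + s" using a(4) by (simp_all only: block_mod block_div)
    moreover have "(((x * n + u) * n + v) * 2 + s) mod 2 = s" "(((x * n + u) * n + v) * 2 + s) div 2 = (x * n + u) * n + v"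
      using a(3) by (simp_all only: block_mod block_div)
    moreover have "((x * n + u) * n + v) mod n = v" "((x * n + u) * n + v) div n = x * n + u"
      "(x * n + u) mod n = u" "(x * n + u) div n = x" using a(1,2) by (simp_all only: block_mod block_div)
    ultimately show "arc_wt (n * n * B + (x * line_len f n + (((u * n + v) * 2 + s) * B + \<alpha>))) =
      of_bool (\<alpha> \<noteq> 0 \<and> floorlog 2 \<alpha> \<le> W' \<and> bit (r u) (floorlog 2 \<alpha> - 1)) * D x (if s = 0 then u else v)"
      unfolding eq by (simp only: arc_wt_def Let_def add_diff_cancel_left' if_False not_add_less1)
  qed
  also have "\<dots> = (\<Sum>u<n. \<Sum>v<n. \<Sum>s<(2::nat). r u * D x (if s = 0 then u else v))"
  proof (intro sum.cong refl)
    fix u v s assume "u \<in> {..<n}"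
    then have "u < n" by simp
    then show "(\<Sum>\<alpha><B. of_bool (\<alpha> \<noteq> 0 \<and> floorlog 2 \<alpha> \<le> W' \<and> bit (r u) (floorlog 2 \<alpha> - 1)) * D x (if s = 0 then u else v))
      = r u * D x (if s = 0 then u else v)"
      by (simp only: sum_distrib_right[symmetric] sum_bits[OF r_less pow_W'_le])
  qed
  also have "\<dots> = root_cost {..<n} E w' r x"
    by (simp add: root_cost_def numeral_2_eq_2 distrib_left)
  finally show ?thesis .
qed

end

section \<open>Soundness of the thresholds\<close>

lemma of_bool_mult_le: "of_bool P * a \<le> (a :: nat)"
  by (cases P) auto

context sroct_run
begin

text \<open>What a set threshold may claim. Line nodes are numbered consecutively, so a stretch of
  arcs is an interval; it may run across several lines.\<close>

definition correct :: "nat \<Rightarrow> nat \<Rightarrow> nat \<Rightarrow> bool" where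
  "correct a b d \<longleftrightarrow> a = b \<or> (a < n \<and> b < n \<and> (\<exists>d'\<le>d. walk E w' a b d')) \<or>
     (n \<le> a \<and> a < b \<and> (\<forall>i\<in>{a..<b}. arc_ok (i - n)) \<and> (\<Sum>i=a..<b. arc_wt (i - n)) \<le> d)"

text \<open>No claim links a graph vertex to a line node, so both parts are always of the same
  kind.\<close>

lemma correct_trans:
  assumes "correct a z e" "correct z b e'"
  shows "correct a b (e + e')"
proof -
  consider "a = z" | "z = b" | "a \<noteq> z" "z \<noteq> b" "a < n" | "a \<noteq> z" "z \<noteq> b" "n \<le> a" by linarith
  then show ?thesis
  proof cases
    case 1
    then show ?thesis using assms(2) unfolding correct_def by (meson le_add2 le_trans)
  next
    case 2
    then show ?thesis using assms(1) unfolding correct_def by (meson le_add1 le_trans)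
  next
    case 3
    then have "z < n" "\<exists>d'\<le>e. walk E w' a z d'" using assms(1) unfolding correct_def by auto
    moreover from this have "b < n" "\<exists>d'\<le>e'. walk E w' z b d'" using 3 assms(2) unfolding correct_def by auto
    ultimately obtain d1 d2 where "d1 \<le> e" "walk E w' a z d1" "d2 \<le> e'" "walk E w' z b d2" by blast
    then have "d1 + d2 \<le> e + e'" "walk E w' a b (d1 + d2)" by (auto intro: walk_trans)
    then show ?thesis using 3 \<open>b < n\<close> unfolding correct_def by blast
  next
    case 4
    then have 1: "a < z" "\<forall>i\<in>{a..<z}. arc_ok (i - n)" "(\<Sum>i=a..<z. arc_wt (i - n)) \<le> e"
      using assms(1) unfolding correct_def by auto
    have 2: "z < b" "\<forall>i\<in>{z..<b}. arc_ok (i - n)" "(\<Sum>i=z..<b. arc_wt (i - n)) \<le> e'"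
      using assms(2) 4 1(1) unfolding correct_def by auto
    have "(\<Sum>i=a..<b. arc_wt (i - n)) = (\<Sum>i=a..<z. arc_wt (i - n)) + (\<Sum>i=z..<b. arc_wt (i - n))"
      using 1(1) 2(1) by (simp add: sum.atLeastLessThan_concat)
    moreover have "\<forall>i\<in>{a..<b}. arc_ok (i - n)" using 1(2) 2(2) by (meson atLeastLessThan_iff not_le)
    ultimately show ?thesis using 1 2 4(3) unfolding correct_def by auto
  qed
qed

lemma pair_less: "u < n \<Longrightarrow> v < n \<Longrightarrow> u * n + v < n * n"
proof -
  assume *: "u < n" "v < n"
  have "u * n + v < Suc u * n" using * by simp
  also have "\<dots> \<le> n * n" using * by (intro mult_right_mono) auto
  finally show ?thesis .
qed

lemma edge_line_le: "u < n \<Longrightarrow> v < n \<Longrightarrow> edge_line f n u v + B \<le> n + n * n * B"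
proof -
  assume "u < n" "v < n"
  then have "Suc (u * n + v) * B \<le> n * n * B" using pair_less by (intro mult_right_mono Suc_leI) auto
  then show ?thesis by (simp add: edge_line_def)
qed

lemma edge_line_less: "u < n \<Longrightarrow> v < n \<Longrightarrow> edge_line f n u v + B < X"
  using edge_line_le[of u v] by (simp add: size_bd_def)

lemma root_line_le: "x \<le> n \<Longrightarrow> root_line f n x \<le> n + n * n * B + n * line_len f n"
  by (simp add: root_line_def)

lemma root_line_less: "x \<le> n \<Longrightarrow> root_line f n x < X"
  using root_line_le[of x] by (simp add: size_bd_def)

text \<open>As \<open>B > 0\<close>, the line contains its arc \<open>\<alpha> = 0\<close>, which
  exists only together with the edge.\<close>

lemma edge_line_correct:
  assumes "u < n" "v < n" "correct (edge_line f n u v) (edge_line f n u v + B) d"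
  shows "{u, v} \<in> E \<and> w {u, v} \<le> d"
proof -
  let ?a = "edge_line f n u v"
  have a: "n \<le> ?a" "B > 0" using B_pos by (auto simp: edge_line_def)
  then have c: "\<forall>i\<in>{?a..<?a + B}. arc_ok (i - n)" "(\<Sum>i=?a..<?a + B. arc_wt (i - n)) \<le> d"
    using assms(3) unfolding correct_def by auto
  have "arc_ok (?a - n)" using c(1) a by simp
  moreover have "?a - n = (u * n + v) * B" by (simp add: edge_line_def)
  moreover have "(u * n + v) * B < n * n * B" using pair_less[OF assms(1,2)] a(2) by simp
  ultimately have "{u, v} \<in> E" using assms(1,2) a(2) by (simp add: arc_ok_def)
  then show ?thesis using c(2) sum_edge_line[OF assms(1,2)] by (simp add: wt_def)
qed

lemma R_sound: "a < X \<Longrightarrow> b < X \<Longrightarrow> d < X \<Longrightarrow> R inp t a b d \<Longrightarrow> correct a b d"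
proof (induction t arbitrary: a b d)
  case 0
  then show ?case using M_init[of 2] by simp
next
  case (Suc t)
  from Suc.prems(4) consider (comp) z e where "z < X" "e \<le> d" "R inp t a z e" "R inp t z b (d - e)"
    | (base) "\<exists>e<X. L inp t (fst (base_term f n a b d e)) \<and> L inp t (snd (base_term f n a b d e))"
    unfolding R_Suc[OF Suc.prems(1-3)] by blast
  then show ?case
  proof cases
    case comp
    then have "correct a z e" "correct z b (d - e)" using Suc by auto
    then show ?thesis using correct_trans comp(2) by fastforce
  next
    case base
    consider (eq) "a = b" | (edge) "a \<noteq> b" "a < n" "b < n" | (arc) "a \<noteq> b" "n \<le> a" "b = a + 1"
      | (no) "a \<noteq> b" "\<not> (a < n \<and> b < n)" "\<not> (n \<le> a \<and> b = a + 1)" by linarith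
    then show ?thesis
    proof cases
      case eq
      then show ?thesis by (simp add: correct_def)
    next
      case edge
      have d: "d \<noteq> 0"
      proof
        assume "d = 0"
        then have "base_term f n a b d e = (1, 1)" for e using edge by (simp add: base_term_def)
        then show False using base by simp
      qed
      have el: "edge_line f n a b < X" "edge_line f n a b + B < X" "(d - 1) div scale f n < X"
        using edge_line_less[OF edge(2,3)] Suc.prems(3) by (auto intro: le_less_trans[OF div_le_dividend])
      have "R inp t (edge_line f n a b) (edge_line f n a b + B) ((d - 1) div scale f n)"
        using base edge d el by (auto simp: base_term_def L_pos)
      then have "correct (edge_line f n a b) (edge_line f n a b + B) ((d - 1) div scale f n)"
        using Suc.IH el by blast
      from edge_line_correct[OF edge(2,3) this] have e: "{a, b} \<in> E" "w {a, b} \<le> (d - 1) div scale f n" by auto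
      have "scale f n * w {a, b} \<le> d - 1" using e(2) by (simp add: less_eq_div_iff_mult_less_eq scale_def mult.commute)
      then have "w' {a, b} \<le> d" using d by simp
      moreover have "walk E w' a b (w' {a, b})" using walk_step[OF walk_refl e(1), of w'] by simp
      ultimately show ?thesis using edge unfolding correct_def by blast
    next
      case arc
      have bt: "base_term f n a b d e = arc_term f n (a - n) d e" for e using arc by (simp add: base_term_def)
      have "arc_ok (a - n) \<and> arc_wt (a - n) \<le> d"
      proof (cases "a - n < n * n * B")
        case True
        then show ?thesis using base edge_arc[OF True Suc.prems(3)] unfolding bt by blast
      next
        case False
        define i' where "i' = a - n - n * n * B"
        define q where "q = i' div B"
        define u where "u = q div 2 div n mod n"
        define v where "v = q div 2 mod n"
        define x where "x = q div 2 div n div n"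
        have i': "i' < n * line_len f n" and h: "i' mod B = 0 \<or> W' < floorlog 2 (i' mod B) \<or>
            \<not> bit (r u) (floorlog 2 (i' mod B) - 1) \<or> R inp t x (if q mod 2 = 0 then u else v) d"
          using base root_arc[OF False Suc.prems(3), of t] unfolding bt Let_def i'_def q_def u_def v_def x_def by auto
        have uvx: "u < n" "v < n" "x < n" unfolding u_def v_def x_def q_def using root_arc_indices[OF i'] by auto
        \<comment> \<open>A threshold set in an earlier layer is a true upper bound for the
          distance. Hence a root arc is never shorter than intended, even while the distances are
          still incomplete.\<close>
        have DL: "D x y \<le> d" if "R inp t x y d" "y < n" for y
        proof -
          have "correct x y d" using Suc.IH[OF _ _ Suc.prems(3) that(1)] uvx that(2) n_less_X by auto
          then show ?thesis using uvx graph_dist_le[of E w' x y]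
            by (auto simp: correct_def graph_dist_refl intro: le_trans)
        qed
        have "(if q mod 2 = 0 then u else v) < n" using uvx by simp
        with h DL[of "if q mod 2 = 0 then u else v"] have "i' mod B = 0 \<or> W' < floorlog 2 (i' mod B) \<or> \<not> bit (r u) (floorlog 2 (i' mod B) - 1) \<or>
          D x (if q mod 2 = 0 then u else v) \<le> d" by blast
        moreover have "arc_wt (a - n) = of_bool (i' mod B \<noteq> 0 \<and> floorlog 2 (i' mod B) \<le> W' \<and>
          bit (r u) (floorlog 2 (i' mod B) - 1)) * D x (if q mod 2 = 0 then u else v)"
          using False unfolding arc_wt_def Let_def i'_def q_def u_def v_def x_def by simp
        moreover have "arc_ok (a - n)" using False i' by (simp add: arc_ok_def i'_def)
        ultimately show ?thesis by (auto simp: not_le of_bool_def simp del: of_bool_eq)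
      qed
      then show ?thesis using arc by (auto simp: correct_def)
    next
      case no
      then show ?thesis using base by (auto simp: base_term_def)
    qed
  qed
qed

section \<open>Completeness of the thresholds by path doubling\<close>

lemma R_refl: "a < X \<Longrightarrow> d < X \<Longrightarrow> t \<ge> 1 \<Longrightarrow> R inp t a a d"
  using R_Suc[of a a d inp "t - 1"] ex_X by (auto simp: base_term_def)

lemma R_compose:
  assumes "R inp t a z e" "R inp t z b e'" "a < X" "z < X" "b < X" "e + e' < X"
  shows "R inp (Suc t) a b (e + e')"
  unfolding R_Suc[OF assms(3,5,6)] using assms by (intro disjI1 exI[of _ z] conjI exI[of _ e]) auto

text \<open>Slack in the budget is spent on the trivial path at \<open>b\<close>, at the price of
  one layer.\<close>

lemma R_mono:
  assumes "R inp t a b d" "d \<le> d'" "t \<ge> 1" "a < X" "b < X" "d' < X"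
  shows "R inp (Suc t) a b d'"
  using R_compose[OF assms(1) R_refl[of b "d' - d" t]] assms by simp

text \<open>Each layer doubles the number of arcs that are bridged. Layers overwrite each other, so
  the arcs are assumed in all layers from \<open>ts\<close> on, and the conclusion covers all later
  layers as well.\<close>

lemma R_chain:
  assumes step: "\<And>t i. t \<ge> ts \<Longrightarrow> i < m \<Longrightarrow> R inp t (g i) (g (Suc i)) (c i)"
    and g: "\<And>i. i \<le> m \<Longrightarrow> g i < X" and ts: "ts \<ge> 1"
  shows "a \<le> b \<Longrightarrow> b \<le> m \<Longrightarrow> b - a \<le> 2 ^ k \<Longrightarrow> t \<ge> ts + k \<Longrightarrow> (\<Sum>i=a..<b. c i) < X \<Longrightarrow>
    R inp t (g a) (g b) (\<Sum>i=a..<b. c i)"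
proof (induction k arbitrary: a b t)
  case 0
  consider "a = b" | "b = Suc a" using 0 by force
  then show ?case
  proof cases
    case 1
    then show ?thesis using 0 ts g R_refl X_pos by simp
  next
    case 2
    then show ?thesis using step[of t a] 0 by simp
  qed
next
  case (Suc k)
  show ?case
  proof (cases "b - a \<le> 2 ^ k")
    case True
    then show ?thesis using Suc by simp
  next
    case False
    define z where "z = a + 2 ^ k"
    have z: "a \<le> z" "z \<le> b" "b - z \<le> 2 ^ k" using False Suc.prems by (auto simp: z_def)
    have s: "(\<Sum>i=a..<b. c i) = (\<Sum>i=a..<z. c i) + (\<Sum>i=z..<b. c i)"
      using z by (simp add: sum.atLeastLessThan_concat)
    obtain t' where t': "t = Suc t'" "t' \<ge> ts + k" using Suc.prems by (cases t) auto
    show ?thesis unfolding s t'(1)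
    proof (rule R_compose)
      show "R inp t' (g a) (g z) (\<Sum>i=a..<z. c i)"
        using Suc.IH[of a z t'] z Suc.prems t' s by (simp add: z_def)
      show "R inp t' (g z) (g b) (\<Sum>i=z..<b. c i)"
        using Suc.IH[of z b t'] z Suc.prems t' s by simp
    qed (use g z Suc.prems s in auto)
  qed
qed

definition K :: nat where "K = floorlog 2 X"

lemma less_pow_K: "m \<le> X \<Longrightarrow> m \<le> 2 ^ K"
  using less_two_power_floorlog[of X] by (simp add: K_def)

text \<open>\<open>K\<close> layers of doubling from \<open>ts\<close> on, and one to relax the
  exact length to \<open>d\<close>.\<close>

lemma R_line:
  assumes arcs: "\<And>t i. t \<ge> ts \<Longrightarrow> i < m \<Longrightarrow> R inp t (a + i) (Suc (a + i)) (arc_wt (a + i - n))"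
    and "ts \<ge> 1" "a + m < X" "(\<Sum>i=a..<a + m. arc_wt (i - n)) \<le> d" "d < X" "t \<ge> ts + K + 1"
  shows "R inp t a (a + m) d"
proof -
  obtain t' where t': "t = Suc t'" "t' \<ge> ts + K" using assms(6) by (cases t) auto
  have s: "(\<Sum>i=a..<a + m. arc_wt (i - n)) = (\<Sum>i=0..<m. arc_wt (a + i - n))"
    using sum.shift_bounds_nat_ivl[of "\<lambda>i. arc_wt (i - n)" 0 a m] by (simp add: add.commute)
  have "R inp t' (a + 0) (a + m) (\<Sum>i=0..<m. arc_wt (a + i - n))"
  proof (rule R_chain[where ts = ts and m = m and g = "\<lambda>i. a + i" and k = K])
    show "m - 0 \<le> 2 ^ K" using assms(3) by (intro less_pow_K) simp
  qed (use assms t' s in auto)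
  then show ?thesis unfolding t'(1) using assms t' s by (intro R_mono) auto
qed

lemma R_edge_line:
  assumes "{u, v} \<in> E" "u < n" "v < n" "t \<ge> K + 2" "w {u, v} \<le> d" "d < X"
  shows "R inp t (edge_line f n u v) (edge_line f n u v + B) d"
proof (rule R_line[where ts = 1])
  fix t i :: nat assume t: "1 \<le> t" and i: "i < B"
  obtain t' where t': "t = Suc t'" using t by (cases t) auto
  let ?a = "edge_line f n u v + i"
  have less: "?a - n < n * n * B" "n \<le> ?a"
    using edge_line_le[OF assms(2,3)] i by (auto simp: edge_line_def)
  have a: "?a < X" "Suc ?a < X" using edge_line_less[OF assms(2,3)] i by auto
  have e: "?a - n = (u * n + v) * B + i" by (simp add: edge_line_def)
  have ok: "arc_ok (?a - n)" using less assms(1-3) i by (simp add: arc_ok_def e)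
  have "arc_wt (?a - n) \<le> 1" using less by (simp add: arc_wt_def Let_def)
  moreover have "1 < X" by (simp add: size_bd_def)
  ultimately have c: "arc_wt (?a - n) < X" by simp
  have "base_term f n ?a (Suc ?a) c' e = arc_term f n (?a - n) c' e" for c' e
    using less by (simp add: base_term_def)
  then show "R inp t ?a (Suc ?a) (arc_wt (?a - n))"
    unfolding t' R_Suc[OF a c] using edge_arc[OF less(1) c, of t'] ok by simp
next
  show "(\<Sum>i=edge_line f n u v..<edge_line f n u v + B. arc_wt (i - n)) \<le> d"
    using sum_edge_line[OF assms(2,3)] assms(1,5) by (simp add: wt_def)
qed (use assms edge_line_less[OF assms(2,3)] in auto)

lemma weight_bound: "e \<in> E \<Longrightarrow> w' e \<le> scale f n * B + 1"
  using w_less[of e] pow_W'_le by (simp add: mult_le_mono less_imp_le le_trans[of _ "2 ^ W'"])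

lemma D_le:
  assumes "u < n" "v < n"
  shows "walk E w' u v (D u v)" "D u v \<le> dist_bd f n"
proof -
  obtain xs where xs: "simple_path E u xs v" using conn assms by (auto simp: connected_graph_def)
  have "set xs \<subseteq> {..<n}" using simple_path_vertices[OF G xs] assms by simp
  then have "card (set xs) \<le> n" using card_mono[of "{..<n}" "set xs"] by simp
  moreover have "distinct xs" using xs by (simp add: simple_path_def)
  ultimately have "length xs \<le> n" by (simp add: distinct_card)
  then have "path_weight w' xs \<le> dist_bd f n"
    using path_weight_le[OF weight_bound xs] unfolding dist_bd_def by (meson le_trans mult_le_mono1)
  then show "walk E w' u v (D u v)" "D u v \<le> dist_bd f n"
    using walk_graph_dist[OF walk_of_path[OF xs]] graph_dist_le[OF walk_of_path[OF xs], of w'] by auto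
qed

lemma D_less_X: "u < n \<Longrightarrow> v < n \<Longrightarrow> D u v < X"
  using D_le(2)[of u v] by (simp add: size_bd_def)

lemma edge_weight_less: "e \<in> E \<Longrightarrow> w' e < X"
proof -
  assume "e \<in> E"
  then have "w' e \<le> 1 * (scale f n * B + 1)" using weight_bound by simp
  also have "\<dots> \<le> dist_bd f n" unfolding dist_bd_def using n_pos by (intro mult_right_mono) auto
  finally show ?thesis by (simp add: size_bd_def)
qed

lemma R_edge:
  assumes "{u, v} \<in> E" "t \<ge> K + 3"
  shows "R inp t u v (w' {u, v})"
proof -
  obtain t' where t': "t = Suc t'" "t' \<ge> K + 2" using assms by (cases t) auto
  have uv: "u < n" "v < n" "u \<noteq> v" using simple_graph_edge[OF G assms(1)] by auto
  have d: "w' {u, v} < X" using edge_weight_less assms(1) by blast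
  then have w: "w {u, v} < X" by (simp add: scale_def)
  have "scale f n > 0" by (simp add: scale_def)
  then have e: "(w' {u, v} - 1) div scale f n = w {u, v}" by simp
  have "R inp t' (edge_line f n u v) (edge_line f n u v + B) (w {u, v})"
    using R_edge_line[OF assms(1) uv(1,2) t'(2) order_refl w] .
  moreover have "base_term f n u v (w' {u, v}) x =
      (pos_lit f n 2 (edge_line f n u v) (edge_line f n u v + B) (w {u, v}), 0)" for x
    using uv e by (simp add: base_term_def)
  ultimately show ?thesis unfolding t'(1)
    using R_Suc[of u v "w' {u, v}" inp t'] uv n_less_X d w edge_line_less[OF uv(1,2)] ex_X by (simp add: L_pos)
qed

text \<open>Edges are available from layer \<open>K + 3\<close> on; doubling takes \<open>K\<close>
  layers and relaxing the budget one.\<close>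

lemma R_dist:
  assumes "x < n" "v < n" "d < X" "t \<ge> 2 * K + 4"
  shows "R inp t x v d \<longleftrightarrow> D x v \<le> d"
proof
  assume "R inp t x v d"
  then have "correct x v d" using R_sound assms n_less_X by auto
  then show "D x v \<le> d"
    using assms graph_dist_le[of E w' x v] by (auto simp: correct_def graph_dist_refl intro: le_trans)
next
  assume le: "D x v \<le> d"
  obtain m g where g: "g 0 = x" "g m = v" "\<forall>i<m. {g i, g (Suc i)} \<in> E" "D x v = (\<Sum>i<m. w' {g i, g (Suc i)})"
    using walk_chain[OF D_le(1)[OF assms(1,2)]] by blast
  \<comment> \<open>Scaled weights are at least 1, so a cheapest walk has at most
    \<open>D x v < X\<close> arcs, few enough for \<open>K\<close> doublings.\<close>
  have "(\<Sum>i<m. 1) \<le> (\<Sum>i<m. w' {g i, g (Suc i)})" by (rule sum_mono) simp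
  then have m: "m \<le> X" using g(4) D_less_X[OF assms(1,2)] by simp
  obtain t' where t': "t = Suc t'" "t' \<ge> (K + 3) + K" using assms by (cases t) auto
  have gX: "g i < X" if "i \<le> m" for i
  proof (cases "i = m")
    case True
    then show ?thesis using g(2) assms n_less_X by simp
  next
    case False
    then have "i < m" using that by simp
    then have "g i \<in> {..<n}" using g(3) simple_graph_edge(1)[OF G, of "g i" "g (Suc i)"] by blast
    then have "g i < n" by simp
    then show ?thesis using n_less_X by simp
  qed
  have "R inp t' (g 0) (g m) (\<Sum>i=0..<m. w' {g i, g (Suc i)})"
  proof (rule R_chain[where ts = "K + 3" and m = m and k = K])
    show "m - 0 \<le> 2 ^ K" using m by (intro less_pow_K) simp
    show "(\<Sum>i=0..<m. w' {g i, g (Suc i)}) < X" using g(4) D_less_X[OF assms(1,2)] by (simp add: atLeast0LessThan)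
  qed (use g(3) R_edge gX t' in auto)
  then have "R inp t' x v (D x v)" using g by (simp add: atLeast0LessThan)
  then show "R inp t x v d" unfolding t'(1) using le assms t' n_less_X by (intro R_mono) auto
qed

abbreviation F :: "nat \<Rightarrow> nat" where "F \<equiv> root_cost {..<n} E w' r"

lemma F_less_X: "x < n \<Longrightarrow> F x < X"
proof -
  assume x: "x < n"
  have "F x \<le> (\<Sum>u<n. \<Sum>v<n. B * (dist_bd f n + dist_bd f n))"
    unfolding root_cost_def using D_le(2)[OF x] r_less pow_W'_le
    by (intro sum_mono mult_mono add_mono) (auto intro: less_imp_le less_le_trans)
  also have "\<dots> = line_len f n * dist_bd f n" by (simp add: line_len_def)
  finally show ?thesis by (simp add: size_bd_def)
qed

lemma R_root:
  assumes x: "x < n" and d: "d < X" and t: "t \<ge> 3 * K + 6"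
  shows "R inp t (root_line f n x) (root_line f n (Suc x)) d \<longleftrightarrow> F x \<le> d"
proof -
  let ?a = "root_line f n x"
  have len: "root_line f n (Suc x) = ?a + line_len f n" by (simp add: root_line_def)
  have lt: "?a + line_len f n < X" using root_line_less[of "Suc x"] x len by simp
  have sum: "(\<Sum>i=?a..<?a + line_len f n. arc_wt (i - n)) = F x" using sum_root_line[OF x] len by simp
  have pos: "line_len f n > 0" using n_pos B_pos by (simp add: line_len_def)
  show ?thesis
  proof
    assume "R inp t (root_line f n x) (root_line f n (Suc x)) d"
    then have "correct ?a (?a + line_len f n) d" using R_sound lt d len by auto
    moreover have "n \<le> ?a" by (simp add: root_line_def)
    ultimately show "F x \<le> d" using pos sum by (auto simp: correct_def)
  next
    assume le: "F x \<le> d"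
    show "R inp t (root_line f n x) (root_line f n (Suc x)) d" unfolding len
    \<comment> \<open>Distances are exact from layer \<open>2 * K + 4\<close> on, and the arcs that
      read them one layer later.\<close>
    proof (rule R_line[where ts = "2 * K + 5"])
      fix t i :: nat assume t: "2 * K + 5 \<le> t" and i: "i < line_len f n"
      obtain t' where t': "t = Suc t'" "t' \<ge> 2 * K + 4" using t by (cases t) auto
      define j where "j = x * line_len f n + i"
      have j: "?a + i - n = n * n * B + j" by (simp add: root_line_def j_def)
      have jl: "j < n * line_len f n"
      proof -
        have "j < Suc x * line_len f n" using i by (simp add: j_def)
        also have "\<dots> \<le> n * line_len f n" using x by (intro mult_right_mono) auto
        finally show ?thesis .
      qed
      define q where "q = j div B"
      define u where "u = q div 2 div n mod n"
      define v where "v = q div 2 mod n"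
      define y where "y = q div 2 div n div n"
      have uvy: "u < n" "v < n" "y < n" unfolding u_def v_def y_def q_def using root_arc_indices[OF jl] by auto
      let ?z = "if q mod 2 = 0 then u else v"
      have wtj: "arc_wt (?a + i - n) = of_bool (j mod B \<noteq> 0 \<and> floorlog 2 (j mod B) \<le> W' \<and>
          bit (r u) (floorlog 2 (j mod B) - 1)) * D y ?z"
        unfolding j arc_wt_def Let_def q_def u_def v_def y_def by simp
      have "arc_wt (?a + i - n) \<le> D y ?z" unfolding wtj by (rule of_bool_mult_le)
      moreover have "D y ?z < X" using D_less_X uvy by simp
      ultimately have c: "arc_wt (?a + i - n) < X" by (rule le_less_trans)
      have nn: "\<not> ?a + i - n < n * n * B" unfolding j by simp
      have "R inp t' y ?z (arc_wt (?a + i - n)) \<or> j mod B = 0 \<or> W' < floorlog 2 (j mod B) \<or>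
          \<not> bit (r u) (floorlog 2 (j mod B) - 1)"
      proof (cases "j mod B \<noteq> 0 \<and> floorlog 2 (j mod B) \<le> W' \<and> bit (r u) (floorlog 2 (j mod B) - 1)")
        case True
        then have "arc_wt (?a + i - n) = D y ?z" unfolding wtj by simp
        then show ?thesis using R_dist[OF uvy(3) _ c t'(2), of ?z] uvy by simp
      qed (auto simp: not_le)
      then have ex: "\<exists>e<X. L inp t' (fst (arc_term f n (?a + i - n) (arc_wt (?a + i - n)) e)) \<and>
          L inp t' (snd (arc_term f n (?a + i - n) (arc_wt (?a + i - n)) e))"
        unfolding root_arc[OF nn c] Let_def unfolding j add_diff_cancel_left' q_def u_def v_def y_def
        using jl by blast
      have a: "?a + i < X" "Suc (?a + i) < X" "n \<le> ?a + i" using lt i by (auto simp: root_line_def)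
      have "base_term f n (?a + i) (Suc (?a + i)) c' e = arc_term f n (?a + i - n) c' e" for c' e
        using a(3) by (simp add: base_term_def)
      then show "R inp t (?a + i) (Suc (?a + i)) (arc_wt (?a + i - n))"
        unfolding t'(1) R_Suc[OF a(1,2) c] using ex by simp
    qed (use lt sum le d t in auto)
  qed
qed

section \<open>Parents, the best root and the output\<close>

definition parent_of :: "nat \<Rightarrow> nat \<Rightarrow> nat \<Rightarrow> bool" where
  "parent_of x u v \<longleftrightarrow> {u, v} \<in> E \<and> D x u + w' {u, v} \<le> D x v"

lemma pair_less_X: "u < n \<Longrightarrow> v < n \<Longrightarrow> u * n + v < X"
proof -
  assume "u < n" "v < n"
  then have "u * n + v < n * n" by (rule pair_less)
  also have "n * n * 1 \<le> n * n * B" using B_pos by (intro mult_left_mono) auto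
  finally show ?thesis by (simp add: size_bd_def)
qed

text \<open>The witness is a number separating the two distances after the shift;
  \<open>D x u\<close> is the best candidate.\<close>

lemma H_iff:
  assumes "x < n" "u < n" "v < n" "\<beta> < X" "t \<ge> 2 * K + 5"
  shows "M inp t 3 x (u * n + v) \<beta> \<longleftrightarrow> D x u + scale f n * \<beta> < D x v"
proof -
  obtain t' where t': "t = Suc t'" "t' \<ge> 2 * K + 4" using assms(5) by (cases t) auto
  have X: "x < X" "u < X" "v < X" using assms n_less_X by auto
  have dm: "(u * n + v) div n = u" "(u * n + v) mod n = v" using assms by auto
  have "M inp t 3 x (u * n + v) \<beta> \<longleftrightarrow> (\<exists>e. e + scale f n * \<beta> < X \<and> R inp t' x u e \<and> \<not> R inp t' x v (e + scale f n * \<beta>))"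
    unfolding t' using H_Suc[of x "u * n + v" \<beta> inp t'] X assms pair_less_X[of u v] unfolding dm by blast
  also have "\<dots> \<longleftrightarrow> D x u + scale f n * \<beta> < D x v"
  proof
    assume "\<exists>e. e + scale f n * \<beta> < X \<and> R inp t' x u e \<and> \<not> R inp t' x v (e + scale f n * \<beta>)"
    then obtain e where e: "e + scale f n * \<beta> < X" "R inp t' x u e" "\<not> R inp t' x v (e + scale f n * \<beta>)" by blast
    have "e < X" using e(1) by linarith
    then have "D x u \<le> e" using R_dist[OF assms(1,2) _ t'(2)] e(2) by blast
    moreover have "\<not> D x v \<le> e + scale f n * \<beta>" using R_dist[OF assms(1,3) e(1) t'(2)] e(3) by blast
    ultimately show "D x u + scale f n * \<beta> < D x v" by linarith
  next
    assume lt: "D x u + scale f n * \<beta> < D x v"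
    then have l: "D x u + scale f n * \<beta> < X" using D_less_X[OF assms(1,3)] by linarith
    have "R inp t' x u (D x u)" using R_dist[OF assms(1,2) D_less_X[OF assms(1,2)] t'(2)] by simp
    moreover have "\<not> R inp t' x v (D x u + scale f n * \<beta>)" using R_dist[OF assms(1,3) l t'(2)] lt by simp
    ultimately show "\<exists>e. e + scale f n * \<beta> < X \<and> R inp t' x u e \<and> \<not> R inp t' x v (e + scale f n * \<beta>)"
      using l by blast
  qed
  finally show ?thesis .
qed

text \<open>The best choice of \<open>e\<close> is the raw weight itself, and the strict inequality
  of region 3 supplies the \<open>+ 1\<close> in \<open>w'\<close>.\<close>

lemma good_iff:
  assumes "x < n" "u < n" "v < n" "t \<ge> 2 * K + 6"
  shows "M inp t 4 x u v \<longleftrightarrow> parent_of x u v"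
proof -
  obtain t' where t': "t = Suc t'" "t' \<ge> 2 * K + 5" using assms(4) by (cases t) auto
  have X: "x < X" "u < X" "v < X" using assms n_less_X by auto
  let ?a = "edge_line f n u v"
  have "M inp t 4 x u v \<longleftrightarrow> (\<exists>e<X. M inp t' 3 x (u * n + v) e \<and> R inp t' ?a (?a + B) e)"
    unfolding t' by (rule good_Suc) (use X assms pair_less_X edge_line_less in auto)
  also have "\<dots> \<longleftrightarrow> parent_of x u v"
  proof
    assume "\<exists>e<X. M inp t' 3 x (u * n + v) e \<and> R inp t' ?a (?a + B) e"
    then obtain e where e: "e < X" "M inp t' 3 x (u * n + v) e" "R inp t' ?a (?a + B) e" by blast
    have "correct ?a (?a + B) e" using R_sound e edge_line_less[OF assms(2,3)] by auto
    from edge_line_correct[OF assms(2,3) this] have c: "{u, v} \<in> E" "w {u, v} \<le> e" by auto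
    have "D x u + scale f n * e < D x v" using H_iff[OF assms(1-3) e(1) t'(2)] e(2) by blast
    moreover have "scale f n * w {u, v} \<le> scale f n * e" using c(2) by (rule mult_left_mono) simp
    ultimately have "D x u + w' {u, v} \<le> D x v" by linarith
    then show "parent_of x u v" using c(1) unfolding parent_of_def by blast
  next
    assume p: "parent_of x u v"
    then have e: "{u, v} \<in> E" by (simp add: parent_of_def)
    have "w' {u, v} < X" using e by (rule edge_weight_less)
    moreover have "1 * w {u, v} \<le> scale f n * w {u, v}" by (intro mult_right_mono) (auto simp: scale_def)
    ultimately have wX: "w {u, v} < X" by linarith
    have "R inp t' ?a (?a + B) (w {u, v})" using t' by (intro R_edge_line e assms wX) auto
    moreover have "M inp t' 3 x (u * n + v) (w {u, v})"
      using H_iff[OF assms(1-3) wX t'(2)] p by (simp add: parent_of_def)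
    ultimately show "\<exists>e<X. M inp t' 3 x (u * n + v) e \<and> R inp t' ?a (?a + B) e" using wX by blast
  qed
  finally show ?thesis .
qed

lemma sel_iff:
  assumes "x < n" "u < n" "v < n" "t \<ge> 2 * K + 8"
  shows "M inp t 8 x u v \<longleftrightarrow> parent_of x u v \<and> (\<forall>z<u. \<not> parent_of x z v)"
proof -
  obtain t' where t': "t = Suc (Suc t')" "t' \<ge> 2 * K + 6" using assms(4) by (cases t; cases "t - 1") auto
  have X: "x < X" "u < X" "v < X" using assms n_less_X by auto
  have "M inp (Suc t') 5 x u v \<longleftrightarrow> (\<exists>z<u. parent_of x z v)"
    unfolding bad_Suc[OF X] using good_iff[OF assms(1) _ assms(3) t'(2)] assms(2) by (meson less_trans)
  then show ?thesis unfolding t' sel_Suc[OF X] using good_iff[OF assms(1-3), of "Suc t'"] t'(2) by auto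
qed

lemma gt_iff:
  assumes "x < n" "y < n" "t \<ge> 3 * K + 7"
  shows "M inp t 6 x y 0 \<longleftrightarrow> F y < F x"
proof -
  obtain t' where t': "t = Suc t'" "t' \<ge> 3 * K + 6" using assms(3) by (cases t) auto
  have X: "x < X" "y < X" "root_line f n (x + 1) < X" "root_line f n (y + 1) < X"
    using assms n_less_X by (auto intro!: root_line_less)
  have "M inp t 6 x y 0 \<longleftrightarrow> (\<exists>e<X. F y \<le> e \<and> \<not> F x \<le> e)"
    unfolding t'(1) gt_Suc[OF X] using R_root[OF assms(1) _ t'(2)] R_root[OF assms(2) _ t'(2)] by auto
  also have "\<dots> \<longleftrightarrow> F y < F x"
    using F_less_X[OF assms(2)] by (auto intro: exI[of _ "F y"])
  finally show ?thesis .
qed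

text \<open>The smallest index among the minimizers, the same tie rule as in region 7, so exactly
  one root survives.\<close>

definition root :: nat where
  "root = (LEAST x. x < n \<and> (\<forall>y<n. F x \<le> F y))"

lemma root: "root < n" "y < n \<Longrightarrow> F root \<le> F y"
proof -
  have "\<exists>x\<in>{..<n}. \<forall>y\<in>{..<n}. F x \<le> F y"
  proof -
    have "Min (F ` {..<n}) \<in> F ` {..<n}" using n_pos by (intro Min_in) (auto simp: lessThan_empty_iff)
    then obtain x where x: "x \<in> {..<n}" "Min (F ` {..<n}) = F x" by auto
    have "F x \<le> F y" if "y \<in> {..<n}" for y unfolding x(2)[symmetric] using that by (intro Min_le) auto
    then show ?thesis using x(1) by blast
  qed
  then have "\<exists>x. x < n \<and> (\<forall>y<n. F x \<le> F y)" by auto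
  then have "root < n \<and> (\<forall>y<n. F root \<le> F y)" unfolding root_def by (rule LeastI_ex)
  then show "root < n" "y < n \<Longrightarrow> F root \<le> F y" by auto
qed

lemma lose_iff:
  assumes "x < n" "t \<ge> 3 * K + 8"
  shows "M inp t 7 x 0 0 \<longleftrightarrow> x \<noteq> root"
proof -
  obtain t' where t': "t = Suc t'" "t' \<ge> 3 * K + 7" using assms(2) by (cases t) auto
  have X: "x < X" using assms n_less_X by auto
  have "M inp t 7 x 0 0 \<longleftrightarrow> (\<exists>z<n. F z < F x) \<or> (\<exists>z<x. \<not> F x < F z)"
    unfolding t'(1) lose_Suc[OF X] using gt_iff[OF _ _ t'(2)] assms(1) by (meson less_trans)
  also have "\<dots> \<longleftrightarrow> x \<noteq> root"
  proof
    assume l: "(\<exists>z<n. F z < F x) \<or> (\<exists>z<x. \<not> F x < F z)"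
    show "x \<noteq> root"
    proof
      assume xr: "x = root"
      then obtain z where z: "z < root" "F z \<le> F root" using l root by (auto simp: not_less) (metis not_le)
      then have "z < n \<and> (\<forall>y<n. F z \<le> F y)" using root by (meson le_trans less_trans)
      then show False using not_less_Least[of z "\<lambda>x. x < n \<and> (\<forall>y<n. F x \<le> F y)"] z(1) unfolding root_def by blast
    qed
  next
    assume ne: "x \<noteq> root"
    show "(\<exists>z<n. F z < F x) \<or> (\<exists>z<x. \<not> F x < F z)"
    proof (cases "F root < F x")
      case True
      then show ?thesis using root(1) by blast
    next
      case False
      then have "\<forall>y<n. F x \<le> F y" using root(2) by (meson le_trans not_le)
      then have "root \<le> x" unfolding root_def using assms(1) by (intro Least_le) simp
      then have "root < x" using ne by simp
      moreover have "\<not> F x < F root" using root(2)[OF assms(1)] False \<open>\<forall>y<n. F x \<le> F y\<close> root(1) by simp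
      ultimately show ?thesis using root(2)[OF assms(1)] False by (meson not_less)
    qed
  qed
  finally show ?thesis .
qed

definition par :: "nat \<Rightarrow> nat" where
  "par v = (LEAST u. parent_of root u v)"

lemma parent_par:
  assumes "v < n" "v \<noteq> root"
  shows "parent_of root (par v) v"
proof -
  obtain u where "{u, v} \<in> E" "D root u + w' {u, v} \<le> D root v"
    using graph_dist_pred[OF D_le(1)[OF root(1) assms(1)] assms(2)] .
  then have "parent_of root u v" by (simp add: parent_of_def)
  then show ?thesis unfolding par_def by (rule LeastI)
qed

sublocale spt: shortest_path_tree "{..<n}" E w' root par
proof
  show "simple_graph {..<n} E" by (rule G)
  show "root \<in> {..<n}" using root by simp
  show "{par v, v} \<in> E" "D root (par v) + w' {par v, v} \<le> D root v" if "v \<in> {..<n} - {root}" for v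
    using parent_par[of v] that by (auto simp: parent_of_def)
qed simp

lemma sel_root_iff:
  assumes "u < n" "v < n" "t \<ge> 2 * K + 8"
  shows "M inp t 8 root u v \<longleftrightarrow> v \<noteq> root \<and> u = par v"
proof -
  have "parent_of root u v \<and> (\<forall>z<u. \<not> parent_of root z v) \<longleftrightarrow> v \<noteq> root \<and> u = par v"
  proof
    assume p: "parent_of root u v \<and> (\<forall>z<u. \<not> parent_of root z v)"
    then have "v \<noteq> root" by (auto simp: parent_of_def graph_dist_refl)
    moreover have "par v \<le> u" unfolding par_def using p by (intro Least_le) simp
    moreover have "\<not> par v < u" using p parent_par[OF assms(2) \<open>v \<noteq> root\<close>] by blast
    ultimately show "v \<noteq> root \<and> u = par v" by simp
  next
    assume "v \<noteq> root \<and> u = par v"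
    then show "parent_of root u v \<and> (\<forall>z<u. \<not> parent_of root z v)"
      using parent_par[OF assms(2)] not_less_Least unfolding par_def by blast
  qed
  then show ?thesis using sel_iff[OF root(1) assms] by simp
qed

lemma out_iff:
  assumes "u < n" "v < n" "t \<ge> 3 * K + 9"
  shows "M inp t 9 u v 0 \<longleftrightarrow> {u, v} \<in> spt.Y"
proof -
  obtain t' where t': "t = Suc t'" "t' \<ge> 3 * K + 8" using assms(3) by (cases t) auto
  have X: "u < X" "v < X" using assms n_less_X by auto
  have "M inp t 9 u v 0 \<longleftrightarrow> M inp t' 8 root u v \<or> M inp t' 8 root v u"
    unfolding t'(1) out_Suc[OF X] using lose_iff[OF _ t'(2)] root(1) by blast
  also have "\<dots> \<longleftrightarrow> (v \<noteq> root \<and> u = par v) \<or> (u \<noteq> root \<and> v = par u)"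
    using sel_root_iff assms t'(2) by simp
  also have "\<dots> \<longleftrightarrow> {u, v} \<in> spt.Y"
    using spt.Y_edge[of u v] assms by (auto simp: spt.Y_def insert_commute)
  finally show ?thesis .
qed

lemma circuit_output: "circuit_eval circ inp = encode_answer n (Some spt.Y)"
proof -
  have "[0..<n * n + 1] = 0 # map Suc [0..<n * n]" by (simp add: upt_conv_Cons map_Suc_upt)
  moreover have "mem inp (num_layers f n) (output_cell f n 0)"
    using M_0[of inp "num_layers f n"] by (simp add: M_def output_cell_def cell_def)
  moreover have "mem inp (num_layers f n) (output_cell f n (Suc q)) = ({q div n, q mod n} \<in> spt.Y)" if "q < n * n" for q
    using out_iff[of "q div n" "q mod n" "num_layers f n"] that n_pos less_mult_imp_div_less[OF that]
    by (simp add: M_def output_cell_def num_layers_def K_def)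
  ultimately show ?thesis unfolding circuit_eval_circ by (simp add: product_upt)
qed

lemma Y_approx: "approx_SROCT 2 n E w r spt.Y"
proof -
  have "sum_req_cost {..<n} w r spt.Y \<le> 2 * sum_req_cost {..<n} w r (SROCT {..<n} E w r)"
  proof (rule shortest_path_tree_approx[where B = B and N = "scale f n"])
    show "spanning_tree {..<n} E (SROCT {..<n} E w r)" by (rule SROCT_spanning[OF G spt.Y_spanning])
    show "shortest_path_tree {..<n} E w' root par" by unfold_locales
    show "r v < B" if "v \<in> {..<n}" for v using r_less[of v] pow_W'_le that by simp
    show "F root \<le> F y" if "y \<in> {..<n}" for y using root that by simp
  qed (simp_all add: G scale_def)
  then have "real (sum_req_cost {..<n} w r spt.Y) \<le> real (2 * sum_req_cost {..<n} w r (SROCT {..<n} E w r))"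
    by (rule of_nat_mono)
  then show ?thesis using spt.Y_spanning by (simp add: approx_SROCT_def)
qed

end

section \<open>Uniformity and the theorem\<close>

text \<open>Register \<open>0\<close> holds \<open>n\<close> and register \<open>1\<close> the
  counter of the enclosing loop.\<close>

definition expressible :: "(nat \<Rightarrow> nat \<Rightarrow> nat) \<Rightarrow> bool" where
  "expressible g \<longleftrightarrow> (\<exists>e. evars e \<subseteq> {..<2} \<and> (\<forall>\<sigma>. eval e \<sigma> = g (\<sigma> 0) (\<sigma> 1)))"

definition decidable :: "(nat \<Rightarrow> nat \<Rightarrow> bool) \<Rightarrow> bool" where
  "decidable P \<longleftrightarrow> expressible (\<lambda>n k. of_bool (P n k))"

definition expressible2 :: "(nat \<Rightarrow> nat \<Rightarrow> nat \<times> nat) \<Rightarrow> bool" where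
  "expressible2 g \<longleftrightarrow> expressible (\<lambda>n k. fst (g n k)) \<and> expressible (\<lambda>n k. snd (g n k))"

lemma expressible_size: "expressible (\<lambda>n k. n)"
  and expressible_counter: "expressible (\<lambda>n k. k)"
  and expressible_const: "expressible (\<lambda>n k. c)"
  unfolding expressible_def
  by (rule exI[of _ "Reg 0"], simp) (rule exI[of _ "Reg 1"], simp, rule exI[of _ "Lit c"], simp)

lemma expressible_Bin:
  assumes "expressible g" "expressible h"
  shows "expressible (\<lambda>n k. apply_op b (g n k) (h n k))"
proof -
  from assms obtain e e' where "evars e \<subseteq> {..<2}" "\<forall>\<sigma>. eval e \<sigma> = g (\<sigma> 0) (\<sigma> 1)"
    "evars e' \<subseteq> {..<2}" "\<forall>\<sigma>. eval e' \<sigma> = h (\<sigma> 0) (\<sigma> 1)" unfolding expressible_def by blast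
  then show ?thesis unfolding expressible_def by (intro exI[of _ "Bin b e e'"]) simp
qed

lemma expressible_floorlog:
  assumes "expressible g"
  shows "expressible (\<lambda>n k. floorlog 2 (g n k))"
proof -
  from assms obtain e where "evars e \<subseteq> {..<2}" "\<forall>\<sigma>. eval e \<sigma> = g (\<sigma> 0) (\<sigma> 1)" unfolding expressible_def by blast
  then show ?thesis unfolding expressible_def by (intro exI[of _ "FloorLog e"]) simp
qed

lemma expressible_add: "expressible g \<Longrightarrow> expressible h \<Longrightarrow> expressible (\<lambda>n k. g n k + h n k)"
  and expressible_diff: "expressible g \<Longrightarrow> expressible h \<Longrightarrow> expressible (\<lambda>n k. g n k - h n k)"
  and expressible_mult: "expressible g \<Longrightarrow> expressible h \<Longrightarrow> expressible (\<lambda>n k. g n k * h n k)"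
  and expressible_div_Suc: "expressible g \<Longrightarrow> expressible h \<Longrightarrow> expressible (\<lambda>n k. g n k div Suc (h n k))"
  using expressible_Bin[of g h Plus] expressible_Bin[of g h Minus]
    expressible_Bin[of g h Times] expressible_Bin[of g h DivSuc] by simp_all

lemma expressible_div:
  assumes "expressible g" "expressible h"
  shows "expressible (\<lambda>n k. g n k div h n k)"
proof -
  \<comment> \<open>The first factor is 0 or 1 according to whether the divisor vanishes, in
    agreement with division by zero being 0.\<close>
  have "expressible (\<lambda>n k. (1 - (1 - h n k)) * (g n k div Suc (h n k - 1)))"
    by (intro expressible_mult expressible_diff expressible_div_Suc expressible_const assms)
  moreover have "(1 - (1 - b)) * (a div Suc (b - 1)) = a div b" for a b :: nat by (cases b) auto
  ultimately show ?thesis by (simp only:)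
qed

lemma expressible_mod:
  assumes "expressible g" "expressible h"
  shows "expressible (\<lambda>n k. g n k mod h n k)"
proof -
  have "expressible (\<lambda>n k. g n k - g n k div h n k * h n k)"
    by (intro expressible_mult expressible_diff expressible_div assms)
  then show ?thesis by (simp only: minus_div_mult_eq_mod)
qed

lemma expressible_power: "expressible g \<Longrightarrow> expressible (\<lambda>n k. g n k ^ c)"
  by (induction c) (simp_all add: expressible_const expressible_mult)

text \<open>The language has no branching, so case distinctions are turned into arithmetic on truth
  values.\<close>

lemma expressible_if:
  assumes "decidable P" "expressible g" "expressible h"
  shows "expressible (\<lambda>n k. if P n k then g n k else h n k)"
proof -
  have "expressible (\<lambda>n k. of_bool (P n k) * g n k + (1 - of_bool (P n k)) * h n k)"
    by (intro expressible_add expressible_mult expressible_diff expressible_const assms assms(1)[unfolded decidable_def])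
  moreover have "of_bool b * x + (1 - of_bool b) * y = (if b then x else y)" for b and x y :: nat by simp
  ultimately show ?thesis by (simp only:)
qed

lemma decidable_less: "expressible g \<Longrightarrow> expressible h \<Longrightarrow> decidable (\<lambda>n k. g n k < h n k)"
proof -
  assume "expressible g" "expressible h"
  then have "expressible (\<lambda>n k. 1 - (1 - (h n k - g n k)))"
    by (intro expressible_diff expressible_const)
  moreover have "1 - (1 - (b - a)) = of_bool (a < b)" for a b :: nat by auto
  ultimately show ?thesis unfolding decidable_def by (simp only:)
qed

lemma decidable_not: "decidable P \<Longrightarrow> decidable (\<lambda>n k. \<not> P n k)"
proof -
  assume "decidable P"
  then have "expressible (\<lambda>n k. 1 - of_bool (P n k))"
    unfolding decidable_def by (intro expressible_diff expressible_const)
  moreover have "1 - of_bool b = (of_bool (\<not> b) :: nat)" for b by simp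
  ultimately show ?thesis unfolding decidable_def by (simp only:)
qed

lemma decidable_conj: "decidable P \<Longrightarrow> decidable Q \<Longrightarrow> decidable (\<lambda>n k. P n k \<and> Q n k)"
  unfolding decidable_def using expressible_mult[of "\<lambda>n k. of_bool (P n k)" "\<lambda>n k. of_bool (Q n k)"]
  by (simp only: of_bool_conj)

lemma decidable_disj: "decidable P \<Longrightarrow> decidable Q \<Longrightarrow> decidable (\<lambda>n k. P n k \<or> Q n k)"
  using decidable_not[OF decidable_conj[OF decidable_not[of P] decidable_not[of Q]]] by simp

lemma decidable_le: "expressible g \<Longrightarrow> expressible h \<Longrightarrow> decidable (\<lambda>n k. g n k \<le> h n k)"
  using decidable_not[OF decidable_less[of h g]] by (simp add: not_less)

lemma decidable_eq: "expressible g \<Longrightarrow> expressible h \<Longrightarrow> decidable (\<lambda>n k. g n k = h n k)"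
  using decidable_conj[OF decidable_le[of g h] decidable_le[of h g]] by (simp only: order_eq_iff[symmetric])

lemma expressible2_Pair: "expressible g \<Longrightarrow> expressible h \<Longrightarrow> expressible2 (\<lambda>n k. (g n k, h n k))"
  by (simp add: expressible2_def)

lemma expressible2_if:
  assumes "decidable P" "expressible2 g" "expressible2 h"
  shows "expressible2 (\<lambda>n k. if P n k then g n k else h n k)"
proof -
  have "fst (if b then x else y) = (if b then fst x else fst y)" "snd (if b then x else y) = (if b then snd x else snd y)"
    for b and x y :: "nat \<times> nat" by simp_all
  then show ?thesis using assms unfolding expressible2_def by (auto intro!: expressible_if)
qed

lemmas expressible_base = expressible_size expressible_counter expressible_const expressible_floorlog
  expressible_add expressible_diff expressible_mult expressible_div expressible_mod expressible_power
  expressible_if expressible2_Pair expressible2_if decidable_less decidable_not decidable_conj decidable_disj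
  decidable_le decidable_eq

lemma expressible_params:
  "expressible (\<lambda>n k. width f n)" "expressible (\<lambda>n k. val_bd f n)" "expressible (\<lambda>n k. scale f n)"
  "expressible (\<lambda>n k. in_len f n)" "expressible (\<lambda>n k. dist_bd f n)" "expressible (\<lambda>n k. line_len f n)"
  "expressible (\<lambda>n k. size_bd f n)" "expressible (\<lambda>n k. num_cells f n)" "expressible (\<lambda>n k. num_terms f n)"
  "expressible (\<lambda>n k. num_layers f n)"
  unfolding num_cells_def num_terms_def num_layers_def size_bd_def dist_bd_def line_len_def in_len_def
    scale_def val_bd_def width_def
  by (intro expressible_base)+

lemma expressible_cell:
  assumes "expressible a" "expressible b" "expressible c" "expressible d"
  shows "expressible (\<lambda>n k. cell (size_bd f n) (a n k) (b n k) (c n k) (d n k))"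
    "expressible (\<lambda>n k. pos_lit f n (a n k) (b n k) (c n k) (d n k))"
    "expressible (\<lambda>n k. neg_lit f n (a n k) (b n k) (c n k) (d n k))"
  unfolding pos_lit_def neg_lit_def cell_def by (intro expressible_base expressible_params assms)+

lemma expressible_edge_line:
  "expressible a \<Longrightarrow> expressible b \<Longrightarrow> expressible (\<lambda>n k. edge_line f n (a n k) (b n k))"
  unfolding edge_line_def by (intro expressible_base expressible_params)

lemma expressible_unary:
  assumes "expressible a"
  shows "expressible (\<lambda>n k. root_line f n (a n k))" "expressible (\<lambda>n k. clip f n (a n k))"
    "expressible (\<lambda>n k. output_cell f n (a n k))"
  unfolding root_line_def output_cell_def clip_def cell_def
  by (intro expressible_base expressible_params assms)+

lemmas expressible_lits = expressible_cell expressible_edge_line expressible_unary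

lemmas expressible_more = expressible_base expressible_params expressible_lits

lemma expressible2_arc_term:
  assumes "expressible i" "expressible c" "expressible e"
  shows "expressible2 (\<lambda>n k. arc_term f n (i n k) (c n k) (e n k))"
  unfolding arc_term_def root_arc_term_def Let_def by (intro expressible_more assms)

lemma expressible2_base_term:
  assumes "expressible a" "expressible b" "expressible c" "expressible e"
  shows "expressible2 (\<lambda>n k. base_term f n (a n k) (b n k) (c n k) (e n k))"
  unfolding base_term_def by (intro expressible_more expressible2_arc_term assms)

lemma expressible2_update_term:
  assumes "expressible reg" "expressible a" "expressible b" "expressible c" "expressible h" "expressible z" "expressible e"
  shows "expressible2 (\<lambda>n k. update_term f n (reg n k) (a n k) (b n k) (c n k) (h n k) (z n k) (e n k))"
  unfolding update_term_def by (intro expressible_more expressible2_base_term assms)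

lemma expressible2_cell_term:
  assumes "expressible s" "expressible j"
  shows "expressible2 (\<lambda>n k. cell_term f n (s n k) (j n k))"
proof -
  let ?t = "\<lambda>n k. update_term f n (s n k div size_bd f n div size_bd f n div size_bd f n)
    (s n k div size_bd f n div size_bd f n mod size_bd f n) (s n k div size_bd f n mod size_bd f n)
    (s n k mod size_bd f n) (j n k div size_bd f n div size_bd f n) (j n k div size_bd f n mod size_bd f n)
    (j n k mod size_bd f n)"
  have "expressible2 ?t" by (intro expressible2_update_term expressible_more assms)
  then have t: "expressible (\<lambda>n k. fst (?t n k))" "expressible (\<lambda>n k. snd (?t n k))"
    by (simp_all add: expressible2_def)
  show ?thesis unfolding cell_term_def Let_def by (intro expressible2_Pair expressible_lits t)
qed

section \<open>The gate list as an arithmetic function of the gate number\<close>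

definition sroct_family :: "nat \<Rightarrow> nat \<Rightarrow> circuit" where
  "sroct_family f n = layered.circ (num_terms f n) (num_cells f n) (num_layers f n) (in_len f n) (n * n + 1)
     (init_gate f n) (cell_term f n) (output_cell f n)"

definition lit_pos :: "nat \<Rightarrow> nat \<Rightarrow> nat \<Rightarrow> nat \<Rightarrow> nat" where
  "lit_pos f n t a = (t * num_cells f n + a div 2) * (2 * num_terms f n) + (2 * num_terms f n - 2 + a mod 2)"

text \<open>Splits \<open>gate_at\<close> into the number fields of \<open>gate_code\<close>; fields
  that a gate lacks get arbitrary values in the two argument functions.\<close>

definition gate_tag :: "nat \<Rightarrow> nat \<Rightarrow> nat \<Rightarrow> nat" where
  "gate_tag f n k = (let J = num_terms f n; S = num_cells f n; p = k mod (2 * J); q = k div (2 * J);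
     s = q mod S; t = q div S; b = cell (size_bd f n) 1 0 0 0 in
     if p = 2 * J - 1 then 4
     else if t = 0 then (if p = 2 * J - 2 then (if s < b then 3 else if s < b + in_len f n then 1 else 2) else 2)
     else if p < J then 5 else 6)"

definition gate_arg1 :: "nat \<Rightarrow> nat \<Rightarrow> nat \<Rightarrow> nat" where
  "gate_arg1 f n k = (let J = num_terms f n; S = num_cells f n; p = k mod (2 * J); q = k div (2 * J);
     s = q mod S; t = q div S; b = cell (size_bd f n) 1 0 0 0 in
     if p = 2 * J - 1 then k - 1
     else if t = 0 then s - b
     else if p < J then lit_pos f n (t - 1) (fst (cell_term f n s p)) else q * (2 * J) + 2 * (p - J))"

definition gate_arg2 :: "nat \<Rightarrow> nat \<Rightarrow> nat \<Rightarrow> nat" where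
  "gate_arg2 f n k = (let J = num_terms f n; S = num_cells f n; p = k mod (2 * J); q = k div (2 * J);
     s = q mod S; t = q div S in
     if p < J then lit_pos f n (t - 1) (snd (cell_term f n s p)) else q * (2 * J) + 2 * (p - J) + 1)"

lemma expressible_lit_pos: "expressible t \<Longrightarrow> expressible a \<Longrightarrow> expressible (\<lambda>n k. lit_pos f n (t n k) (a n k))"
  unfolding lit_pos_def by (intro expressible_more)

lemma expressible_cell_term:
  assumes "expressible s" "expressible j"
  shows "expressible (\<lambda>n k. fst (cell_term f n (s n k) (j n k)))" "expressible (\<lambda>n k. snd (cell_term f n (s n k) (j n k)))"
  using expressible2_cell_term[OF assms, of f] by (simp_all add: expressible2_def)

lemma expressible_gate:
  "expressible (gate_tag f)" "expressible (gate_arg1 f)" "expressible (gate_arg2 f)"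
proof -
  have "expressible (\<lambda>n k. gate_tag f n k)" "expressible (\<lambda>n k. gate_arg1 f n k)" "expressible (\<lambda>n k. gate_arg2 f n k)"
    unfolding gate_tag_def gate_arg1_def gate_arg2_def Let_def
    by (intro expressible_more expressible_lit_pos expressible_cell_term)+
  then show "expressible (gate_tag f)" "expressible (gate_arg1 f)" "expressible (gate_arg2 f)" .
qed

context sroct_circuit
begin

lemma circ_eq: "sroct_family f n = circ"
  by (simp add: sroct_family_def)

lemma lit_addr_eq: "lit_addr t a = lit_pos f n t a"
  by (simp add: lit_addr_def lit_pos_def)

text \<open>Optional fields are lists of length 0 or 1, so the program prints them by loops with at
  most one pass.\<close>

lemma gate_code_gate_at:
  "gate_code (gate_at k) = gate_tag f n k #
     replicate (of_bool (gate_tag f n k \<noteq> 2 \<and> gate_tag f n k \<noteq> 3)) (gate_arg1 f n k) @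
     replicate (of_bool (gate_tag f n k > 4)) (gate_arg2 f n k)"
proof -
  let ?J = "num_terms f n" and ?S = "num_cells f n"
  let ?p = "k mod (2 * ?J)" and ?q = "k div (2 * ?J)"
  let ?s = "?q mod ?S" and ?t = "?q div ?S"
  consider (neg) "?p = 2 * ?J - 1" | (init) "?p \<noteq> 2 * ?J - 1" "?t = 0"
    | (leaf) "?p \<noteq> 2 * ?J - 1" "?t \<noteq> 0" "?p < ?J" | (inner) "?p \<noteq> 2 * ?J - 1" "?t \<noteq> 0" "\<not> ?p < ?J" by blast
  then show ?thesis
  proof cases
    case neg
    then show ?thesis by (simp add: gate_at_def gate_tag_def gate_arg1_def Let_def)
  next
    case init
    then show ?thesis by (simp add: gate_at_def gate_tag_def gate_arg1_def Let_def init_gate_def)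
  next
    case leaf
    then show ?thesis by (simp add: gate_at_def gate_tag_def gate_arg1_def gate_arg2_def Let_def lit_addr_eq)
  next
    case inner
    then show ?thesis by (simp add: gate_at_def gate_tag_def gate_arg1_def gate_arg2_def Let_def)
  qed
qed

lemma encode_family:
  "encode_circuit (sroct_family f n) = concat (map unary (in_len f n #
     concat (map (\<lambda>k. gate_tag f n k #
       replicate (of_bool (gate_tag f n k \<noteq> 2 \<and> gate_tag f n k \<noteq> 3)) (gate_arg1 f n k) @
       replicate (of_bool (gate_tag f n k > 4)) (gate_arg2 f n k))
       [0..<Suc (num_layers f n) * num_cells f n * (2 * num_terms f n)]) @ [0] @
     map (\<lambda>i. lit_pos f n (num_layers f n) (2 * output_cell f n i)) [0..<n * n + 1]))"
proof -
  have "(\<lambda>k. replicate k True @ [False]) = unary" by (simp add: fun_eq_iff unary_def)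
  then show ?thesis unfolding circ_eq encode_circuit_def circ_def num_gates_def
    by (simp only: circuit.simps map_map comp_def gate_code_gate_at lit_addr_eq)
qed

end

text \<open>Outside the loops only register \<open>0\<close> is in scope. Register \<open>1\<close>
  can be replaced by a constant whenever the value does not depend on it.\<close>

fun fix_counter :: "exp \<Rightarrow> exp" where
  "fix_counter (Reg r) = (if r = 0 then Reg 0 else Lit 0)"
| "fix_counter (Lit c) = Lit c"
| "fix_counter (Bin b e e') = Bin b (fix_counter e) (fix_counter e')"
| "fix_counter (FloorLog e) = FloorLog (fix_counter e)"

lemma eval_fix_counter: "eval (fix_counter e) \<sigma> = eval e (\<lambda>r. if r = 0 then \<sigma> 0 else 0)"
  and evars_fix_counter: "evars (fix_counter e) \<subseteq> {..<1}"
  by (induction e) auto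

lemma uniform_family: "logspace_uniform (sroct_family f)"
proof -
  have ex: "\<exists>e. evars e \<subseteq> {..<2} \<and> (\<forall>\<sigma>. eval e \<sigma> = g (\<sigma> 0) (\<sigma> 1))" if "expressible g" for g
    using that unfolding expressible_def .
  have ex0: "\<exists>e. evars e \<subseteq> {..<1} \<and> (\<forall>\<sigma>. eval e \<sigma> = g (\<sigma> 0))" if g: "expressible (\<lambda>n k. g n)" for g
  proof -
    from ex[OF g] obtain e where "\<forall>\<sigma>. eval e \<sigma> = g (\<sigma> 0)" by blast
    then show ?thesis
      using evars_fix_counter[of e] by (intro exI[of _ "fix_counter e"]) (simp add: eval_fix_counter)
  qed
  have "expressible (\<lambda>n k. Suc (num_layers f n) * num_cells f n * (2 * num_terms f n))"
    unfolding Suc_eq_plus1 by (intro expressible_more)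
  from ex0[OF this] obtain eg where eg: "evars eg \<subseteq> {..<1}"
    "\<And>\<sigma>. eval eg \<sigma> = Suc (num_layers f (\<sigma> 0)) * num_cells f (\<sigma> 0) * (2 * num_terms f (\<sigma> 0))" by blast
  have "expressible (\<lambda>n k. in_len f n)" by (intro expressible_more)
  from ex0[OF this] obtain ei where ei: "evars ei \<subseteq> {..<1}" "\<And>\<sigma>. eval ei \<sigma> = in_len f (\<sigma> 0)" by blast
  have "expressible (\<lambda>n k. n * n + 1)" by (intro expressible_more)
  from ex0[OF this] obtain en where en: "evars en \<subseteq> {..<1}" "\<And>\<sigma>. eval en \<sigma> = \<sigma> 0 * \<sigma> 0 + 1" by blast
  from ex[OF expressible_gate(1)] obtain et where et: "evars et \<subseteq> {..<2}"
    "\<And>\<sigma>. eval et \<sigma> = gate_tag f (\<sigma> 0) (\<sigma> 1)" by blast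
  from ex[OF expressible_gate(2)] obtain e1 where e1: "evars e1 \<subseteq> {..<2}"
    "\<And>\<sigma>. eval e1 \<sigma> = gate_arg1 f (\<sigma> 0) (\<sigma> 1)" by blast
  from ex[OF expressible_gate(3)] obtain e2 where e2: "evars e2 \<subseteq> {..<2}"
    "\<And>\<sigma>. eval e2 \<sigma> = gate_arg2 f (\<sigma> 0) (\<sigma> 1)" by blast
  have "decidable (\<lambda>n k. gate_tag f n k \<noteq> 2 \<and> gate_tag f n k \<noteq> 3)"
    by (intro expressible_more expressible_gate)
  from ex[OF this[unfolded decidable_def]] obtain c1 where c1: "evars c1 \<subseteq> {..<2}"
    "\<And>\<sigma>. eval c1 \<sigma> = of_bool (gate_tag f (\<sigma> 0) (\<sigma> 1) \<noteq> 2 \<and> gate_tag f (\<sigma> 0) (\<sigma> 1) \<noteq> 3)" by blast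
  have "decidable (\<lambda>n k. gate_tag f n k > 4)"
    by (intro expressible_more expressible_gate)
  from ex[OF this[unfolded decidable_def]] obtain c2 where c2: "evars c2 \<subseteq> {..<2}"
    "\<And>\<sigma>. eval c2 \<sigma> = of_bool (gate_tag f (\<sigma> 0) (\<sigma> 1) > 4)" by blast
  have "expressible (\<lambda>n k. lit_pos f n (num_layers f n) (2 * output_cell f n k))"
    by (intro expressible_more expressible_lit_pos)
  from ex[OF this] obtain eo where eo: "evars eo \<subseteq> {..<2}"
    "\<And>\<sigma>. eval eo \<sigma> = lit_pos f (\<sigma> 0) (num_layers f (\<sigma> 0)) (2 * output_cell f (\<sigma> 0) (\<sigma> 1))" by blast
  \<comment> \<open>The order of \<open>encode_circuit\<close>: input count, gate codes, end tag,
    outputs. The one-pass loops bounded by \<open>c1\<close> and \<open>c2\<close> leave the gate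
    counter readable in register \<open>1\<close>.\<close>
  define s where "s = Then (EmitN ei) (Then
    (For eg (Then (EmitN et) (Then (For c1 (EmitN e1)) (For c2 (EmitN e2)))))
    (Then (EmitN (Lit 0)) (For en (EmitN eo))))"
  note evs = ei(2) eg(2) en(2) et(2) e1(2) e2(2) c1(2) c2(2) eo(2)
  have "{..<2} \<subseteq> {..<5 :: nat}" "{..<2} \<subseteq> {..<3 :: nat}" by auto
  \<comment> \<open>The loops occupy registers \<open>1\<close> to \<open>4\<close>; any scratch
    base from \<open>5\<close> on would do.\<close>
  then have "wf_stm 1 10 s"
    using ei(1) eg(1) en(1) et(1) e1(1) e2(1) c1(1) c2(1) eo(1) unfolding s_def by (auto simp: subset_iff)
  moreover have "encode_circuit (sroct_family f n) = concat (map unary (outs 1 s ((\<lambda>_. 0)(0 := n))))" for n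
  proof -
    interpret sroct_circuit f n .
    show ?thesis unfolding encode_family s_def
      by (simp add: evs map_replicate_const concat_map_singleton del: upt_Suc)
  qed
  ultimately show ?thesis by (rule logspace_uniform_stm)
qed

section \<open>Size and depth bounds\<close>

lemma poly_bounded_floorlog_self: "poly_bounded (floorlog 2)"
  by (rule poly_bounded_mono[OF poly_bounded_id]) (rule floorlog_le_self)

lemma poly_bounded_size_bd: "poly_bounded (size_bd f)"
  unfolding size_bd_def dist_bd_def line_len_def in_len_def scale_def val_bd_def width_def
  by (intro poly_bounded_intros poly_bounded_floorlog_self)

lemma poly_bounded_bigo:
  assumes "poly_bounded g"
  shows "\<exists>k. (\<lambda>n. real (g n)) \<in> O(\<lambda>n. real n ^ k)"
proof -
  obtain k where k: "\<And>m. g m \<le> (m + 2) ^ k" using assms unfolding poly_bounded_def by blast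
  have "real (g n) \<le> 2 ^ k * real n ^ k" if "n \<ge> 2" for n
  proof -
    have "g n \<le> (2 * n) ^ k" using k[of n] power_mono[of "n + 2" "2 * n" k] that by simp
    then have "real (g n) \<le> real ((2 * n) ^ k)" by (rule of_nat_mono)
    then show ?thesis by (simp add: power_mult_distrib)
  qed
  then have "(\<lambda>n. real (g n)) \<in> O(\<lambda>n. real n ^ k)"
    by (intro bigoI[where c = "2 ^ k"] eventually_at_top_linorderI[of 2]) auto
  then show ?thesis ..
qed

lemma floorlog_le_log:
  assumes "n \<ge> 2"
  shows "real (floorlog 2 n) \<le> 2 * log 2 (real n)"
proof -
  have "log 2 2 \<le> log 2 (real n)" using assms by (subst log_le_cancel_iff) auto
  then have "1 \<le> log 2 (real n)" by simp
  moreover have "real (floorlog 2 n) \<le> log 2 (real n) + 1" using assms calculation by (simp add: floorlog_def)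
  ultimately show ?thesis by linarith
qed

text \<open>Logarithmically many layers, each of logarithmic depth because a cell has only
  polynomially many terms.\<close>

lemma family_depth: "(\<lambda>n. real (circuit_depth (sroct_family f n))) \<in> O(\<lambda>n. (log 2 (real n))\<^sup>2)"
proof -
  obtain c where c: "\<And>n. floorlog 2 (size_bd f n) \<le> c * floorlog 2 n + c"
    using poly_bounded_floorlog[OF poly_bounded_size_bd] by blast
  have "poly_bounded (\<lambda>n. 2 * num_terms f n)"
    unfolding num_terms_def by (intro poly_bounded_intros poly_bounded_size_bd)
  then have "poly_bounded (\<lambda>n. 2 * num_terms f n - 1)" by (rule poly_bounded_mono) simp
  then obtain d where d: "\<And>n. floorlog 2 (2 * num_terms f n - 1) \<le> d * floorlog 2 n + d"
    by (rule poly_bounded_floorlog) blast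
  have "real (circuit_depth (sroct_family f n)) \<le> (9 * c + 12) * (3 * d + 2) * (log 2 (real n))\<^sup>2" if n: "n \<ge> 2" for n
  proof -
    interpret sroct_circuit f n .
    let ?l = "log 2 (real n)"
    have "log 2 2 \<le> ?l" using n by (subst log_le_cancel_iff) auto
    then have l: "1 \<le> ?l" by simp
    have fl: "real (floorlog 2 n) \<le> 2 * ?l" using n by (rule floorlog_le_log)
    have "real (floorlog 2 (size_bd f n)) \<le> real c * real (floorlog 2 n) + real c"
      using c[of n] by (metis of_nat_add of_nat_mono of_nat_mult)
    also have "\<dots> \<le> real c * (2 * ?l) + real c * ?l"
      using fl mult_left_mono[OF l, of "real c"] by (intro add_mono mult_left_mono) auto
    finally have "real (Suc (num_layers f n)) \<le> 9 * real c * ?l + 12" by (simp add: num_layers_def)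
    also have "\<dots> \<le> (9 * real c + 12) * ?l" using l by (simp add: algebra_simps)
    finally have 1: "real (Suc (num_layers f n)) \<le> (9 * real c + 12) * ?l" .
    have "real (floorlog 2 (2 * num_terms f n - 1)) \<le> real d * real (floorlog 2 n) + real d"
      using d[of n] by (metis of_nat_add of_nat_mono of_nat_mult)
    also have "\<dots> \<le> real d * (2 * ?l) + real d * ?l"
      using fl mult_left_mono[OF l, of "real d"] by (intro add_mono mult_left_mono) auto
    finally have "real (floorlog 2 (2 * num_terms f n - 1) + 2) \<le> 3 * real d * ?l + 2" by simp
    also have "\<dots> \<le> (3 * real d + 2) * ?l" using l by (simp add: algebra_simps)
    finally have 2: "real (floorlog 2 (2 * num_terms f n - 1) + 2) \<le> (3 * real d + 2) * ?l" .
    have "real (circuit_depth (sroct_family f n)) \<le>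
      real (Suc (num_layers f n) * (floorlog 2 (2 * num_terms f n - 1) + 2))"
      unfolding circ_eq by (rule of_nat_mono[OF circuit_depth_circ])
    also have "\<dots> \<le> ((9 * real c + 12) * ?l) * ((3 * real d + 2) * ?l)"
      unfolding of_nat_mult by (intro mult_mono 1 2) (use l in auto)
    finally show ?thesis by (simp add: power2_eq_square algebra_simps)
  qed
  then show ?thesis
    by (intro bigoI[where c = "(9 * c + 12) * (3 * d + 2)"] eventually_at_top_linorderI[of 2]) auto
qed

lemma RNC2_family: "RNC2 (input_length p) (\<lambda>_. 0) (sroct_family (width_factor p))"
proof -
  let ?f = "width_factor p"
  have "wf_circuit (sroct_family ?f n) \<and> num_inputs (sroct_family ?f n) = input_length p n + 0" for n
  proof -
    interpret sroct_circuit ?f n .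
    have "num_inputs circ = in_len ?f n" unfolding circ_def by simp
    moreover have "in_len ?f n = input_length p n"
      by (simp add: in_len_def width_def input_length_def field_width_def)
    ultimately show ?thesis using wf_circ unfolding circ_eq by simp
  qed
  moreover have "circuit_size (sroct_family ?f n) = Suc (num_layers ?f n) * num_cells ?f n * (2 * num_terms ?f n)" for n
  proof -
    interpret sroct_circuit ?f n .
    have "circuit_size circ = num_gates" unfolding circuit_size_def circ_def by simp
    then show ?thesis unfolding circ_eq num_gates_def .
  qed
  moreover have "poly_bounded (\<lambda>n. Suc (num_layers ?f n) * num_cells ?f n * (2 * num_terms ?f n))"
    unfolding num_layers_def num_cells_def num_terms_def Suc_eq_plus1
    by (intro poly_bounded_intros poly_bounded_size_bd
        poly_bounded_compose[OF poly_bounded_floorlog_self poly_bounded_size_bd])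
  ultimately have "poly_bounded (\<lambda>n. circuit_size (sroct_family ?f n))"
    and 1: "\<forall>n. wf_circuit (sroct_family ?f n) \<and> num_inputs (sroct_family ?f n) = input_length p n + 0"
    by (simp_all only:) simp
  from poly_bounded_bigo[OF this(1)] show ?thesis
    unfolding RNC2_def using 1 uniform_family family_depth by auto
qed

theorem theorem20:
  fixes p :: "real poly"
  shows "\<exists>(C :: nat \<Rightarrow> circuit) (m :: nat \<Rightarrow> nat) (\<epsilon> :: nat \<Rightarrow> real) (\<pi> :: nat \<Rightarrow> real).
    RNC2 (input_length p) m C \<and>
    \<epsilon> \<longlonglongrightarrow> 0 \<and> \<pi> \<longlonglongrightarrow> 1 \<and>
    (\<forall>n E w r. sroct_instance p n E w r \<longrightarrow>
       (let out = (\<lambda>\<rho>. circuit_eval (C n) (encode_instance p n E w r @ \<rho>));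
            good = (\<lambda>y. \<exists>T. approx_SROCT (2 + \<epsilon> n) n E w r T \<and> y = encode_answer n (Some T))
        in measure_pmf.prob (random_bits (m n)) {\<rho>. good (out \<rho>)} \<ge> \<pi> n \<and>
           (\<forall>\<rho>. length \<rho> = m n \<longrightarrow> \<not> good (out \<rho>) \<longrightarrow> out \<rho> = encode_answer n None)))"
proof -
  let ?C = "sroct_family (width_factor p)"
  have good: "\<exists>T. approx_SROCT (2 + 0) n E w r T \<and>
      circuit_eval (?C n) (encode_instance p n E w r @ []) = encode_answer n (Some T)"
    if "sroct_instance p n E w r" for n E w r
  proof -
    interpret sroct_run p n E w r by unfold_locales (rule that)
    show ?thesis unfolding circ_eq using circuit_output Y_approx by auto
  qed
  have "random_bits 0 = return_pmf []" by (simp add: random_bits_def pmf_of_set_singleton)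
  then have prob: "measure_pmf.prob (random_bits 0) S = indicator S []" for S by simp
  show ?thesis
  \<comment> \<open>Witnesses: no random bits, error 0 and success probability 1. Every output is
    good, so the clause about failure holds vacuously.\<close>
  proof (rule exI[of _ ?C], rule exI[of _ "\<lambda>_. 0"], rule exI[of _ "\<lambda>_. 0"], rule exI[of _ "\<lambda>_. 1"],
      intro conjI allI impI)
    show "RNC2 (input_length p) (\<lambda>_. 0) ?C" by (rule RNC2_family)
    fix n E w r
    assume "sroct_instance p n E w r"
    from good[OF this] show "let out = (\<lambda>\<rho>. circuit_eval (?C n) (encode_instance p n E w r @ \<rho>));
            good = (\<lambda>y. \<exists>T. approx_SROCT (2 + 0) n E w r T \<and> y = encode_answer n (Some T))
        in measure_pmf.prob (random_bits 0) {\<rho>. good (out \<rho>)} \<ge> 1 \<and>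
           (\<forall>\<rho>. length \<rho> = 0 \<longrightarrow> \<not> good (out \<rho>) \<longrightarrow> out \<rho> = encode_answer n None)"
      unfolding Let_def prob by (simp only: length_0_conv) auto
  qed simp_all
qed

end
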